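(* Let $(G,\sigma,K)$ be a Riemannian symmetric triple and let $P=\exp(\mathfrak{p})$. For almost all cosets $gK$ in $G/K$ (that is, for all $gK$ outside a subset of measure zero of the smooth manifold $G/K$), $gK$ intersects $P$ transversally in $G$.
   Context: A Riemannian symmetric triple $(G,\sigma,K)$ consists of a connected Lie group $G$, an involution $\sigma$ of $G$ (a Lie group automorphism with $\sigma^2=\mathrm{id}$), and the closed subgroup $K=\{g\in G\mid\sigma(g)=g\}$, such that there exists a $G$-invariant Riemannian structure on $G/K$. Let $\mathfrak{g}$ be the Lie algebra of $G$ and $d\sigma$ the differential of $\sigma$ on $\mathfrak{g}$; $\mathfrak{p}$ is the eigenspace of $d\sigma$ with eigenvalue $-1$. The set $P=\exp(\mathfrak{p})$ is a closed (embedded) submanifold of $G$. That $gK$ intersects $P$ transversally means $T_pP+T_p(gK)=T_pG$ for every $p\in gK\cap P$. *)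

theory Defs
  imports
    "HOL-Analysis.Analysis"
    "HOL-Algebra.Left_Coset"
    "HOL-Library.Function_Algebras"
    "HOL-Library.Set_Algebras"
begin

section \<open>Smooth maps between linear subspaces\<close>

text \<open>
  \<open>Ck_on k W S f\<close>: \<open>f\<close> is of class \<open>C\<^sup>k\<close> on \<open>S\<close>, where \<open>S\<close> is relatively open in the linear
  subspace \<open>W\<close>. The derivative of \<open>f\<close> within \<open>W\<close> is unique on directions in \<open>W\<close> only, and only
  those directions are used.
\<close>

primrec Ck_on ::
  "nat \<Rightarrow> 'e::real_normed_vector set \<Rightarrow> 'e set \<Rightarrow> ('e \<Rightarrow> 'f::real_normed_vector) \<Rightarrow> bool"
where
  "Ck_on 0 W S f \<longleftrightarrow> continuous_on S f"
| "Ck_on (Suc k) W S f \<longleftrightarrow>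
     (\<exists>f'. (\<forall>x\<in>S. (f has_derivative f' x) (at x within W)) \<and>
           (\<forall>v\<in>W. Ck_on k W S (\<lambda>x. f' x v)))"

definition smooth_on ::
  "'e::real_normed_vector set \<Rightarrow> 'e set \<Rightarrow> ('e \<Rightarrow> 'f::real_normed_vector) \<Rightarrow> bool"
where
  "smooth_on W S f \<longleftrightarrow> (\<forall>k. Ck_on k W S f)"


section \<open>Smooth manifolds\<close>

text \<open>
  A chart maps an open set \<open>cdom\<close> homeomorphically onto a relatively open subset of a linear
  subspace \<open>cspace\<close> of a Euclidean space; its dimension is \<open>dim cspace\<close>. Using subspaces
  (rather than a whole type of class \<open>euclidean_space\<close>, whose dimension is never \<open>0\<close>)
  admits manifolds of dimension \<open>0\<close>, and lets a quotient of a manifold be modelled in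
  the same ambient type. The values of \<open>cmap\<close> outside \<open>cdom\<close> are irrelevant.
\<close>

record ('a, 'e) chart =
  cdom :: "'a set"
  cspace :: "'e set"
  cmap :: "'a \<Rightarrow> 'e"

record ('a, 'e) manifold =
  mtop :: "'a topology"
  charts :: "('a, 'e) chart set"

definition cinv :: "('a, 'e) chart \<Rightarrow> 'e \<Rightarrow> 'a" where
  "cinv c = inv_into (cdom c) (cmap c)"

definition is_chart :: "'a topology \<Rightarrow> ('a, 'e::euclidean_space) chart \<Rightarrow> bool" where
  "is_chart T c \<longleftrightarrow>
     openin T (cdom c) \<and> subspace (cspace c) \<and>
     openin (top_of_set (cspace c)) (cmap c ` cdom c) \<and>
     homeomorphic_map (subtopology T (cdom c)) (top_of_set (cmap c ` cdom c)) (cmap c)"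

definition smooth_manifold :: "('a, 'e::euclidean_space) manifold \<Rightarrow> bool" where
  "smooth_manifold M \<longleftrightarrow>
     Hausdorff_space (mtop M) \<and> second_countable (mtop M) \<and>
     (\<forall>c\<in>charts M. is_chart (mtop M) c) \<and>
     (\<Union>c\<in>charts M. cdom c) = topspace (mtop M) \<and>
     (\<forall>c\<in>charts M. \<forall>d\<in>charts M.
        smooth_on (cspace c) (cmap c ` (cdom c \<inter> cdom d)) (cmap d \<circ> cinv c))"

definition smooth_map_on ::
  "('a, 'e::euclidean_space) manifold \<Rightarrow> ('b, 'f::euclidean_space) manifold \<Rightarrow>
   'a set \<Rightarrow> ('a \<Rightarrow> 'b) \<Rightarrow> bool"
where
  "smooth_map_on M N U f \<longleftrightarrow>
     openin (mtop M) U \<and> f ` U \<subseteq> topspace (mtop N) \<and>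
     (\<forall>p\<in>U. \<exists>c\<in>charts M. \<exists>d\<in>charts N. \<exists>A.
        openin (mtop M) A \<and> p \<in> A \<and> A \<subseteq> U \<inter> cdom c \<and> f ` A \<subseteq> cdom d \<and>
        smooth_on (cspace c) (cmap c ` A) (cmap d \<circ> f \<circ> cinv c))"

abbreviation smooth_map ::
  "('a, 'e::euclidean_space) manifold \<Rightarrow> ('b, 'f::euclidean_space) manifold \<Rightarrow>
   ('a \<Rightarrow> 'b) \<Rightarrow> bool"
where
  "smooth_map M N f \<equiv> smooth_map_on M N (topspace (mtop M)) f"

definition linear_manifold :: "'e::euclidean_space set \<Rightarrow> ('e, 'e) manifold" where
  "linear_manifold W = \<lparr>mtop = top_of_set W, charts = {\<lparr>cdom = W, cspace = W, cmap = id\<rparr>}\<rparr>"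

abbreviation real_line :: "(real, real) manifold" where
  "real_line \<equiv> linear_manifold UNIV"

definition prod_manifold ::
  "('a, 'e) manifold \<Rightarrow> ('b, 'f) manifold \<Rightarrow> ('a \<times> 'b, 'e \<times> 'f) manifold"
where
  "prod_manifold M N =
     \<lparr>mtop = prod_topology (mtop M) (mtop N),
      charts = {\<lparr>cdom = cdom c \<times> cdom d, cspace = cspace c \<times> cspace d,
                 cmap = map_prod (cmap c) (cmap d)\<rparr> |c d. c \<in> charts M \<and> d \<in> charts N}\<rparr>"

text \<open>
  A null set of a linear subspace \<open>W\<close>, for the Lebesgue measure of \<open>W\<close>: the cylinder over it in
  the direction of the orthogonal complement of \<open>W\<close> is a null set of the ambient space.
\<close>

definition null_in_subspace :: "'e::euclidean_space set \<Rightarrow> 'e set \<Rightarrow> bool" where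
  "null_in_subspace W A \<longleftrightarrow> A \<subseteq> W \<and> negligible (A + orthogonal_comp W)"

definition measure_zero :: "('a, 'e::euclidean_space) manifold \<Rightarrow> 'a set \<Rightarrow> bool" where
  "measure_zero M N \<longleftrightarrow>
     N \<subseteq> topspace (mtop M) \<and>
     (\<forall>c\<in>charts M. null_in_subspace (cspace c) (cmap c ` (N \<inter> cdom c)))"


section \<open>Tangent vectors\<close>

text \<open>
  A tangent vector at \<open>p\<close> is the family of its coordinate representations in all charts around
  \<open>p\<close>, which transform by the derivatives of the transition maps (and, by convention,
  vanish at all other indices). The vector space operations are pointwise.
\<close>

type_synonym ('a, 'e) tvec = "('a, 'e) chart \<Rightarrow> 'e"

definition coord_tvec ::
  "('a, 'e::euclidean_space) manifold \<Rightarrow> ('a, 'e) chart \<Rightarrow> 'a \<Rightarrow> 'e \<Rightarrow> ('a, 'e) tvec"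
where
  "coord_tvec M c p a =
     (\<lambda>d. if d \<in> charts M \<and> p \<in> cdom d
          then frechet_derivative (cmap d \<circ> cinv c) (at (cmap c p) within cspace c) a
          else 0)"

definition tangent_space ::
  "('a, 'e::euclidean_space) manifold \<Rightarrow> 'a \<Rightarrow> ('a, 'e) tvec set"
where
  "tangent_space M p =
     {v. (\<forall>c\<in>charts M. p \<in> cdom c \<longrightarrow> v c \<in> cspace c \<and> v = coord_tvec M c p (v c)) \<and>
         (\<forall>c. \<not> (c \<in> charts M \<and> p \<in> cdom c) \<longrightarrow> v c = 0)}"

text \<open>
  The chart chosen in \<open>differential\<close> does not matter when \<open>f\<close> is smooth near \<open>p\<close> and \<open>v\<close> is tangent
  at \<open>p\<close>.
\<close>

definition differential ::
  "('a, 'e::euclidean_space) manifold \<Rightarrow> ('b, 'f::euclidean_space) manifold \<Rightarrow>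
   ('a \<Rightarrow> 'b) \<Rightarrow> 'a \<Rightarrow> ('a, 'e) tvec \<Rightarrow> ('b, 'f) tvec"
where
  "differential M N f p v =
     (let c = (SOME c. c \<in> charts M \<and> p \<in> cdom c) in
      (\<lambda>d. if d \<in> charts N \<and> f p \<in> cdom d
           then frechet_derivative (cmap d \<circ> f \<circ> cinv c) (at (cmap c p) within cspace c) (v c)
           else 0))"

definition submersion_on ::
  "('a, 'e::euclidean_space) manifold \<Rightarrow> ('b, 'f::euclidean_space) manifold \<Rightarrow>
   'a set \<Rightarrow> ('a \<Rightarrow> 'b) \<Rightarrow> bool"
where
  "submersion_on M N U f \<longleftrightarrow>
     smooth_map_on M N U f \<and>
     (\<forall>p\<in>U. differential M N f p ` tangent_space M p = tangent_space N (f p))"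

definition velocity ::
  "('a, 'e::euclidean_space) manifold \<Rightarrow> (real \<Rightarrow> 'a) \<Rightarrow> real \<Rightarrow> ('a, 'e) tvec"
where
  "velocity M \<gamma> t =
     (\<lambda>c. if c \<in> charts M \<and> \<gamma> t \<in> cdom c then vector_derivative (cmap c \<circ> \<gamma>) (at t) else 0)"

text \<open>
  For an embedded submanifold \<open>S\<close>, the tangent space \<open>T\<^sub>pS\<close>, as a subspace of \<open>T\<^sub>pM\<close>, consists of
  the velocities at \<open>p\<close> of the smooth curves of \<open>M\<close> that run in \<open>S\<close>.
\<close>

definition submanifold_tangent_space ::
  "('a, 'e::euclidean_space) manifold \<Rightarrow> 'a set \<Rightarrow> 'a \<Rightarrow> ('a, 'e) tvec set"
where
  "submanifold_tangent_space M S p =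
     {velocity M \<gamma> 0 |\<gamma>. \<gamma> 0 = p \<and>
        (\<exists>\<epsilon>>0. smooth_map_on real_line M {-\<epsilon><..<\<epsilon>} \<gamma> \<and> \<gamma> ` {-\<epsilon><..<\<epsilon>} \<subseteq> S)}"

definition transversal ::
  "('a, 'e::euclidean_space) manifold \<Rightarrow> 'a set \<Rightarrow> 'a set \<Rightarrow> bool"
where
  "transversal M A B \<longleftrightarrow>
     (\<forall>p\<in>A \<inter> B.
        submanifold_tangent_space M B p + submanifold_tangent_space M A p = tangent_space M p)"

definition riemannian_metric ::
  "('a, 'e::euclidean_space) manifold \<Rightarrow>
   ('a \<Rightarrow> ('a, 'e) tvec \<Rightarrow> ('a, 'e) tvec \<Rightarrow> real) \<Rightarrow> bool"
where
  "riemannian_metric M h \<longleftrightarrow>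
     (\<forall>p\<in>topspace (mtop M). \<forall>u\<in>tangent_space M p. \<forall>v\<in>tangent_space M p.
        h p u v = h p v u \<and>
        (\<forall>w\<in>tangent_space M p. h p (u + w) v = h p u v + h p w v) \<and>
        (\<forall>r. h p (\<lambda>c. r *\<^sub>R u c) v = r * h p u v) \<and>
        (u \<noteq> 0 \<longrightarrow> h p u u > 0)) \<and>
     (\<forall>c\<in>charts M. \<forall>a\<in>cspace c. \<forall>b\<in>cspace c.
        smooth_on (cspace c) (cmap c ` cdom c)
          (\<lambda>y. h (cinv c y) (coord_tvec M c (cinv c y) a) (coord_tvec M c (cinv c y) b)))"


section \<open>Lie groups\<close>

text \<open>A Lie group is an algebraic group together with a smooth structure on its carrier.\<close>

definition lie_group ::
  "('g, 'b) monoid_scheme \<Rightarrow> ('g, 'e::euclidean_space) manifold \<Rightarrow> bool"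
where
  "lie_group G M \<longleftrightarrow>
     group G \<and> smooth_manifold M \<and> topspace (mtop M) = carrier G \<and>
     smooth_map (prod_manifold M M) M (\<lambda>(x, y). x \<otimes>\<^bsub>G\<^esub> y) \<and>
     smooth_map M M (\<lambda>x. inv\<^bsub>G\<^esub> x)"

definition one_parameter_subgroup ::
  "('g, 'b) monoid_scheme \<Rightarrow> ('g, 'e::euclidean_space) manifold \<Rightarrow> (real \<Rightarrow> 'g) \<Rightarrow> bool"
where
  "one_parameter_subgroup G M \<gamma> \<longleftrightarrow>
     smooth_map real_line M \<gamma> \<and> (\<forall>s t. \<gamma> (s + t) = \<gamma> s \<otimes>\<^bsub>G\<^esub> \<gamma> t)"

definition lie_exp ::
  "('g, 'b) monoid_scheme \<Rightarrow> ('g, 'e::euclidean_space) manifold \<Rightarrow> ('g, 'e) tvec \<Rightarrow> 'g"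
where
  "lie_exp G M X =
     (THE g. \<exists>\<gamma>. one_parameter_subgroup G M \<gamma> \<and> velocity M \<gamma> 0 = X \<and> g = \<gamma> 1)"

definition minus_eigenspace ::
  "('g, 'b) monoid_scheme \<Rightarrow> ('g, 'e::euclidean_space) manifold \<Rightarrow> ('g \<Rightarrow> 'g) \<Rightarrow>
   ('g, 'e) tvec set"
where
  "minus_eigenspace G M \<sigma> =
     {X \<in> tangent_space M \<one>\<^bsub>G\<^esub>. differential M M \<sigma> \<one>\<^bsub>G\<^esub> X = - X}"


section \<open>The homogeneous space \<open>G/K\<close>\<close>

definition coset_topology ::
  "('g, 'b) monoid_scheme \<Rightarrow> 'g topology \<Rightarrow> 'g set \<Rightarrow> 'g set topology"
where
  "coset_topology G T K =
     topology (\<lambda>\<U>. \<U> \<subseteq> lcosets\<^bsub>G\<^esub> K \<and> openin T {g \<in> carrier G. g <#\<^bsub>G\<^esub> K \<in> \<U>})"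

lemma openin_coset_topology:
  assumes "topspace T = carrier G"
  shows "openin (coset_topology G T K) \<U> \<longleftrightarrow>
         \<U> \<subseteq> lcosets\<^bsub>G\<^esub> K \<and> openin T {g \<in> carrier G. g <#\<^bsub>G\<^esub> K \<in> \<U>}"
proof -
  have "istopology (\<lambda>\<U>. \<U> \<subseteq> lcosets\<^bsub>G\<^esub> K \<and> openin T {g \<in> carrier G. g <#\<^bsub>G\<^esub> K \<in> \<U>})"
    unfolding istopology_def
  proof (intro conjI allI impI)
    fix S S' :: "'a set set"
    assume S: "S \<subseteq> lcosets\<^bsub>G\<^esub> K \<and> openin T {g \<in> carrier G. g <#\<^bsub>G\<^esub> K \<in> S}"
      and S': "S' \<subseteq> lcosets\<^bsub>G\<^esub> K \<and> openin T {g \<in> carrier G. g <#\<^bsub>G\<^esub> K \<in> S'}"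
    show "S \<inter> S' \<subseteq> lcosets\<^bsub>G\<^esub> K" using S by blast
    have "{g \<in> carrier G. g <#\<^bsub>G\<^esub> K \<in> S \<inter> S'} =
          {g \<in> carrier G. g <#\<^bsub>G\<^esub> K \<in> S} \<inter> {g \<in> carrier G. g <#\<^bsub>G\<^esub> K \<in> S'}" by blast
    then show "openin T {g \<in> carrier G. g <#\<^bsub>G\<^esub> K \<in> S \<inter> S'}" using S S' by auto
  next
    fix \<K> :: "'a set set set"
    assume K: "\<forall>S\<in>\<K>. S \<subseteq> lcosets\<^bsub>G\<^esub> K \<and> openin T {g \<in> carrier G. g <#\<^bsub>G\<^esub> K \<in> S}"
    show "\<Union>\<K> \<subseteq> lcosets\<^bsub>G\<^esub> K" using K by blast
    have "{g \<in> carrier G. g <#\<^bsub>G\<^esub> K \<in> \<Union>\<K>} = (\<Union>S\<in>\<K>. {g \<in> carrier G. g <#\<^bsub>G\<^esub> K \<in> S})" by blast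
    then show "openin T {g \<in> carrier G. g <#\<^bsub>G\<^esub> K \<in> \<Union>\<K>}" using K by auto
  qed
  then show ?thesis by (simp add: coset_topology_def topology_inverse')
qed

text \<open>
  For a closed subgroup \<open>K\<close>, \<open>G/K\<close> carries the quotient topology and the unique smooth structure
  for which the projection \<open>g \<mapsto> gK\<close> is a submersion. The charts below form its maximal
  atlas: they are the local homeomorphisms into subspaces of \<open>'e\<close> whose composition
  with the projection is a submersion.
\<close>

definition coset_manifold ::
  "('g, 'b) monoid_scheme \<Rightarrow> ('g, 'e::euclidean_space) manifold \<Rightarrow> 'g set \<Rightarrow>
   ('g set, 'e) manifold"
where
  "coset_manifold G M K =
     \<lparr>mtop = coset_topology G (mtop M) K,
      charts = {c. is_chart (coset_topology G (mtop M) K) c \<and>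
                   submersion_on M (linear_manifold (cspace c))
                     {g \<in> carrier G. g <#\<^bsub>G\<^esub> K \<in> cdom c} (\<lambda>g. cmap c (g <#\<^bsub>G\<^esub> K))}\<rparr>"

definition invariant_riemannian_metric ::
  "('g, 'b) monoid_scheme \<Rightarrow> ('g, 'e::euclidean_space) manifold \<Rightarrow> 'g set \<Rightarrow>
   ('g set \<Rightarrow> ('g set, 'e) tvec \<Rightarrow> ('g set, 'e) tvec \<Rightarrow> real) \<Rightarrow> bool"
where
  "invariant_riemannian_metric G M K h \<longleftrightarrow>
     riemannian_metric (coset_manifold G M K) h \<and>
     (\<forall>g\<in>carrier G. \<forall>x\<in>lcosets\<^bsub>G\<^esub> K.
        \<forall>u\<in>tangent_space (coset_manifold G M K) x.
        \<forall>v\<in>tangent_space (coset_manifold G M K) x.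
          let L = (\<lambda>y. g <#\<^bsub>G\<^esub> y);
              dL = differential (coset_manifold G M K) (coset_manifold G M K) L x
          in h (L x) (dL u) (dL v) = h x u v)"

definition riemannian_symmetric_triple ::
  "('g, 'b) monoid_scheme \<Rightarrow> ('g, 'e::euclidean_space) manifold \<Rightarrow> ('g \<Rightarrow> 'g) \<Rightarrow> 'g set \<Rightarrow> bool"
where
  "riemannian_symmetric_triple G M \<sigma> K \<longleftrightarrow>
     lie_group G M \<and> connected_space (mtop M) \<and>
     \<sigma> \<in> iso G G \<and> smooth_map M M \<sigma> \<and> (\<forall>g\<in>carrier G. \<sigma> (\<sigma> g) = g) \<and>
     K = {g \<in> carrier G. \<sigma> g = g} \<and>
     (\<exists>h. invariant_riemannian_metric G M K h)"

end

theory Submission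
  imports Defs
begin

text \<open>
  Let \<open>W\<close> be the target of a chart \<open>c\<close> of \<open>G/K\<close> and \<open>h g = c (g K)\<close>. A vector in the kernel of
  \<open>dh\<close> at \<open>g\<close> is the velocity of a curve in \<open>g K\<close>, hence a left translate of a vector fixed by
  \<open>d\<sigma>\<close>; consequently \<open>dim \<pp> \<le> dim W\<close>, and Sard's theorem applies to \<open>h \<circ> exp\<close> on \<open>\<pp>\<close>. Where
  the derivative of \<open>h \<circ> exp\<close> at \<open>a \<in> \<pp>\<close> is onto \<open>W\<close>, every tangent vector at \<open>exp a\<close> is the sum
  of a velocity of \<open>t \<mapsto> exp (a + t Y)\<close> with \<open>Y \<in> \<pp>\<close> and of a kernel vector of \<open>dh\<close>, so that
  \<open>P\<close> and \<open>exp a K\<close> are transversal there.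

  The exponential map is constructed without differential equations. In a chart at the identity,
  the squaring map \<open>s\<close> fixes \<open>0\<close> and has derivative \<open>2\<close> there, so \<open>E x = lim s\<^sup>n (x / 2\<^sup>n)\<close>
  converges and satisfies \<open>E x = s (E (x/2))\<close>. The derivatives of \<open>E\<close> satisfy linear functional
  equations \<open>u x = b x + A x (u (x/2))\<close>, and each differentiation halves the operator \<open>A\<close>; this
  yields smoothness. Since \<open>s\<close> expands by a factor close to \<open>2\<close>, a curve with
  \<open>\<alpha> (2 t) = \<alpha> t \<otimes> \<alpha> t\<close> is determined by its velocity at \<open>0\<close>, which yields the homomorphism
  property of \<open>t \<mapsto> exp (t a)\<close> and the uniqueness of one-parameter subgroups.
\<close>

section \<open>Maps of class \<open>C\<^sup>k\<close> on subspaces\<close>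

text \<open>The dimension bound decides which form of Sard's theorem is needed: when the source has
  at most the dimension of the target, differentiability alone makes the critical values negligible.
  The bound comes from the two eigenvalues of the differential of \<open>\<sigma>\<close>: a vector
  of p whose translate is killed by the derivative of h would also be fixed, hence 0. No manifold
  structure on K is built. Level curves of h yield vectors fixed by the differential, and conversely
  the exponential map sends fixed vectors into K. The converse cannot be skipped: level curves are
  only known to be differentiable at one point, whereas \<open>submanifold_tangent_space\<close>
  asks for smooth curves. \<open>lie_exp\<close> is a definite description over one-parameter
  subgroups, so existence and uniqueness must both be settled before it can be evaluated. The
  functional equation for the derivative of E comes with an operator bound slightly above 1, so
  contraction is not evident. At first order convergence is gained by subtracting the value at 0;
  from then on every differentiation brings its own factor 1/2.\<close>

lemma has_derivative_within_subspace_unique: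
  fixes f :: "'e::real_normed_vector \<Rightarrow> 'f::real_normed_vector"
  assumes "subspace W" "x \<in> W" "(f has_derivative f1) (at x within W)"
    "(f has_derivative f2) (at x within W)" "v \<in> W"
  shows "f1 v = f2 v"
proof -
  \<comment> \<open>Along the line through \<open>x\<close> in direction \<open>v\<close>, which
    stays in \<open>W\<close>, both candidates become derivatives of one function of a real
    variable, where uniqueness holds.\<close>
  have *: "((\<lambda>t. f (x + t *\<^sub>R v)) has_derivative (\<lambda>t. f' (t *\<^sub>R v))) (at (0::real))"
    if "(f has_derivative f') (at x within W)" for f'
  proof -
    have sub: "range (\<lambda>t. x + t *\<^sub>R v) \<subseteq> W"
      using assms by (auto intro: subspace_add subspace_scale)
    have "((\<lambda>t. x + t *\<^sub>R v) has_derivative (\<lambda>t. t *\<^sub>R v)) (at (0::real))"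
      by (auto intro!: derivative_eq_intros)
    moreover have "(f has_derivative f') (at (x + 0 *\<^sub>R v) within range (\<lambda>t. x + t *\<^sub>R v))"
      using has_derivative_subset[OF that sub] by simp
    ultimately show ?thesis
      using has_derivative_in_compose[of "\<lambda>t. x + t *\<^sub>R v" "\<lambda>t. t *\<^sub>R v" "0::real" UNIV f f'] by simp
  qed
  have "(\<lambda>t::real. f1 (t *\<^sub>R v)) = (\<lambda>t. f2 (t *\<^sub>R v))"
    using has_derivative_unique[OF *[OF assms(3)] *[OF assms(4)]] .
  then show ?thesis by (metis scaleR_one)
qed

lemma frechet_derivative_within_subspace:
  assumes "subspace W" "x \<in> W" "(f has_derivative f') (at x within W)" "v \<in> W"
  shows "frechet_derivative f (at x within W) v = f' v"
proof -
  have "(f has_derivative frechet_derivative f (at x within W)) (at x within W)"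
    using assms(3) by (metis differentiableI frechet_derivative_works)
  then show ?thesis by (rule has_derivative_within_subspace_unique[OF assms(1,2) _ assms(3,4)])
qed

lemma at_within_relopen:
  assumes "openin (top_of_set W) S" "x \<in> S"
  shows "at x within W = at x within S"
proof -
  obtain T where T: "open T" "S = W \<inter> T" using assms(1) by (auto simp: openin_open)
  show ?thesis
    by (rule at_within_nhd[of x T]) (use T assms(2) in auto)
qed

lemma has_derivative_transform_relopen:
  assumes "openin (top_of_set W) S" "x \<in> S" "\<And>y. y \<in> S \<Longrightarrow> f y = g y"
    "(f has_derivative f') (at x within W)"
  shows "(g has_derivative f') (at x within W)"
proof -
  have "(f has_derivative f') (at x within S)"
    using assms(4) unfolding at_within_relopen[OF assms(1,2)] .
  then have "(g has_derivative f') (at x within S)"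
    by (rule has_derivative_transform[OF assms(2), rotated]) (use assms(3) in auto)
  then show ?thesis unfolding at_within_relopen[OF assms(1,2)] .
qed

lemma Ck_on_cong:
  assumes "openin (top_of_set W) S" "\<And>x. x \<in> S \<Longrightarrow> f x = g x" "Ck_on k W S f"
  shows "Ck_on k W S g"
proof (cases k)
  case 0
  then show ?thesis using assms continuous_on_cong[of S S f g] by auto
next
  case (Suc j)
  then obtain f' where f': "\<forall>x\<in>S. (f has_derivative f' x) (at x within W)"
    "\<forall>v\<in>W. Ck_on j W S (\<lambda>x. f' x v)" using assms(3) by auto
  have "\<forall>x\<in>S. (g has_derivative f' x) (at x within W)"
  proof
    fix x assume x: "x \<in> S"
    show "(g has_derivative f' x) (at x within W)"
      using has_derivative_transform_relopen[OF assms(1) x assms(2) f'(1)[rule_format, OF x]] .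
  qed
  then show ?thesis unfolding Suc Ck_on.simps using f'(2) by blast
qed

lemma Ck_on_imp_continuous_on:
  assumes "Ck_on k W S f" "S \<subseteq> W"
  shows "continuous_on S f"
proof (cases k)
  case (Suc j)
  then obtain f' where f': "\<forall>x\<in>S. (f has_derivative f' x) (at x within W)" using assms(1) by auto
  then show ?thesis
    using assms(2) by (meson continuous_on_eq_continuous_within continuous_within_subset has_derivative_continuous)
qed (use assms in auto)

lemma Ck_on_SucD: "Ck_on (Suc k) W S f \<Longrightarrow> S \<subseteq> W \<Longrightarrow> Ck_on k W S f"
proof (induction k arbitrary: f)
  case 0
  then show ?case using Ck_on_imp_continuous_on[OF 0] by simp
next
  case (Suc k)
  then obtain f' where f': "\<forall>x\<in>S. (f has_derivative f' x) (at x within W)"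
    "\<forall>v\<in>W. Ck_on (Suc k) W S (\<lambda>x. f' x v)" by auto
  then have "\<forall>v\<in>W. Ck_on k W S (\<lambda>x. f' x v)" using Suc by blast
  then show ?case using f'(1) by auto
qed

lemma Ck_on_subset: "Ck_on k W S f \<Longrightarrow> T \<subseteq> S \<Longrightarrow> Ck_on k W T f"
proof (induction k arbitrary: f)
  case 0
  then show ?case by (auto intro: continuous_on_subset)
next
  case (Suc k)
  then obtain f' where f': "\<forall>x\<in>S. (f has_derivative f' x) (at x within W)"
    "\<forall>v\<in>W. Ck_on k W S (\<lambda>x. f' x v)" by auto
  then show ?case using Suc by (auto intro!: exI[of _ f'])
qed

lemma Ck_on_const: "Ck_on k W S (\<lambda>x. c)"
  by (induction k arbitrary: c) (auto intro!: exI[of _ "\<lambda>_ _. 0"])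

lemma Ck_on_bounded_linear: "bounded_linear L \<Longrightarrow> Ck_on k W S L"
proof (cases k)
  case (Suc j)
  assume L: "bounded_linear L"
  have "\<forall>x\<in>S. (L has_derivative L) (at x within W)"
    using L bounded_linear_imp_has_derivative by blast
  then show ?thesis using Suc Ck_on_const by (auto intro!: exI[of _ "\<lambda>x. L"])
qed (auto intro: linear_continuous_on)

lemma Ck_on_linear_comp:
  "bounded_linear L \<Longrightarrow> Ck_on k W S f \<Longrightarrow> Ck_on k W S (\<lambda>x. L (f x))"
proof (induction k arbitrary: f)
  case 0
  then show ?case by (auto intro: bounded_linear.continuous_on)
next
  case (Suc k)
  then obtain f' where f': "\<forall>x\<in>S. (f has_derivative f' x) (at x within W)"
    "\<forall>v\<in>W. Ck_on k W S (\<lambda>x. f' x v)" by auto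
  have "\<forall>x\<in>S. ((\<lambda>x. L (f x)) has_derivative (\<lambda>v. L (f' x v))) (at x within W)"
    using f'(1) bounded_linear.has_derivative[OF Suc.prems(1)] by blast
  then show ?case using f'(2) Suc by (auto intro!: exI[of _ "\<lambda>x v. L (f' x v)"])
qed

lemma Ck_on_add: "Ck_on k W S f \<Longrightarrow> Ck_on k W S g \<Longrightarrow> Ck_on k W S (\<lambda>x. f x + g x)"
proof (induction k arbitrary: f g)
  case 0
  then show ?case by (auto intro: continuous_on_add)
next
  case (Suc k)
  obtain f' where f': "\<forall>x\<in>S. (f has_derivative f' x) (at x within W)"
    "\<forall>v\<in>W. Ck_on k W S (\<lambda>x. f' x v)" using Suc.prems by auto
  obtain g' where g': "\<forall>x\<in>S. (g has_derivative g' x) (at x within W)"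
    "\<forall>v\<in>W. Ck_on k W S (\<lambda>x. g' x v)" using Suc.prems by auto
  have "\<forall>x\<in>S. ((\<lambda>x. f x + g x) has_derivative (\<lambda>v. f' x v + g' x v)) (at x within W)"
    using f'(1) g'(1) by (auto intro: has_derivative_add)
  then show ?case using f'(2) g'(2) Suc.IH by (auto intro!: exI[of _ "\<lambda>x v. f' x v + g' x v"])
qed

lemma Ck_on_minus: "Ck_on k W S f \<Longrightarrow> Ck_on k W S (\<lambda>x. - f x)"
  using Ck_on_linear_comp[OF bounded_linear_minus[OF bounded_linear_ident]] .

lemma Ck_on_diff: "Ck_on k W S f \<Longrightarrow> Ck_on k W S g \<Longrightarrow> Ck_on k W S (\<lambda>x. f x - g x)"
  using Ck_on_add[OF _ Ck_on_minus, of k W S f g] by simp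

lemma Ck_on_sum:
  "(\<And>i. i \<in> I \<Longrightarrow> Ck_on k W S (f i)) \<Longrightarrow> Ck_on k W S (\<lambda>x. \<Sum>i\<in>I. f i x)"
  by (induction I rule: infinite_finite_induct) (auto intro: Ck_on_const Ck_on_add)

lemma Ck_on_bilinear:
  assumes B: "bounded_bilinear B" and "S \<subseteq> W"
  shows "Ck_on k W S f \<Longrightarrow> Ck_on k W S g \<Longrightarrow> Ck_on k W S (\<lambda>x. B (f x) (g x))"
proof (induction k arbitrary: f g)
  case 0
  then show ?case by (auto intro: bounded_bilinear.continuous_on[OF B])
next
  case (Suc k)
  obtain f' where f': "\<forall>x\<in>S. (f has_derivative f' x) (at x within W)"
    "\<forall>v\<in>W. Ck_on k W S (\<lambda>x. f' x v)" using Suc.prems by auto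
  obtain g' where g': "\<forall>x\<in>S. (g has_derivative g' x) (at x within W)"
    "\<forall>v\<in>W. Ck_on k W S (\<lambda>x. g' x v)" using Suc.prems by auto
  have fk: "Ck_on k W S f" "Ck_on k W S g" using Suc.prems Ck_on_SucD \<open>S \<subseteq> W\<close> by blast+
  have "\<forall>x\<in>S. ((\<lambda>x. B (f x) (g x)) has_derivative (\<lambda>v. B (f x) (g' x v) + B (f' x v) (g x)))
      (at x within W)"
    using f'(1) g'(1) by (auto intro: bounded_bilinear.FDERIV[OF B])
  then show ?case using f'(2) g'(2) fk Suc.IH
    by (auto intro!: exI[of _ "\<lambda>x v. B (f x) (g' x v) + B (f' x v) (g x)"] Ck_on_add)
qed

lemma Ck_on_Pair: "Ck_on k W S f \<Longrightarrow> Ck_on k W S g \<Longrightarrow> Ck_on k W S (\<lambda>x. (f x, g x))"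
proof (induction k arbitrary: f g)
  case 0
  then show ?case by (auto intro: continuous_on_Pair)
next
  case (Suc k)
  obtain f' where f': "\<forall>x\<in>S. (f has_derivative f' x) (at x within W)"
    "\<forall>v\<in>W. Ck_on k W S (\<lambda>x. f' x v)" using Suc.prems by auto
  obtain g' where g': "\<forall>x\<in>S. (g has_derivative g' x) (at x within W)"
    "\<forall>v\<in>W. Ck_on k W S (\<lambda>x. g' x v)" using Suc.prems by auto
  have "\<forall>x\<in>S. ((\<lambda>x. (f x, g x)) has_derivative (\<lambda>v. (f' x v, g' x v))) (at x within W)"
    using f'(1) g'(1) by (auto intro: has_derivative_Pair)
  then show ?case using f'(2) g'(2) Suc.IH by (auto intro!: exI[of _ "\<lambda>x v. (f' x v, g' x v)"])
qed

text \<open>The orthogonal projection onto \<open>W\<close>. Derivatives within \<open>W\<close> are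
  determined on \<open>W\<close> only; precomposing with this total linear map makes the standard
  basis and operator bounds of the whole type applicable to them.\<close>

definition subspace_proj :: "'e::euclidean_space set \<Rightarrow> 'e \<Rightarrow> 'e" where
  "subspace_proj W = (SOME P. linear P \<and> range P \<subseteq> W \<and> (\<forall>y\<in>W. P y = y) \<and>
     (\<forall>y. \<forall>w\<in>W. orthogonal (y - P y) w))"

lemma subspace_proj:
  fixes W :: "'e::euclidean_space set"
  assumes "subspace W"
  shows linear_subspace_proj: "linear (subspace_proj W)"
    and subspace_proj_in: "subspace_proj W y \<in> W"
    and subspace_proj_id: "y \<in> W \<Longrightarrow> subspace_proj W y = y"
    and subspace_proj_orthogonal: "w \<in> W \<Longrightarrow> orthogonal (y - subspace_proj W y) w"
    and norm_subspace_proj_le: "norm (subspace_proj W y) \<le> norm y"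
proof -
  have "\<exists>P. linear P \<and> range P \<subseteq> W \<and> (\<forall>y\<in>W. P y = y) \<and> (\<forall>y. \<forall>w\<in>W. orthogonal (y - P y) w)"
  proof -
    obtain B where B: "B \<subseteq> W" "pairwise orthogonal B" "\<And>x. x \<in> B \<Longrightarrow> norm x = 1"
      "independent B" "span B = W"
      using orthonormal_basis_subspace[OF assms] by metis
    have fin: "finite B" using B(4) independent_imp_finite by blast
    define P where "P = (\<lambda>y. \<Sum>b\<in>B. (y \<bullet> b) *\<^sub>R b)"
    have lin: "linear P" unfolding P_def
      by (intro linear_compose_sum ballI) (auto intro!: linearI simp: inner_add_left algebra_simps)
    have range: "P y \<in> W" for y
      unfolding P_def B(5)[symmetric] by (intro span_sum span_scale span_base)
    have orth: "orthogonal (y - P y) w" if "w \<in> W" for y w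
    proof -
      have "orthogonal (y - P y) b" if "b \<in> B" for b
      proof -
        have "(\<Sum>c\<in>B. (y \<bullet> c) * (c \<bullet> b)) = (\<Sum>c\<in>B. if c = b then y \<bullet> b else 0)"
          using B(2,3) that by (intro sum.cong) (auto simp: pairwise_def orthogonal_def norm_eq_1)
        then show ?thesis using fin that
          by (simp add: P_def orthogonal_def inner_diff_left inner_sum_left)
      qed
      then show ?thesis using orthogonal_to_span that B(5) by blast
    qed
    have id: "P y = y" if "y \<in> W" for y
    proof -
      have "y - P y \<in> W" using that range assms subspace_diff by blast
      then have "orthogonal (y - P y) (y - P y)" by (rule orth)
      then show ?thesis by (simp add: orthogonal_self)
    qed
    show ?thesis using lin range orth id by (intro exI[of _ P]) blast
  qed
  from someI_ex[OF this] have P: "linear (subspace_proj W) \<and> range (subspace_proj W) \<subseteq> W \<and>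
    (\<forall>y\<in>W. subspace_proj W y = y) \<and> (\<forall>y. \<forall>w\<in>W. orthogonal (y - subspace_proj W y) w)"
    unfolding subspace_proj_def .
  show "linear (subspace_proj W)" using P by blast
  show in_W: "subspace_proj W y \<in> W" using P by blast
  show "subspace_proj W y = y" if "y \<in> W" using P that by blast
  show "orthogonal (y - subspace_proj W y) w" if "w \<in> W" for w using P that by blast
  from this[OF in_W] have "(norm y)\<^sup>2 = (norm (y - subspace_proj W y))\<^sup>2 + (norm (subspace_proj W y))\<^sup>2"
    using norm_add_Pythagorean[of "y - subspace_proj W y" "subspace_proj W y"] by simp
  then have "(norm (subspace_proj W y))\<^sup>2 \<le> (norm y)\<^sup>2" by simp
  then show "norm (subspace_proj W y) \<le> norm y" using norm_ge_zero by (rule power2_le_imp_le)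
qed

lemma bounded_linear_subspace_proj: "subspace W \<Longrightarrow> bounded_linear (subspace_proj W)"
  for W :: "'e::euclidean_space set"
  using linear_subspace_proj linear_conv_bounded_linear by blast

text \<open>The projected standard basis spans \<open>W\<close>, so sums over \<open>Basis\<close>
  can be used with directions that lie in \<open>W\<close>, without choosing a basis of
  \<open>W\<close>.\<close>

lemma subspace_proj_expansion:
  fixes W :: "'e::euclidean_space set"
  assumes W: "subspace W" and y: "y \<in> W"
  shows "(\<Sum>i\<in>Basis. (y \<bullet> i) *\<^sub>R subspace_proj W i) = y"
proof -
  have "subspace_proj W (\<Sum>i\<in>Basis. (y \<bullet> i) *\<^sub>R i) = (\<Sum>i\<in>Basis. (y \<bullet> i) *\<^sub>R subspace_proj W i)"
    using linear_subspace_proj[OF W] by (simp add: linear_sum linear_scale)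
  then show ?thesis using subspace_proj_id[OF W y] by (simp only: euclidean_representation)
qed

text \<open>The component of \<open>f\<close> orthogonal to \<open>W'\<close> is constantly 0 on the
  relatively open set \<open>S\<close>, hence so is its derivative in directions of
  \<open>W\<close>.\<close>

lemma has_derivative_value_in_subspace:
  fixes f :: "'e::euclidean_space \<Rightarrow> 'f::euclidean_space"
  assumes "subspace W" "subspace W'" "openin (top_of_set W) S" "x \<in> S" "f ` S \<subseteq> W'"
    "(f has_derivative f') (at x within W)" "v \<in> W"
  shows "f' v \<in> W'"
proof -
  have xW: "x \<in> W" using assms openin_imp_subset by blast
  define P where "P = (\<lambda>y. y - subspace_proj W' y)"
  have P: "bounded_linear P"
    unfolding P_def by (intro bounded_linear_sub bounded_linear_ident bounded_linear_subspace_proj assms(2))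
  have P0: "P y = 0" if "y \<in> W'" for y using subspace_proj_id[OF assms(2) that] by (simp add: P_def)
  have PW: "y \<in> W'" if "P y = 0" for y
    using that subspace_proj_in[OF assms(2), of y] by (simp add: P_def)
  have "((\<lambda>y. P (f y)) has_derivative (\<lambda>v. P (f' v))) (at x within W)"
    using bounded_linear.has_derivative[OF P assms(6)] .
  then have "((\<lambda>y. 0) has_derivative (\<lambda>v. P (f' v))) (at x within W)"
    by (rule has_derivative_transform_relopen[OF assms(3,4), rotated]) (use assms(5) P0 in auto)
  then have "P (f' v) = 0"
    using has_derivative_within_subspace_unique[OF assms(1) xW, of "\<lambda>y. 0" _ "\<lambda>v. 0" v] assms(7) by simp
  then show ?thesis using PW by simp
qed

text \<open>The chain rule gives \<open>g' (f x) (f' x v)\<close>, whose direction moves with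
  \<open>x\<close>, while \<open>Ck_on\<close> speaks of fixed directions. Expanding the moving
  direction in the projected basis turns the expression into a sum of products of functions of class
  \<open>C\<^sup>k\<close>.\<close>

lemma Ck_on_compose:
  fixes f :: "'e::euclidean_space \<Rightarrow> 'f::euclidean_space" and g :: "'f \<Rightarrow> 'h::real_normed_vector"
  assumes W: "subspace W" "subspace W'" and S: "openin (top_of_set W) S" and S': "S' \<subseteq> W'" "f ` S \<subseteq> S'"
  shows "Ck_on k W S f \<Longrightarrow> Ck_on k W' S' g \<Longrightarrow> Ck_on k W S (\<lambda>x. g (f x))"
proof (induction k arbitrary: g)
  case 0
  then show ?case using S' by (auto intro: continuous_on_compose2)
next
  case (Suc k)
  have SW: "S \<subseteq> W" using S openin_imp_subset by blast
  obtain f' where f': "\<forall>x\<in>S. (f has_derivative f' x) (at x within W)"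
    "\<forall>v\<in>W. Ck_on k W S (\<lambda>x. f' x v)" using Suc.prems by auto
  obtain g' where g': "\<forall>x\<in>S'. (g has_derivative g' x) (at x within W')"
    "\<forall>v\<in>W'. Ck_on k W' S' (\<lambda>x. g' x v)" using Suc.prems by auto
  have fv: "f' x v \<in> W'" if "x \<in> S" "v \<in> W" for x v
  proof (rule has_derivative_value_in_subspace[OF W S that(1) _ _ that(2)])
    show "f ` S \<subseteq> W'" using S' by simp
    show "(f has_derivative f' x) (at x within W)" using f'(1) that(1) by simp
  qed
  have d: "((\<lambda>x. g (f x)) has_derivative (\<lambda>v. g' (f x) (f' x v))) (at x within W)" if x: "x \<in> S" for x
  proof -
    have "(f has_derivative f' x) (at x within W)" using f'(1) x by blast
    then have 1: "(f has_derivative f' x) (at x within S)" unfolding at_within_relopen[OF S x] .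
    have "(g has_derivative g' (f x)) (at (f x) within f ` S)"
      by (rule has_derivative_subset[of _ _ _ W']) (use g'(1) x S' in auto)
    from has_derivative_in_compose[OF 1 this] show ?thesis unfolding at_within_relopen[OF S x] .
  qed
  have fk: "Ck_on k W S f" using Suc.prems Ck_on_SucD SW by blast
  have c: "Ck_on k W S (\<lambda>x. g' (f x) (f' x v))" if v: "v \<in> W" for v
  proof (rule Ck_on_cong[OF S])
    show "Ck_on k W S (\<lambda>x. \<Sum>i\<in>Basis. (f' x v \<bullet> i) *\<^sub>R g' (f x) (subspace_proj W' i))"
      using v fk g'(2) f'(2) subspace_proj_in[OF W(2)]
      by (intro Ck_on_sum Ck_on_bilinear[OF bounded_bilinear_scaleR SW] Suc.IH
          Ck_on_linear_comp[OF bounded_linear_inner_left]) auto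
    fix x assume x: "x \<in> S"
    then have "linear (g' (f x))" using g'(1) S'(2) has_derivative_linear by blast
    then have "(\<Sum>i\<in>Basis. (f' x v \<bullet> i) *\<^sub>R g' (f x) (subspace_proj W' i)) =
        g' (f x) (\<Sum>i\<in>Basis. (f' x v \<bullet> i) *\<^sub>R subspace_proj W' i)"
      by (simp add: linear_sum linear_scale)
    then show "(\<Sum>i\<in>Basis. (f' x v \<bullet> i) *\<^sub>R g' (f x) (subspace_proj W' i)) = g' (f x) (f' x v)"
      unfolding subspace_proj_expansion[OF W(2) fv[OF x v]] .
  qed
  show ?case unfolding Ck_on.simps
  proof (rule exI[of _ "\<lambda>x v. g' (f x) (f' x v)"], rule conjI)
    show "\<forall>x\<in>S. ((\<lambda>x. g (f x)) has_derivative (\<lambda>v. g' (f x) (f' x v))) (at x within W)"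
      using d by (rule ballI)
    show "\<forall>v\<in>W. Ck_on k W S (\<lambda>x. g' (f x) (f' x v))" using c by (rule ballI)
  qed
qed

text \<open>Derivatives found on different neighbourhoods agree on \<open>W\<close>, so a single
  pointwise choice \<open>f'\<close> coincides on each neighbourhood with the local derivative and
  inherits its regularity.\<close>

lemma Ck_on_local:
  assumes W: "subspace W" and "\<And>x. x \<in> S \<Longrightarrow> \<exists>T. openin (top_of_set W) T \<and> x \<in> T \<and> Ck_on k W T f"
  shows "Ck_on k W S f"
  using assms(2)
proof (induction k arbitrary: f S)
  case 0
  have "S \<subseteq> W"
  proof
    fix y assume "y \<in> S"
    from 0[OF this] obtain T where T: "openin (top_of_set W) T \<and> y \<in> T \<and> Ck_on 0 W T f" ..
    then have "T \<subseteq> W" by (intro openin_imp_subset) (rule conjunct1)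
    then show "y \<in> W" using T by (metis subsetD)
  qed
  have "continuous (at x within S) f" if x: "x \<in> S" for x
  proof -
    from 0[OF x] obtain T where T: "openin (top_of_set W) T \<and> x \<in> T \<and> Ck_on 0 W T f" ..
    then have T1: "openin (top_of_set W) T" and T2: "x \<in> T" and T3: "continuous_on T f"
      by (simp_all only: Ck_on.simps)
    have "continuous (at x within T) f"
      using T2 T3 by (simp only: continuous_on_eq_continuous_within)
    then have "continuous (at x within W) f" unfolding at_within_relopen[OF T1 T2] .
    then show ?thesis by (rule continuous_within_subset[OF _ \<open>S \<subseteq> W\<close>])
  qed
  then show ?case by (simp only: Ck_on.simps continuous_on_eq_continuous_within) blast
next
  case (Suc k)
  define f' where "f' x = (SOME f'. (f has_derivative f') (at x within W))" for x
  have f': "(f has_derivative f' x) (at x within W)"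
    if "(f has_derivative g') (at x within W)" for x g'
    unfolding f'_def
    by (rule someI[where P = "\<lambda>f'. (f has_derivative f') (at x within W)", OF that])
  have "Ck_on k W S (\<lambda>x. f' x v)" if v: "v \<in> W" for v
  proof (rule Suc.IH)
    fix x assume "x \<in> S"
    then obtain T where T: "openin (top_of_set W) T" "x \<in> T" "Ck_on (Suc k) W T f" using Suc.prems by blast
    then obtain g' where g': "\<forall>x\<in>T. (f has_derivative g' x) (at x within W)"
      "\<forall>v\<in>W. Ck_on k W T (\<lambda>x. g' x v)" by auto
    have "Ck_on k W T (\<lambda>x. f' x v)"
    proof (rule Ck_on_cong[OF T(1)])
      fix y assume y: "y \<in> T"
      then have "y \<in> W" using T openin_imp_subset by blast
      then show "g' y v = f' y v"
        using has_derivative_within_subspace_unique[OF W _ g'(1)[rule_format, OF y]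
            f'[OF g'(1)[rule_format, OF y]] v] by simp
    qed (use g'(2) v in blast)
    then show "\<exists>T. openin (top_of_set W) T \<and> x \<in> T \<and> Ck_on k W T (\<lambda>x. f' x v)" using T by blast
  qed
  moreover have "(f has_derivative f' x) (at x within W)" if "x \<in> S" for x
    using Suc.prems[OF that] f' by auto
  ultimately show ?case unfolding Ck_on.simps by blast
qed

lemma smooth_onD: "smooth_on W S f \<Longrightarrow> Ck_on k W S f" by (simp add: smooth_on_def)

text \<open>For every order \<open>smooth_on\<close> may supply a different derivative; uniqueness
  in directions of \<open>W\<close> merges them into one that works for all orders.\<close>

lemma smooth_on_obtain_derivative:
  assumes W: "subspace W" and S: "openin (top_of_set W) S" and f: "smooth_on W S f"
  obtains f' where "\<And>x. x \<in> S \<Longrightarrow> (f has_derivative f' x) (at x within W)"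
    "\<And>v. v \<in> W \<Longrightarrow> smooth_on W S (\<lambda>x. f' x v)"
proof -
  have SW: "S \<subseteq> W" using S openin_imp_subset by blast
  obtain f' where f': "\<forall>x\<in>S. (f has_derivative f' x) (at x within W)"
    using smooth_onD[OF f, of "Suc 0"] by auto
  have "smooth_on W S (\<lambda>x. f' x v)" if v: "v \<in> W" for v
    unfolding smooth_on_def
  proof
    fix k
    obtain g' where g': "\<forall>x\<in>S. (f has_derivative g' x) (at x within W)"
      "\<forall>v\<in>W. Ck_on k W S (\<lambda>x. g' x v)" using smooth_onD[OF f, of "Suc k"] by auto
    have "g' x v = f' x v" if x: "x \<in> S" for x
      using has_derivative_within_subspace_unique[OF W _ g'(1)[rule_format, OF x]
          f'[rule_format, OF x] v] x SW by blast
    then show "Ck_on k W S (\<lambda>x. f' x v)" by (rule Ck_on_cong[OF S _ g'(2)[rule_format, OF v]])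
  qed
  with f' show thesis by (intro that[of f']) auto
qed

section \<open>Linearization of a smooth map with derivative 2 at a fixed point\<close>

text \<open>On \<open>W\<close> the map \<open>f\<close> equals its composition with the projection,
  so its derivative can be normalised to vanish on the orthogonal complement of \<open>W\<close>.
  Bounds valid for all vectors of the type then become available.\<close>

lemma has_derivative_within_subspace_proj:
  fixes W :: "'e::euclidean_space set"
  assumes W: "subspace W" and x: "x \<in> W" and f: "(f has_derivative f') (at x within W)"
  shows "(f has_derivative (\<lambda>v. f' (subspace_proj W v))) (at x within W)"
proof -
  let ?P = "subspace_proj W"
  have P: "(?P has_derivative ?P) (at x within W)"
    using bounded_linear_imp_has_derivative[OF bounded_linear_subspace_proj[OF W]] .
  have im: "?P ` W \<subseteq> W" using subspace_proj_in[OF W] by blast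
  have "(f has_derivative f') (at (?P x) within ?P ` W)"
    using has_derivative_subset[OF f im] subspace_proj_id[OF W x] by simp
  from has_derivative_in_compose[OF P this]
  have "((\<lambda>x. f (?P x)) has_derivative (\<lambda>v. f' (?P v))) (at x within W)" .
  then show ?thesis
    by (rule has_derivative_transform[OF x, rotated]) (simp add: subspace_proj_id[OF W])
qed

lemma linear_norm_le_sum_Basis:
  fixes L :: "'e::euclidean_space \<Rightarrow> 'f::real_normed_vector"
  assumes "linear L" "\<And>i. i \<in> Basis \<Longrightarrow> norm (L i) \<le> c i"
  shows "norm (L v) \<le> (\<Sum>i\<in>Basis. c i) * norm v"
proof -
  have "norm (L v) = norm (L (\<Sum>i\<in>Basis. (v \<bullet> i) *\<^sub>R i))" by (simp only: euclidean_representation)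
  also have "\<dots> = norm (\<Sum>i\<in>Basis. (v \<bullet> i) *\<^sub>R L i)"
    using assms(1) by (simp add: linear_sum linear_scale)
  also have "\<dots> \<le> (\<Sum>i\<in>Basis. norm v * c i)"
  proof (rule sum_norm_le)
    fix i :: 'e assume i: "i \<in> Basis"
    show "norm ((v \<bullet> i) *\<^sub>R L i) \<le> norm v * c i"
      using Basis_le_norm[OF i, of v] assms(2)[OF i] by (auto intro!: mult_mono)
  qed
  also have "\<dots> = (\<Sum>i\<in>Basis. c i) * norm v" by (simp add: sum_distrib_left mult.commute)
  finally show ?thesis .
qed

text \<open>Continuity of \<open>f'\<close> is available for each fixed direction only; finitely
  many basis directions suffice for a bound uniform in \<open>v\<close>.\<close>

lemma compact_directional_bound:
  fixes f' :: "'e::euclidean_space \<Rightarrow> 'e \<Rightarrow> 'f::real_normed_vector"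
  assumes "compact K" "\<And>x. x \<in> K \<Longrightarrow> linear (f' x)" "\<And>v. continuous_on K (\<lambda>x. f' x v)"
  obtains C where "C \<ge> 0" "\<And>x v. x \<in> K \<Longrightarrow> norm (f' x v) \<le> C * norm v"
proof -
  have "\<exists>c. \<forall>x\<in>K. norm (f' x i) \<le> c" for i
  proof -
    have "bounded ((\<lambda>x. f' x i) ` K)"
      using compact_continuous_image[OF assms(3) assms(1)] compact_imp_bounded by blast
    then show ?thesis unfolding bounded_iff by blast
  qed
  then obtain c where c: "\<And>i x. x \<in> K \<Longrightarrow> norm (f' x i) \<le> c i" by metis
  have "norm (f' x v) \<le> (\<Sum>i\<in>Basis. \<bar>c i\<bar>) * norm v" if "x \<in> K" for x v
    using c[OF that] by (intro linear_norm_le_sum_Basis assms(2)[OF that]) (meson abs_ge_self order_trans)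
  then show thesis by (intro that[of "\<Sum>i\<in>Basis. \<bar>c i\<bar>"]) (auto intro: sum_nonneg)
qed

lemma Ck_on_Suc_derivative:
  fixes f :: "'e::euclidean_space \<Rightarrow> 'f::real_normed_vector"
  assumes W: "subspace W" and S: "S \<subseteq> W" and f: "Ck_on (Suc k) W S f"
  obtains f' where "\<And>x. x \<in> S \<Longrightarrow> (f has_derivative f' x) (at x within W)"
    "\<And>v. Ck_on k W S (\<lambda>x. f' x v)"
    "\<And>x v. f' x v = f' x (subspace_proj W v)"
proof -
  obtain f0 where f0: "\<forall>x\<in>S. (f has_derivative f0 x) (at x within W)"
    "\<forall>v\<in>W. Ck_on k W S (\<lambda>x. f0 x v)" using f by auto
  show thesis
  proof (rule that[of "\<lambda>x v. f0 x (subspace_proj W v)"])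
    show "(f has_derivative (\<lambda>v. f0 x (subspace_proj W v))) (at x within W)" if "x \<in> S" for x
      using has_derivative_within_subspace_proj[OF W] that S f0(1) by blast
    show "Ck_on k W S (\<lambda>x. f0 x (subspace_proj W v))" for v
      using f0(2) subspace_proj_in[OF W] by blast
  qed (simp add: subspace_proj_id[OF W subspace_proj_in[OF W]])
qed

lemma relopen_ball: "openin (top_of_set V) (V \<inter> ball 0 R)"
  by (simp add: openin_open_Int)

text \<open>Mean value inequality on the convex compact set \<open>V \<inter> cball 0 r\<close>,
  which the gap \<open>r < R\<close> keeps inside the domain of \<open>f\<close>.\<close>

lemma Ck_on_Suc_Lipschitz:
  fixes f :: "'e::euclidean_space \<Rightarrow> 'f::real_normed_vector"
  assumes V: "subspace V" and f: "Ck_on (Suc 0) V (V \<inter> ball 0 R) f" and r: "r < R"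
  obtains C where "C \<ge> 0"
    "\<And>x y. x \<in> V \<inter> cball 0 r \<Longrightarrow> y \<in> V \<inter> cball 0 r \<Longrightarrow> norm (f x - f y) \<le> C * norm (x - y)"
proof -
  let ?K = "V \<inter> cball 0 r"
  have KB: "?K \<subseteq> V \<inter> ball 0 R" using r by auto
  obtain f' where f': "\<And>x. x \<in> V \<inter> ball 0 R \<Longrightarrow> (f has_derivative f' x) (at x within V)"
    "\<And>v. Ck_on 0 V (V \<inter> ball 0 R) (\<lambda>x. f' x v)"
    using Ck_on_Suc_derivative[OF V _ f] by (metis Int_lower1)
  have "compact ?K" using closed_subspace[OF V] compact_Int_closed[of "cball 0 r" V]
    by (simp add: Int_commute)
  moreover have "linear (f' x)" if "x \<in> ?K" for x
    using f'(1) that KB has_derivative_linear by blast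
  moreover have "continuous_on ?K (\<lambda>x. f' x v)" for v
    using f'(2)[of v] continuous_on_subset[OF _ KB] by simp
  ultimately obtain C where C: "C \<ge> 0" "\<And>x v. x \<in> ?K \<Longrightarrow> norm (f' x v) \<le> C * norm v"
    using compact_directional_bound[of ?K f'] by blast
  have "norm (f x - f y) \<le> C * norm (x - y)" if "x \<in> ?K" "y \<in> ?K" for x y
  proof (rule differentiable_bound[where f' = f' and S = ?K])
    show "convex ?K" using V by (simp add: convex_Int subspace_imp_convex)
    show "(f has_derivative f' x) (at x within ?K)" if "x \<in> ?K" for x
      using has_derivative_subset[OF f'(1)] that KB by blast
    show "onorm (f' x) \<le> C" if "x \<in> ?K" for x
      using C that by (intro onorm_bound) auto
  qed (use that in auto)
  then show thesis using that C(1) by blast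
qed

lemma smooth_ball_derivative:
  fixes f :: "'e::euclidean_space \<Rightarrow> 'f::real_normed_vector"
  assumes V: "subspace V" and f: "smooth_on V (V \<inter> ball 0 R) f" and r: "r < R"
  obtains f' C where "C > 0" "\<And>x. x \<in> V \<inter> ball 0 R \<Longrightarrow> (f has_derivative f' x) (at x within V)"
    "\<And>v. smooth_on V (V \<inter> ball 0 R) (\<lambda>x. f' x v)"
    "\<And>x v. f' x v = f' x (subspace_proj V v)"
    "\<And>x y v. x \<in> V \<inter> cball 0 r \<Longrightarrow> y \<in> V \<inter> cball 0 r \<Longrightarrow> norm (f' x v - f' y v) \<le> C * norm (x - y) * norm v"
proof -
  let ?K = "V \<inter> cball 0 r"
  obtain f0 where f0: "\<And>x. x \<in> V \<inter> ball 0 R \<Longrightarrow> (f has_derivative f0 x) (at x within V)"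
    "\<And>v. v \<in> V \<Longrightarrow> smooth_on V (V \<inter> ball 0 R) (\<lambda>x. f0 x v)"
    using smooth_on_obtain_derivative[OF V relopen_ball f] by metis
  define f' where "f' = (\<lambda>x v. f0 x (subspace_proj V v))"
  have 1: "(f has_derivative f' x) (at x within V)" if "x \<in> V \<inter> ball 0 R" for x
    using has_derivative_within_subspace_proj[OF V _ f0(1)[OF that]] that unfolding f'_def by simp
  have 2: "smooth_on V (V \<inter> ball 0 R) (\<lambda>x. f' x v)" for v
    unfolding f'_def using f0(2) subspace_proj_in[OF V] by blast
  have 3: "f' x v = f' x (subspace_proj V v)" for x v
    unfolding f'_def by (simp add: subspace_proj_id[OF V subspace_proj_in[OF V]])
  have "\<exists>c\<ge>0. \<forall>x\<in>?K. \<forall>y\<in>?K. norm (f' x v - f' y v) \<le> c * norm (x - y)" for v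
    using Ck_on_Suc_Lipschitz[OF V smooth_onD[OF 2, of "Suc 0" v] r] by metis
  then obtain c where c: "\<And>v. c v \<ge> 0"
    "\<And>v x y. x \<in> ?K \<Longrightarrow> y \<in> ?K \<Longrightarrow> norm (f' x v - f' y v) \<le> c v * norm (x - y)" by metis
  \<comment> \<open>The summand 1 makes \<open>C\<close> positive, so that radii such as
    \<open>1 / (3 * C)\<close> make sense later.\<close>
  define C where "C = (\<Sum>i\<in>Basis. c i) + 1"
  have Cpos: "C > 0" unfolding C_def using c(1) sum_nonneg[of Basis c] by (simp add: add_nonneg_pos)
  have 4: "norm (f' x v - f' y v) \<le> C * norm (x - y) * norm v" if "x \<in> ?K" "y \<in> ?K" for x y v
  proof -
    have "x \<in> V \<inter> ball 0 R" "y \<in> V \<inter> ball 0 R" using that r by auto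
    then have "linear (\<lambda>v. f' x v - f' y v)" using 1 has_derivative_linear linear_compose_sub by blast
    then have "norm (f' x v - f' y v) \<le> (\<Sum>i\<in>Basis. c i * norm (x - y)) * norm v"
      by (rule linear_norm_le_sum_Basis) (rule c(2)[OF that])
    also have "\<dots> = (\<Sum>i\<in>Basis. c i) * norm (x - y) * norm v" by (simp add: sum_distrib_right)
    also have "\<dots> \<le> C * norm (x - y) * norm v" unfolding C_def by (intro mult_right_mono) auto
    finally show ?thesis .
  qed
  show thesis by (rule that[OF Cpos 1 2 3 4])
qed

section \<open>Geometric convergence and regularity of solutions of the halving equation\<close>

lemma geometric_limit:
  fixes f :: "nat \<Rightarrow> 'f::banach"
  assumes "\<And>n. norm (f (Suc n) - f n) \<le> C * q ^ n" "0 \<le> q" "q < 1"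
  obtains l where "f \<longlonglongrightarrow> l" "\<And>n. norm (l - f n) \<le> C / (1 - q) * q ^ n"
proof -
  have sm: "summable (\<lambda>n. C * q ^ n)" using assms by (intro summable_mult summable_geometric) auto
  have "summable (\<lambda>n. f (Suc n) - f n)"
    by (rule summable_comparison_test'[OF sm, of 0]) (use assms(1) in auto)
  then have "(\<lambda>n. \<Sum>i<n. f (Suc i) - f i) \<longlonglongrightarrow> suminf (\<lambda>n. f (Suc n) - f n)"
    by (rule summable_LIMSEQ)
  then have "(\<lambda>n. f n - f 0) \<longlonglongrightarrow> suminf (\<lambda>n. f (Suc n) - f n)" by (simp add: sum_lessThan_telescope)
  from tendsto_add[OF this tendsto_const[of "f 0"]]
  obtain l where l: "f \<longlonglongrightarrow> l" by auto
  have dist: "norm (f (n + k) - f n) \<le> C * q ^ n * (\<Sum>i<k. q ^ i)" for n k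
  proof (induction k)
    case (Suc k)
    have "norm (f (n + Suc k) - f n) \<le> norm (f (Suc (n + k)) - f (n + k)) + norm (f (n + k) - f n)"
      by (metis add_Suc_right diff_add_cancel add_diff_eq norm_triangle_ineq)
    also have "\<dots> \<le> C * q ^ (n + k) + C * q ^ n * (\<Sum>i<k. q ^ i)" using Suc assms(1) add_mono by blast
    finally show ?case by (simp add: algebra_simps power_add)
  qed simp
  have C0: "C \<ge> 0" using order_trans[OF norm_ge_zero assms(1)[of 0]] by simp
  have "norm (l - f n) \<le> C / (1 - q) * q ^ n" for n
  proof (rule LIMSEQ_le_const2)
    show "(\<lambda>k. norm (f (k + n) - f n)) \<longlonglongrightarrow> norm (l - f n)"
      by (intro tendsto_intros LIMSEQ_ignore_initial_segment l)
    have "norm (f (k + n) - f n) \<le> C / (1 - q) * q ^ n" for k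
    proof -
      have "(\<Sum>i<k. q ^ i) = (1 - q ^ k) / (1 - q)"
        using assms(3) sum_gp_strict[of q k] by simp
      also have "\<dots> \<le> 1 / (1 - q)" using assms(2,3) by (intro divide_right_mono) auto
      finally have "C * q ^ n * (\<Sum>i<k. q ^ i) \<le> C * q ^ n * (1 / (1 - q))"
        using C0 assms(2) by (intro mult_left_mono) auto
      then show ?thesis using dist[of n k] by (simp add: add.commute)
    qed
    then show "\<exists>N. \<forall>k\<ge>N. norm (f (k + n) - f n) \<le> C / (1 - q) * q ^ n" by blast
  qed
  then show thesis using that l by blast
qed

text \<open>\<open>A\<close> is regular only after evaluation at a fixed vector; linearity and the
  standard basis reduce a moving argument to finitely many such evaluations.\<close>

lemma Ck_on_apply:
  fixes A :: "'e::euclidean_space \<Rightarrow> 'f::euclidean_space \<Rightarrow> 'h::real_normed_vector"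
  assumes S: "openin (top_of_set V) S" and lin: "\<And>x. x \<in> S \<Longrightarrow> linear (A x)"
    and A: "\<And>w. Ck_on k V S (\<lambda>x. A x w)" and f: "Ck_on k V S f"
  shows "Ck_on k V S (\<lambda>x. A x (f x))"
proof (rule Ck_on_cong[OF S])
  have SV: "S \<subseteq> V" using S openin_imp_subset by blast
  show "Ck_on k V S (\<lambda>x. \<Sum>i\<in>Basis. (f x \<bullet> i) *\<^sub>R A x i)"
    by (intro Ck_on_sum Ck_on_bilinear[OF bounded_bilinear_scaleR SV] A
        Ck_on_linear_comp[OF bounded_linear_inner_left f])
  fix x assume x: "x \<in> S"
  have "A x (f x) = A x (\<Sum>i\<in>Basis. (f x \<bullet> i) *\<^sub>R i)" by (simp only: euclidean_representation)
  also have "\<dots> = (\<Sum>i\<in>Basis. (f x \<bullet> i) *\<^sub>R A x i)"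
    using lin[OF x] by (simp add: linear_sum linear_scale)
  finally show "(\<Sum>i\<in>Basis. (f x \<bullet> i) *\<^sub>R A x i) = A x (f x)" ..
qed

lemma half_in_ball:
  fixes V :: "'e::real_normed_vector set"
  assumes "subspace V"
  shows "x \<in> V \<inter> ball 0 r \<Longrightarrow> (1/2) *\<^sub>R x \<in> V \<inter> ball 0 r"
    and "x \<in> V \<inter> cball 0 r \<Longrightarrow> (1/2) *\<^sub>R x \<in> V \<inter> cball 0 r"
proof -
  have "norm ((1/2) *\<^sub>R x) \<le> norm x" by simp
  then show "x \<in> V \<inter> ball 0 r \<Longrightarrow> (1/2) *\<^sub>R x \<in> V \<inter> ball 0 r"
    "x \<in> V \<inter> cball 0 r \<Longrightarrow> (1/2) *\<^sub>R x \<in> V \<inter> cball 0 r"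
    using subspace_scale[OF assms, of x "1/2"] by (simp_all del: norm_scaleR)
qed

lemma Ck_on_halved_argument:
  fixes f :: "'e::euclidean_space \<Rightarrow> 'f::real_normed_vector"
  assumes V: "subspace V" and f: "Ck_on k V (V \<inter> ball 0 R) f"
  shows "Ck_on k V (V \<inter> ball 0 R) (\<lambda>x. f ((1/2) *\<^sub>R x))"
proof (rule Ck_on_compose[OF V V relopen_ball _ _ _ f])
  show "(\<lambda>x. (1/2) *\<^sub>R x) ` (V \<inter> ball 0 R) \<subseteq> V \<inter> ball 0 R"
    using half_in_ball(1)[OF V] by blast
  show "Ck_on k V (V \<inter> ball 0 R) (\<lambda>x. (1/2) *\<^sub>R x)"
    by (intro Ck_on_bounded_linear bounded_linear_scaleR_right)
qed simp

text \<open>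
  Iteration for the linear functional equation \<open>u(x) = b(x) + A(x) u(x/2)\<close>. Differentiating the
  equation halves the operator \<open>A\<close>, so that a solution is as smooth as \<open>A\<close> and \<open>b\<close> are.
\<close>

primrec halving_iter ::
  "('e::real_vector \<Rightarrow> 'f::real_vector \<Rightarrow> 'f) \<Rightarrow> ('e \<Rightarrow> 'f) \<Rightarrow> nat \<Rightarrow> 'e \<Rightarrow> 'f"
where
  "halving_iter A b 0 x = 0"
| "halving_iter A b (Suc n) x = b x + A x (halving_iter A b n ((1/2) *\<^sub>R x))"

lemma Ck_on_halving_iter:
  fixes A :: "'e::euclidean_space \<Rightarrow> 'f::euclidean_space \<Rightarrow> 'f"
  assumes V: "subspace V" and lin: "\<And>x. x \<in> V \<inter> ball 0 R \<Longrightarrow> linear (A x)"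
    and A: "\<And>w. Ck_on k V (V \<inter> ball 0 R) (\<lambda>x. A x w)" and b: "Ck_on k V (V \<inter> ball 0 R) b"
  shows "Ck_on k V (V \<inter> ball 0 R) (halving_iter A b n)"
proof (induction n)
  case 0
  have "halving_iter A b 0 = (\<lambda>x. 0)" by (rule ext) simp
  then show ?case using Ck_on_const by metis
next
  case (Suc n)
  have "halving_iter A b (Suc n) = (\<lambda>x. b x + A x (halving_iter A b n ((1/2) *\<^sub>R x)))"
    by (rule ext) simp
  then show ?case
    using Ck_on_add[OF b Ck_on_apply[OF relopen_ball lin A Ck_on_halved_argument[OF V Suc]]] by metis
qed

text \<open>Consecutive iterates differ by \<open>A x\<close> applied to the previous difference at
  \<open>x / 2\<close>, so each step contributes one factor \<open>q\<close>; the first difference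
  is \<open>b\<close>.\<close>

lemma halving_iter_step:
  fixes A :: "'e::euclidean_space \<Rightarrow> 'f::euclidean_space \<Rightarrow> 'f"
  assumes V: "subspace V" and lin: "\<And>x. x \<in> V \<inter> cball 0 r \<Longrightarrow> linear (A x)"
    and A: "\<And>x w. x \<in> V \<inter> cball 0 r \<Longrightarrow> norm (A x w) \<le> q * norm w" and q: "0 \<le> q"
    and b: "\<And>x. x \<in> V \<inter> cball 0 r \<Longrightarrow> norm (b x) \<le> C"
  shows "x \<in> V \<inter> cball 0 r \<Longrightarrow>
    norm (halving_iter A b (Suc n) x - halving_iter A b n x) \<le> C * q ^ n"
proof (induction n arbitrary: x)
  case 0
  then show ?case using b linear_0[OF lin] by simp
next
  case (Suc n)
  let ?y = "(1/2) *\<^sub>R x"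
  have y: "?y \<in> V \<inter> cball 0 r" using half_in_ball(2)[OF V Suc.prems] .
  have "halving_iter A b (Suc (Suc n)) x - halving_iter A b (Suc n) x
      = A x (halving_iter A b (Suc n) ?y - halving_iter A b n ?y)"
    using lin[OF Suc.prems] by (simp add: linear_diff)
  also have "norm \<dots> \<le> q * (C * q ^ n)"
    using A[OF Suc.prems] Suc.IH[OF y] q by (meson mult_left_mono order_trans)
  finally show ?case by (simp add: mult_ac)
qed

text \<open>Uniform geometric convergence on every smaller ball, with a rate that may depend on the
  radius. It is kept as a condition on \<open>u\<close>, because the operator bound used below may
  exceed 1 and then the iteration need not contract. The explicit rate is what the convergence proof
  for the derivatives consumes.\<close>

definition halving_limit ::
  "'e::euclidean_space set \<Rightarrow> real \<Rightarrow> ('e \<Rightarrow> 'f \<Rightarrow> 'f) \<Rightarrow> ('e \<Rightarrow> 'f::euclidean_space) \<Rightarrow> ('e \<Rightarrow> 'f) \<Rightarrow> bool"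
where
  "halving_limit V R A b u \<longleftrightarrow> (\<forall>r<R. \<exists>C q. 0 \<le> q \<and> q < 1 \<and>
     (\<forall>x\<in>V \<inter> cball 0 r. \<forall>n. norm (halving_iter A b n x - u x) \<le> C * q ^ n))"

text \<open>Differentiating the equation gives
  \<open>u' x v = \<beta> v x + (1/2) *\<^sub>R A x (u' (x/2) v)\<close>. The operator now has norm
  at most \<open>q/2 < 1\<close>, so its iteration converges by itself to some \<open>w\<close>. The
  induction hypothesis makes \<open>w\<close> regular, and comparing with the derivatives of the
  iterates identifies \<open>w\<close> as the derivative of \<open>u\<close>.\<close>

lemma Ck_on_halving_limit:
  fixes A :: "'e::euclidean_space \<Rightarrow> 'f::euclidean_space \<Rightarrow> 'f"
  assumes V: "subspace V"
  shows "\<lbrakk>\<And>x. x \<in> V \<inter> ball 0 R \<Longrightarrow> linear (A x);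
      \<And>x w. x \<in> V \<inter> ball 0 R \<Longrightarrow> norm (A x w) \<le> q * norm w; 0 \<le> q; q < 2;
      \<And>w. Ck_on k V (V \<inter> ball 0 R) (\<lambda>x. A x w); Ck_on k V (V \<inter> ball 0 R) b;
      halving_limit V R A b u\<rbrakk> \<Longrightarrow> Ck_on k V (V \<inter> ball 0 R) u"
proof (induction k arbitrary: A b u q)
  case 0
  show ?case
  proof (rule Ck_on_local[OF V])
    fix x assume x: "x \<in> V \<inter> ball 0 R"
    then obtain r where r: "norm x < r" "r < R" using dense by auto
    obtain C p where p: "0 \<le> p" "p < 1" and
      lim: "\<forall>x\<in>V \<inter> cball 0 r. \<forall>n. norm (halving_iter A b n x - u x) \<le> C * p ^ n"
      using 0(7) r(2) unfolding halving_limit_def by blast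
    have sub: "V \<inter> ball 0 r \<subseteq> V \<inter> ball 0 R" using r by auto
    have null: "(\<lambda>n. C * p ^ n) \<longlonglongrightarrow> 0"
      using tendsto_mult[OF tendsto_const[of C] LIMSEQ_power_zero[of p]] p by simp
    have "uniform_limit (V \<inter> ball 0 r) (halving_iter A b) u sequentially"
    proof (rule uniform_limitI)
      fix e :: real assume "e > 0"
      then have "\<forall>\<^sub>F n in sequentially. C * p ^ n < e" using order_tendstoD(2)[OF null] by blast
      then show "\<forall>\<^sub>F n in sequentially. \<forall>x\<in>V \<inter> ball 0 r. dist (halving_iter A b n x) (u x) < e"
      proof (rule eventually_mono)
        fix n assume n: "C * p ^ n < e"
        show "\<forall>x\<in>V \<inter> ball 0 r. dist (halving_iter A b n x) (u x) < e"
        proof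
          fix x assume "x \<in> V \<inter> ball 0 r"
          then have "norm (halving_iter A b n x - u x) \<le> C * p ^ n" using lim by auto
          then show "dist (halving_iter A b n x) (u x) < e" using n by (simp add: dist_norm)
        qed
      qed
    qed
    moreover have "continuous_on (V \<inter> ball 0 r) (halving_iter A b n)" for n
      using continuous_on_subset[OF _ sub] Ck_on_halving_iter[OF V 0(1) 0(5) 0(6), of n] by simp
    ultimately have "continuous_on (V \<inter> ball 0 r) u"
      by (intro uniform_limit_theorem[of _ "halving_iter A b" sequentially]) auto
    then show "\<exists>T. openin (top_of_set V) T \<and> x \<in> T \<and> Ck_on 0 V T u"
      using relopen_ball[of V r] x r by (intro exI[of _ "V \<inter> ball 0 r"]) simp
  qed
next
  case (Suc k)
  let ?S = "V \<inter> ball 0 R"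
  let ?h = "\<lambda>x::'e. (1/2) *\<^sub>R x"
  note lin = Suc.prems(1) and Aq = Suc.prems(2) and q = Suc.prems(3,4)
  have SV: "?S \<subseteq> V" by blast
  have half: "?h x \<in> V \<inter> ball 0 r" if "x \<in> V \<inter> ball 0 r" for x r
    using half_in_ball(1)[OF V that] .
  have halfc: "?h x \<in> V \<inter> cball 0 r" if "x \<in> V \<inter> cball 0 r" for x r
    using half_in_ball(2)[OF V that] .
  have Ak: "Ck_on k V ?S (\<lambda>x. A x w)" for w using Ck_on_SucD[OF Suc.prems(5) SV] .
  have bk: "Ck_on k V ?S b" using Ck_on_SucD[OF Suc.prems(6) SV] .
  \<comment> \<open>The inhomogeneous term \<open>\<beta>\<close> below contains \<open>u\<close> at
    \<open>x / 2\<close>, so order \<open>k\<close> of \<open>u\<close> itself comes before any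
    statement about its derivative.\<close>
  have uk: "Ck_on k V ?S u" using Suc.IH[OF lin Aq q Ak bk Suc.prems(7)] .
  have uhk: "Ck_on k V ?S (\<lambda>x. u (?h x))" using Ck_on_halved_argument[OF V uk] .
  obtain b' where b': "\<And>x. x \<in> ?S \<Longrightarrow> (b has_derivative b' x) (at x within V)"
    "\<And>v. Ck_on k V ?S (\<lambda>x. b' x v)" using Ck_on_Suc_derivative[OF V SV Suc.prems(6)] by metis
  have "\<exists>A'. (\<forall>x\<in>?S. ((\<lambda>x. A x w) has_derivative A' x) (at x within V)) \<and>
      (\<forall>v. Ck_on k V ?S (\<lambda>x. A' x v))" for w
    using Ck_on_Suc_derivative[OF V SV Suc.prems(5)[of w]] by metis
  then obtain A' where A': "\<And>w x. x \<in> ?S \<Longrightarrow> ((\<lambda>x. A x w) has_derivative A' w x) (at x within V)"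
      "\<And>w v. Ck_on k V ?S (\<lambda>x. A' w x v)" by metis
  \<comment> \<open>\<open>D x v y\<close> is the derivative of \<open>A\<close> at \<open>x\<close>
    in direction \<open>v\<close>, evaluated at \<open>y\<close>; it is assembled from the
    derivatives of \<open>A\<close> at the basis vectors.\<close>
  define D where "D = (\<lambda>x v. \<lambda>y. \<Sum>i\<in>Basis. (y \<bullet> i) *\<^sub>R A' i x v)"
  define \<beta> where "\<beta> = (\<lambda>v x. b' x v + D x v (u (?h x)))"
  define w where "w = (\<lambda>x v. lim (\<lambda>n. halving_iter (\<lambda>x w. (1/2) *\<^sub>R A x w) (\<beta> v) n x))"
  have linb': "linear (b' x)" if "x \<in> ?S" for x using b'(1)[OF that] has_derivative_linear by blast
  have linA': "linear (A' i x)" if "x \<in> ?S" for x i using A'(1)[OF that] has_derivative_linear by blast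
  have lin\<beta>: "linear (\<lambda>v. \<beta> v x)" if "x \<in> ?S" for x
    unfolding \<beta>_def D_def
    by (intro linear_compose_add linb'[OF that] linear_compose_sum ballI linear_compose_scale_right linA'[OF that])
  have Dk: "Ck_on k V ?S (\<lambda>x. D x v (f x))" if "Ck_on k V ?S f" for v f
    unfolding D_def
    by (intro Ck_on_sum Ck_on_bilinear[OF bounded_bilinear_scaleR SV] A'(2)
        Ck_on_linear_comp[OF bounded_linear_inner_left that])
  have \<beta>k: "Ck_on k V ?S (\<beta> v)" for v unfolding \<beta>_def by (intro Ck_on_add b'(2) Dk uhk)
  have lin2: "linear (\<lambda>w. (1/2) *\<^sub>R A x w)" if "x \<in> ?S" for x
    using lin[OF that] linear_compose_scale_right by blast
  have A2: "norm ((1/2) *\<^sub>R A x w) \<le> (q/2) * norm w" if "x \<in> ?S" for x w using Aq[OF that, of w] by simp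
  have q2: "0 \<le> q/2" "q/2 < 1" using q by auto
  have comp: "compact (V \<inter> cball 0 r)" for r
    using closed_subspace[OF V] compact_Int_closed[of "cball 0 r" V] by (simp add: Int_commute)
  have cb: "V \<inter> cball 0 r \<subseteq> ?S" if "r < R" for r using that by auto
  have cont: "continuous_on (V \<inter> cball 0 r) f" if "r < R" "Ck_on k V ?S f" for f :: "'e \<Rightarrow> 'f" and r
    using continuous_on_subset[OF Ck_on_imp_continuous_on[OF that(2) SV] cb[OF that(1)]] .
  have \<beta>bd: "\<exists>C\<ge>0. \<forall>x\<in>V \<inter> cball 0 r. \<forall>v. norm (\<beta> v x) \<le> C * norm v" if r: "r < R" for r
  proof -
    obtain C where "C \<ge> 0" "\<And>x v. x \<in> V \<inter> cball 0 r \<Longrightarrow> norm (\<beta> v x) \<le> C * norm v"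
      using compact_directional_bound[OF comp, of r "\<lambda>x v. \<beta> v x"] lin\<beta> cb[OF r] cont[OF r \<beta>k] by blast
    then show ?thesis by blast
  qed
  \<comment> \<open>Linearity of \<open>\<beta> v x\<close> in \<open>v\<close> lets one constant
    times \<open>norm v\<close> serve all directions, as the uniform convergence of derivatives
    requires.\<close>
  have wlim: "\<exists>C. (\<forall>x\<in>V \<inter> cball 0 r. \<forall>v. \<forall>n.
      norm (halving_iter (\<lambda>x w. (1/2) *\<^sub>R A x w) (\<beta> v) n x - w x v) \<le> C * norm v * (q/2) ^ n)"
    if r: "r < R" for r
  proof -
    obtain C where C: "C \<ge> 0" "\<forall>x\<in>V \<inter> cball 0 r. \<forall>v. norm (\<beta> v x) \<le> C * norm v" using \<beta>bd[OF r] by blast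
    show ?thesis
    proof (intro exI[of _ "C / (1 - q/2)"] ballI allI)
      fix x v n assume x: "x \<in> V \<inter> cball 0 r"
      let ?f = "\<lambda>n. halving_iter (\<lambda>x w. (1/2) *\<^sub>R A x w) (\<beta> v) n x"
      have step: "norm (?f (Suc n) - ?f n) \<le> C * norm v * (q/2) ^ n" for n
        using halving_iter_step[OF V _ _ q2(1), of r "\<lambda>x w. (1/2) *\<^sub>R A x w" "\<beta> v" "C * norm v" x n]
          lin2 A2 cb[OF r] C(2) x by blast
      obtain l where l: "?f \<longlonglongrightarrow> l" "\<And>n. norm (l - ?f n) \<le> C * norm v / (1 - q/2) * (q/2) ^ n"
        using geometric_limit[OF step q2] by blast
      have "w x v = l" unfolding w_def using limI[OF l(1)] .
      then show "norm (?f n - w x v) \<le> C / (1 - q/2) * norm v * (q/2) ^ n"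
        using l(2)[of n] by (simp add: norm_minus_commute)
    qed
  qed
  have wk: "Ck_on k V ?S (\<lambda>x. w x v)" for v
  proof (rule Suc.IH[OF lin2 A2 q2(1) _ _ \<beta>k])
    show "q/2 < 2" using q by simp
    show "Ck_on k V ?S (\<lambda>x. (1/2) *\<^sub>R A x w)" for w
      using Ck_on_linear_comp[OF bounded_linear_scaleR_right Ak] .
    show "halving_limit V R (\<lambda>x w. (1/2) *\<^sub>R A x w) (\<beta> v) (\<lambda>x. w x v)"
      unfolding halving_limit_def
    proof (intro allI impI)
      fix r assume "r < R"
      then obtain C where "\<forall>x\<in>V \<inter> cball 0 r. \<forall>v. \<forall>n.
         norm (halving_iter (\<lambda>x w. (1/2) *\<^sub>R A x w) (\<beta> v) n x - w x v) \<le> C * norm v * (q/2) ^ n"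
        using wlim by blast
      then show "\<exists>C p. 0 \<le> p \<and> p < 1 \<and> (\<forall>x\<in>V \<inter> cball 0 r. \<forall>n.
         norm (halving_iter (\<lambda>x w. (1/2) *\<^sub>R A x w) (\<beta> v) n x - w x v) \<le> C * p ^ n)"
        using q2 by (intro exI[of _ "C * norm v"] exI[of _ "q/2"]) blast
    qed
  qed
  have weq: "w x v = \<beta> v x + (1/2) *\<^sub>R A x (w (?h x) v)" if x: "x \<in> ?S" for x v
  proof -
    obtain r where r: "norm x < r" "r < R" using x dense by auto
    let ?f = "halving_iter (\<lambda>x w. (1/2) *\<^sub>R A x w) (\<beta> v)"
    have conv: "(\<lambda>n. ?f n y) \<longlonglongrightarrow> w y v" if y: "y \<in> V \<inter> cball 0 r" for y
    proof -
      obtain C where C: "\<forall>x\<in>V \<inter> cball 0 r. \<forall>v. \<forall>n.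
         norm (halving_iter (\<lambda>x w. (1/2) *\<^sub>R A x w) (\<beta> v) n x - w x v) \<le> C * norm v * (q/2) ^ n"
        using wlim[OF r(2)] by blast
      have "(\<lambda>n. C * norm v * (q/2) ^ n) \<longlonglongrightarrow> 0"
        using tendsto_mult[OF tendsto_const LIMSEQ_power_zero[of "q/2"]] q by simp
      moreover have "\<forall>n. norm (?f n y - w y v) \<le> C * norm v * (q/2) ^ n" using C y by blast
      ultimately have "(\<lambda>n. ?f n y - w y v) \<longlonglongrightarrow> 0"
        by (rule Lim_null_comparison[OF always_eventually, rotated])
      then show ?thesis by (simp add: LIM_zero_iff)
    qed
    have xr: "x \<in> V \<inter> cball 0 r" using x r by auto
    have "(\<lambda>n. \<beta> v x + (1/2) *\<^sub>R A x (?f n (?h x))) \<longlonglongrightarrow> \<beta> v x + (1/2) *\<^sub>R A x (w (?h x) v)"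
      using lin[OF x] linear_conv_bounded_linear
      by (intro tendsto_intros bounded_linear.tendsto[of "A x"] conv halfc[OF xr]) auto
    then have "(\<lambda>n. ?f (Suc n) x) \<longlonglongrightarrow> \<beta> v x + (1/2) *\<^sub>R A x (w (?h x) v)" by simp
    then show ?thesis using LIMSEQ_unique[OF LIMSEQ_Suc[OF conv[OF xr]]] by blast
  qed
  \<comment> \<open>The derivative of the n-th iterate. Its inhomogeneous part contains the iterate
    where \<open>\<beta>\<close> contains the limit \<open>u\<close>, so \<open>d\<close> is not
    itself a \<open>halving_iter\<close>, and its convergence to \<open>w\<close> needs a separate
    estimate.\<close>
  define d where "d = rec_nat (\<lambda>x v. 0) (\<lambda>n dn x v. b' x v + D x v (halving_iter A b n (?h x))
      + (1/2) *\<^sub>R A x (dn (?h x) v))"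
  have d0: "d 0 x v = 0" for x v by (simp add: d_def)
  have dS: "d (Suc n) x v = b' x v + D x v (halving_iter A b n (?h x)) + (1/2) *\<^sub>R A x (d n (?h x) v)"
    for n x v by (simp add: d_def)
  have der: "(halving_iter A b n has_derivative d n x) (at x within V)" if "x \<in> ?S" for n x
    using that
  proof (induction n arbitrary: x)
    case 0
    have "halving_iter A b 0 = (\<lambda>x. 0)" "d 0 x = (\<lambda>v. 0)" using d0 by auto
    then show ?case by simp
  next
    case (Suc n)
    have hx: "?h x \<in> ?S" using half Suc.prems by blast
    have "(halving_iter A b n has_derivative d n (?h x)) (at (?h x) within ?h ` V)"
      by (rule has_derivative_subset[OF Suc.IH[OF hx]]) (use V in \<open>auto intro: subspace_scale\<close>)
    moreover have "(?h has_derivative ?h) (at x within V)"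
      by (intro bounded_linear_imp_has_derivative bounded_linear_scaleR_right)
    ultimately have 1: "((\<lambda>x. halving_iter A b n (?h x)) has_derivative (\<lambda>v. d n (?h x) (?h v))) (at x within V)"
      using has_derivative_in_compose by blast
    have lind: "linear (d n (?h x))" using Suc.IH[OF hx] has_derivative_linear by blast
    \<comment> \<open>Expanding the moving vector in the basis leaves only \<open>A\<close> at fixed
      vectors, where its derivative is known.\<close>
    let ?g = "\<lambda>x. b x + (\<Sum>i\<in>Basis. (halving_iter A b n (?h x) \<bullet> i) *\<^sub>R A x i)"
    have "(?g has_derivative (\<lambda>v. b' x v + (\<Sum>i\<in>Basis. (halving_iter A b n (?h x) \<bullet> i) *\<^sub>R A' i x v
        + (d n (?h x) (?h v) \<bullet> i) *\<^sub>R A x i))) (at x within V)"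
      by (intro has_derivative_add b'(1) has_derivative_sum has_derivative_scaleR A'(1) Suc.prems
          has_derivative_inner_left 1)
    moreover have "b' x v + (\<Sum>i\<in>Basis. (halving_iter A b n (?h x) \<bullet> i) *\<^sub>R A' i x v
        + (d n (?h x) (?h v) \<bullet> i) *\<^sub>R A x i) = d (Suc n) x v" for v
    proof -
      have "(\<Sum>i\<in>Basis. (d n (?h x) (?h v) \<bullet> i) *\<^sub>R A x i) = A x (d n (?h x) (?h v))"
      proof -
        have "A x (d n (?h x) (?h v)) = A x (\<Sum>i\<in>Basis. (d n (?h x) (?h v) \<bullet> i) *\<^sub>R i)"
          by (simp only: euclidean_representation)
        then show ?thesis using lin[OF Suc.prems] by (simp add: linear_sum linear_scale)
      qed
      also have "\<dots> = (1/2) *\<^sub>R A x (d n (?h x) v)"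
        using lin[OF Suc.prems] lind by (simp add: linear_scale)
      finally show ?thesis unfolding dS D_def by (simp add: sum.distrib)
    qed
    ultimately have "(?g has_derivative d (Suc n) x) (at x within V)" by simp
    then show ?case
    proof (rule has_derivative_transform_relopen[OF relopen_ball[of V R] Suc.prems, rotated])
      fix y assume y: "y \<in> ?S"
      have "A y (halving_iter A b n (?h y)) = A y (\<Sum>i\<in>Basis. (halving_iter A b n (?h y) \<bullet> i) *\<^sub>R i)"
        by (simp only: euclidean_representation)
      then show "?g y = halving_iter A b (Suc n) y"
        using lin[OF y] by (simp add: linear_sum linear_scale)
    qed
  qed
  have deru: "(u has_derivative w x) (at x within V)" if x: "x \<in> ?S" for x
  proof -
    obtain r where r: "norm x < r" "r < R" using x dense by auto
    let ?T = "V \<inter> ball 0 r"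
    let ?K = "V \<inter> cball 0 r"
    have TS: "?T \<subseteq> ?S" using r by auto
    have KS: "?K \<subseteq> ?S" using cb[OF r(2)] .
    have r0: "0 < r" using r(1) norm_ge_zero[of x] by linarith
    obtain C1 p where p: "0 \<le> p" "p < 1" and
      ulim: "\<forall>x\<in>?K. \<forall>n. norm (halving_iter A b n x - u x) \<le> C1 * p ^ n"
      using Suc.prems(7) r(2) unfolding halving_limit_def by blast
    obtain C2 where C2: "\<forall>x\<in>?K. \<forall>v. \<forall>n.
      norm (halving_iter (\<lambda>x w. (1/2) *\<^sub>R A x w) (\<beta> v) n x - w x v) \<le> C2 * norm v * (q/2) ^ n"
      using wlim[OF r(2)] by blast
    have "\<exists>c\<ge>0. \<forall>x\<in>?K. \<forall>v. norm (A' i x v) \<le> c * norm v" for i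
    proof -
      obtain c where "c \<ge> 0" "\<And>x v. x \<in> ?K \<Longrightarrow> norm (A' i x v) \<le> c * norm v"
        using compact_directional_bound[OF comp, of r "A' i"] linA' KS cont[OF r(2) A'(2)] by blast
      then show ?thesis by blast
    qed
    then obtain c where c: "\<And>i. c i \<ge> 0" "\<And>i x v. x \<in> ?K \<Longrightarrow> norm (A' i x v) \<le> c i * norm v" by metis
    define C3 where "C3 = (\<Sum>i\<in>Basis. c i)"
    have C30: "C3 \<ge> 0" unfolding C3_def using c(1) sum_nonneg by metis
    have Dbd: "norm (D x v y) \<le> C3 * norm v * norm y" if "x \<in> ?K" for x v y
    proof -
      have "norm (D x v y) \<le> (\<Sum>i\<in>Basis. norm y * (c i * norm v))"
        unfolding D_def
      proof (rule sum_norm_le)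
        fix i :: 'f assume i: "i \<in> Basis"
        show "norm ((y \<bullet> i) *\<^sub>R A' i x v) \<le> norm y * (c i * norm v)"
          using Basis_le_norm[OF i, of y] c(2)[OF that, of i v] by (auto intro!: mult_mono)
      qed
      also have "\<dots> = C3 * norm v * norm y" unfolding C3_def by (simp add: sum_distrib_left sum_distrib_right mult_ac)
      finally show ?thesis .
    qed
    have C10: "C1 \<ge> 0"
    proof -
      have "0 \<in> ?K" using r0 subspace_0[OF V] by simp
      then have "norm (halving_iter A b 0 0 - u 0) \<le> C1 * p ^ 0" using ulim by blast
      from order_trans[OF norm_ge_zero this] show ?thesis by simp
    qed
    \<comment> \<open>Up to the factor \<open>norm v\<close> the error obeys
      \<open>e (n+1) \<le> C3 * C1 * p ^ n + (q/2) * e n\<close>. A rate \<open>m\<close> strictly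
      above \<open>q/2\<close> and \<open>p\<close> leaves a gap \<open>m - q/2\<close>, and
      dividing by this gap in \<open>K\<close> closes the induction; the summand
      \<open>\<bar>C2\<bar>\<close> covers its start.\<close>
    obtain m where m: "p < m" "q/2 < m" "m < 1" using dense[of "max p (q/2)" 1] p q by auto
    have m0: "0 \<le> m" using m p by simp
    define K where "K = \<bar>C2\<bar> + C3 * C1 / (m - q/2)"
    have K0: "K \<ge> 0" unfolding K_def using C30 C10 m by simp
    have "C3 * C1 / (m - q/2) \<ge> 0" using C30 C10 m by simp
    then have KC2: "C2 \<le> K" unfolding K_def by linarith
    have KC: "C3 * C1 + (q/2) * K \<le> K * m"
    proof -
      have "C3 * C1 = (C3 * C1 / (m - q/2)) * (m - q/2)" using m by simp
      also have "\<dots> \<le> K * (m - q/2)" unfolding K_def using m by (intro mult_right_mono) auto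
      finally show ?thesis by (simp add: algebra_simps)
    qed
    have db: "norm (d n x v - w x v) \<le> K * m ^ n * norm v" if "x \<in> ?K" for n x v
      using that
    proof (induction n arbitrary: x)
      case 0
      have "norm (w x v) \<le> C2 * norm v" using C2[rule_format, OF 0, of v 0] by simp
      also have "\<dots> \<le> K * norm v" using KC2 by (intro mult_right_mono) auto
      finally show ?case by (simp add: d0)
    next
      case (Suc n)
      have xS: "x \<in> ?S" and hK: "?h x \<in> ?K" using Suc.prems KS halfc by blast+
      have "d (Suc n) x v - w x v = (D x v (halving_iter A b n (?h x)) - D x v (u (?h x)))
          + (1/2) *\<^sub>R (A x (d n (?h x) v) - A x (w (?h x) v))"
        unfolding dS weq[OF xS] \<beta>_def by (simp add: algebra_simps)
      also have "D x v (halving_iter A b n (?h x)) - D x v (u (?h x)) = D x v (halving_iter A b n (?h x) - u (?h x))"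
        unfolding D_def by (simp add: inner_diff_left scaleR_diff_left sum_subtractf)
      also have "A x (d n (?h x) v) - A x (w (?h x) v) = A x (d n (?h x) v - w (?h x) v)"
        using lin[OF xS] by (simp add: linear_diff)
      also have "norm (D x v (halving_iter A b n (?h x) - u (?h x)) + (1/2) *\<^sub>R A x (d n (?h x) v - w (?h x) v))
          \<le> C3 * norm v * (C1 * m ^ n) + (q/2) * (K * m ^ n * norm v)"
      proof (rule norm_triangle_le, rule add_mono)
        have "norm (halving_iter A b n (?h x) - u (?h x)) \<le> C1 * p ^ n" using ulim hK by blast
        also have "\<dots> \<le> C1 * m ^ n" using C10 p m by (intro mult_left_mono power_mono) auto
        finally show "norm (D x v (halving_iter A b n (?h x) - u (?h x))) \<le> C3 * norm v * (C1 * m ^ n)"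
          using Dbd[OF Suc.prems] C30 by (meson mult_left_mono mult_nonneg_nonneg norm_ge_zero order_trans)
        show "norm ((1/2) *\<^sub>R A x (d n (?h x) v - w (?h x) v)) \<le> (q/2) * (K * m ^ n * norm v)"
          using A2[OF xS] Suc.IH[OF hK] q2 by (meson mult_left_mono order_trans)
      qed
      also have "\<dots> = (C3 * C1 + (q/2) * K) * (m ^ n * norm v)" by (simp add: algebra_simps)
      also have "\<dots> \<le> K * m * (m ^ n * norm v)" using KC m0 by (intro mult_right_mono) auto
      finally show ?case by (simp add: mult_ac)
    qed
    have null: "(\<lambda>n. B * s ^ n) \<longlonglongrightarrow> 0" if "0 \<le> s" "s < 1" for B s :: real
      using tendsto_mult[OF tendsto_const[of B] LIMSEQ_power_zero[of s]] that by simp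
    have conv: "(\<lambda>n. halving_iter A b n y) \<longlonglongrightarrow> u y" if "y \<in> ?T" for y
    proof -
      have "(\<lambda>n. halving_iter A b n y - u y) \<longlonglongrightarrow> 0"
        by (rule Lim_null_comparison[OF always_eventually null[OF p]]) (use ulim that in auto)
      then show ?thesis by (simp add: LIM_zero_iff)
    qed
    have "\<exists>g. \<forall>x\<in>?T. (\<lambda>n. halving_iter A b n x) \<longlonglongrightarrow> g x \<and> (g has_derivative w x) (at x within ?T)"
    proof (rule has_derivative_sequence[where f' = d])
      show "convex ?T" using V by (simp add: convex_Int subspace_imp_convex)
      show "(halving_iter A b n has_derivative d n x) (at x within ?T)" if "x \<in> ?T" for n x
        by (rule has_derivative_subset[OF der]) (use that TS in auto)
      show "\<forall>\<^sub>F n in sequentially. \<forall>x\<in>?T. \<forall>h. norm (d n x h - w x h) \<le> e * norm h" if "e > 0" for e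
      proof -
        have "\<forall>\<^sub>F n in sequentially. K * m ^ n < e" using order_tendstoD(2)[OF null[OF m0 m(3)] that] .
        then show ?thesis
        proof (rule eventually_mono)
          fix n assume n: "K * m ^ n < e"
          show "\<forall>x\<in>?T. \<forall>h. norm (d n x h - w x h) \<le> e * norm h"
          proof (intro ballI allI)
            fix x h assume "x \<in> ?T"
            then have "x \<in> ?K" by auto
            from db[OF this] have "norm (d n x h - w x h) \<le> K * m ^ n * norm h" .
            also have "\<dots> \<le> e * norm h" using n by (intro mult_right_mono) auto
            finally show "norm (d n x h - w x h) \<le> e * norm h" .
          qed
        qed
      qed
      show "0 \<in> ?T" using r0 subspace_0[OF V] by simp
      show "(\<lambda>n. halving_iter A b n 0) \<longlonglongrightarrow> u 0" using conv r0 subspace_0[OF V] by simp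
    qed
    then obtain g where g: "\<forall>x\<in>?T. (\<lambda>n. halving_iter A b n x) \<longlonglongrightarrow> g x \<and> (g has_derivative w x) (at x within ?T)"
      by blast
    have gu: "g y = u y" if "y \<in> ?T" for y using LIMSEQ_unique[OF conv[OF that]] bspec[OF g that] by metis
    have xT: "x \<in> ?T" using x r by auto
    then have "(g has_derivative w x) (at x within V)"
      using g unfolding at_within_relopen[OF relopen_ball xT] by blast
    from has_derivative_transform_relopen[OF relopen_ball xT gu this] show ?thesis .
  qed
  show ?case
    unfolding Ck_on.simps
  proof (intro exI[of _ w] conjI ballI)
    show "(u has_derivative w x) (at x within V)" if "x \<in> ?S" for x using deru[OF that] .
    show "Ck_on k V ?S (\<lambda>x. w x v)" for v using wk .
  qed
qed

section \<open>Maps with derivative 2 at a fixed point: orbits and linearization\<close>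

locale doubling_map =
  fixes V :: "'e::euclidean_space set" and s :: "'e \<Rightarrow> 'e" and R :: real
  assumes V: "subspace V" and R: "0 < R"
    and smooth: "smooth_on V (V \<inter> ball 0 R) s"
    and s_0: "s 0 = 0"
    and s_in: "\<And>x. x \<in> V \<inter> ball 0 R \<Longrightarrow> s x \<in> V"
    and deriv_0: "(s has_derivative (\<lambda>v. 2 *\<^sub>R v)) (at 0 within V)"
begin

text \<open>A single Lipschitz constant \<open>C\<close> of the derivative on the ball of radius
  \<open>R/2\<close> yields all the estimates: comparison with the derivative at 0 gives the
  deviation from twice the projection, and the mean value inequality turns it into the deviation of
  \<open>s\<close> from doubling.\<close>

lemma derivative_bounds:
  obtains s' C where "C > 0"
    "\<And>x. x \<in> V \<inter> ball 0 R \<Longrightarrow> (s has_derivative s' x) (at x within V)"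
    "\<And>v. smooth_on V (V \<inter> ball 0 R) (\<lambda>x. s' x v)"
    "\<And>x v. x \<in> V \<inter> ball 0 R \<Longrightarrow> s' x v \<in> V"
    "\<And>x y v. x \<in> V \<inter> cball 0 (R/2) \<Longrightarrow> y \<in> V \<inter> cball 0 (R/2) \<Longrightarrow>
       norm (s' x v - s' y v) \<le> C * norm (x - y) * norm v"
    "\<And>x v. x \<in> V \<inter> cball 0 (R/2) \<Longrightarrow>
       norm (s' x v - 2 *\<^sub>R subspace_proj V v) \<le> C * norm x * norm v"
    "\<And>x y r. x \<in> V \<inter> cball 0 r \<Longrightarrow> y \<in> V \<inter> cball 0 r \<Longrightarrow> r \<le> R/2 \<Longrightarrow>
       norm (s x - s y - 2 *\<^sub>R (x - y)) \<le> C * r * norm (x - y)"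
proof -
  let ?P = "subspace_proj V"
  have "R/2 < R" using R by simp
  from smooth_ball_derivative[OF V smooth this] obtain s' C where C: "C > 0"
    and s': "\<And>x. x \<in> V \<inter> ball 0 R \<Longrightarrow> (s has_derivative s' x) (at x within V)"
    "\<And>v. smooth_on V (V \<inter> ball 0 R) (\<lambda>x. s' x v)"
    and P: "\<And>x v. s' x v = s' x (?P v)"
    and lip: "\<And>x y v. x \<in> V \<inter> cball 0 (R/2) \<Longrightarrow> y \<in> V \<inter> cball 0 (R/2) \<Longrightarrow>
       norm (s' x v - s' y v) \<le> C * norm (x - y) * norm v" by metis
  have s0: "s' 0 v = 2 *\<^sub>R ?P v" for v
  proof -
    have "0 \<in> V \<inter> ball 0 R" using R subspace_0[OF V] by simp
    from has_derivative_within_subspace_unique[OF V subspace_0[OF V] s'(1)[OF this] deriv_0 subspace_proj_in[OF V]]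
    show ?thesis using P by metis
  qed
  have inV: "s' x v \<in> V" if "x \<in> V \<inter> ball 0 R" for x v
  proof -
    have "s ` (V \<inter> ball 0 R) \<subseteq> V" using s_in by blast
    from has_derivative_value_in_subspace[OF V V relopen_ball that this s'(1)[OF that] subspace_proj_in[OF V]]
    show ?thesis using P by metis
  qed
  have est: "norm (s' x v - 2 *\<^sub>R ?P v) \<le> C * norm x * norm v" if "x \<in> V \<inter> cball 0 (R/2)" for x v
    using lip[OF that, of 0 v] subspace_0[OF V] R s0 by simp
  have main: "norm (s x - s y - 2 *\<^sub>R (x - y)) \<le> C * r * norm (x - y)"
    if "x \<in> V \<inter> cball 0 r" "y \<in> V \<inter> cball 0 r" "r \<le> R/2" for x y r
  proof -
    let ?K = "V \<inter> cball 0 r"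
    have sub: "?K \<subseteq> V \<inter> ball 0 R" "?K \<subseteq> V \<inter> cball 0 (R/2)" using that(3) R by auto
    have "norm ((s x - 2 *\<^sub>R ?P x) - (s y - 2 *\<^sub>R ?P y)) \<le> C * r * norm (x - y)"
    proof (rule differentiable_bound[where f' = "\<lambda>x v. s' x v - 2 *\<^sub>R ?P v" and S = ?K])
      show "convex ?K" using V by (simp add: convex_Int subspace_imp_convex)
      fix z assume z: "z \<in> ?K"
      have "(s has_derivative s' z) (at z within ?K)"
        using has_derivative_subset[OF s'(1), of z ?K] z sub by blast
      moreover have "((\<lambda>x. 2 *\<^sub>R ?P x) has_derivative (\<lambda>x. 2 *\<^sub>R ?P x)) (at z within ?K)"
        by (intro bounded_linear_imp_has_derivative bounded_linear_const_scaleR bounded_linear_subspace_proj V)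
      ultimately show "((\<lambda>x. s x - 2 *\<^sub>R ?P x) has_derivative (\<lambda>v. s' z v - 2 *\<^sub>R ?P v)) (at z within ?K)"
        by (rule has_derivative_diff)
      show "onorm (\<lambda>v. s' z v - 2 *\<^sub>R ?P v) \<le> C * r"
      proof (rule onorm_bound)
        show "0 \<le> C * r" using C z norm_ge_zero[of z] by (auto intro!: mult_nonneg_nonneg order_trans[of 0 "norm z" r])
        fix v
        have "norm (s' z v - 2 *\<^sub>R ?P v) \<le> C * norm z * norm v" using est z sub by blast
        also have "\<dots> \<le> C * r * norm v" using C z by (intro mult_right_mono mult_left_mono) auto
        finally show "norm (s' z v - 2 *\<^sub>R ?P v) \<le> C * r * norm v" .
      qed
    qed (use that in auto)
    then show ?thesis using that by (simp add: subspace_proj_id[OF V] algebra_simps)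
  qed
  show thesis by (rule that[OF C s' inV lip est main])
qed

text \<open>One application of \<open>s\<close> expands differences by a factor 2 with a relative
  error of order \<open>c / 2 ^ n\<close>, and the product of these errors converges. So
  \<open>2 ^ n * norm (a n - b n)\<close> bounds the initial difference up to a constant, and it
  tends to 0.\<close>

lemma halving_orbit_unique:
  obtains r where "0 < r" "r \<le> R"
    "\<And>a b c. \<lbrakk>\<And>n. a n \<in> V \<inter> ball 0 r; \<And>n. b n \<in> V \<inter> ball 0 r;
       \<And>n. a n = s (a (Suc n)); \<And>n. b n = s (b (Suc n));
       \<And>n. norm (a n) \<le> c / 2 ^ n; \<And>n. norm (b n) \<le> c / 2 ^ n;
       (\<lambda>n. 2 ^ n *\<^sub>R (a n - b n)) \<longlonglongrightarrow> 0\<rbrakk> \<Longrightarrow> a 0 = b 0"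
proof -
  obtain C where C: "C > 0" "\<And>x y r. x \<in> V \<inter> cball 0 r \<Longrightarrow> y \<in> V \<inter> cball 0 r \<Longrightarrow> r \<le> R/2 \<Longrightarrow>
       norm (s x - s y - 2 *\<^sub>R (x - y)) \<le> C * r * norm (x - y)"
  proof (rule derivative_bounds)
    fix s' C
    assume "C > 0" "\<And>x y r. x \<in> V \<inter> cball 0 r \<Longrightarrow> y \<in> V \<inter> cball 0 r \<Longrightarrow> r \<le> R/2 \<Longrightarrow>
       norm (s x - s y - 2 *\<^sub>R (x - y)) \<le> C * r * norm (x - y)"
    then show thesis by (rule that)
  qed
  have main: "a 0 = b 0" if a: "\<And>n. a n \<in> V \<inter> ball 0 (R/2)" and b: "\<And>n. b n \<in> V \<inter> ball 0 (R/2)"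
    and as: "\<And>n. a n = s (a (Suc n))" and bs: "\<And>n. b n = s (b (Suc n))"
    and ac: "\<And>n. norm (a n) \<le> c / 2 ^ n" and bc: "\<And>n. norm (b n) \<le> c / 2 ^ n"
    and lim: "(\<lambda>n. 2 ^ n *\<^sub>R (a n - b n)) \<longlonglongrightarrow> 0" for a b c
  proof -
    have c0: "c \<ge> 0" using order_trans[OF norm_ge_zero ac[of 0]] by simp
    define w where "w n = norm (2 ^ n *\<^sub>R (a n - b n))" for n
    \<comment> \<open>The corrections still to come, \<open>C * c / 2 ^ k\<close> for
      \<open>k > n\<close>, add up to \<open>C * c / 2 ^ n\<close>. This factor makes the sequence
      nondecreasing, so its limit 0 bounds \<open>z 0\<close> from above.\<close>
    define z where "z n = w n * exp (- (C * c / 2 ^ n))" for n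
    have step: "w n \<le> w (Suc n) * exp (C * c / 2 ^ Suc n)" for n
    proof -
      define m where "m = max (norm (a (Suc n))) (norm (b (Suc n)))"
      have m: "m \<le> c / 2 ^ Suc n" using ac bc by (simp only: m_def max.bounded_iff)
      have mR: "m \<le> R/2" using a[of "Suc n"] b[of "Suc n"] by (auto simp: m_def)
      let ?d = "a (Suc n) - b (Suc n)"
      have "norm (a n - b n) \<le> norm (s (a (Suc n)) - s (b (Suc n)) - 2 *\<^sub>R ?d) + norm (2 *\<^sub>R ?d)"
        using norm_triangle_ineq[of "s (a (Suc n)) - s (b (Suc n)) - 2 *\<^sub>R ?d" "2 *\<^sub>R ?d"] as[of n] bs[of n] by simp
      also have "\<dots> \<le> C * m * norm ?d + 2 * norm ?d"
        using C(2)[of "a (Suc n)" m "b (Suc n)"] a[of "Suc n"] b[of "Suc n"] mR by (simp add: m_def)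
      also have "\<dots> = 2 * norm ?d * (1 + C * m / 2)" by (simp add: algebra_simps)
      also have "\<dots> \<le> 2 * norm ?d * exp (C * c / 2 ^ Suc n)"
      proof (intro mult_left_mono)
        have m0: "m \<ge> 0" unfolding m_def by (simp add: le_max_iff_disj)
        have "C * m / 2 \<le> C * m" using C m0 by simp
        also have "\<dots> \<le> C * (c / 2 ^ Suc n)" using C m by (intro mult_left_mono) auto
        finally have "1 + C * m / 2 \<le> 1 + C * c / 2 ^ Suc n" by simp
        then show "1 + C * m / 2 \<le> exp (C * c / 2 ^ Suc n)" using exp_ge_add_one_self order_trans by blast
      qed auto
      finally show ?thesis unfolding w_def by (simp add: mult_ac)
    qed
    have "z n \<le> z (Suc n)" for n
    proof -
      have "z n \<le> w (Suc n) * exp (C * c / 2 ^ Suc n) * exp (- (C * c / 2 ^ n))"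
        unfolding z_def using step[of n] by (intro mult_right_mono) auto
      also have "\<dots> = w (Suc n) * exp (C * c / 2 ^ Suc n + - (C * c / 2 ^ n))" by (simp only: exp_add mult.assoc)
      also have "C * c / 2 ^ Suc n + - (C * c / 2 ^ n) = - (C * c / 2 ^ Suc n)" by (simp add: field_simps)
      finally show ?thesis unfolding z_def .
    qed
    then have mono: "incseq z" by (rule incseq_SucI)
    have "z \<longlonglongrightarrow> 0"
    proof (rule Lim_null_comparison[OF always_eventually])
      show "w \<longlonglongrightarrow> 0" unfolding w_def using tendsto_norm_zero[OF lim] .
      show "\<forall>n. norm (z n) \<le> w n"
        unfolding z_def w_def using C(1) c0 by (auto simp: abs_mult intro!: mult_left_le)
    qed
    from incseq_le[OF mono this, of 0] have "z 0 \<le> 0" .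
    then have "w 0 \<le> 0" unfolding z_def by (simp add: mult_le_0_iff)
    then show ?thesis unfolding w_def by simp
  qed
  show thesis
  proof (rule that[of "R/2"])
    show "0 < R/2" "R/2 \<le> R" using R by auto
  qed (rule main)
qed

lemma linearization:
  obtains r K E where "0 < r" "r \<le> R"
    "\<And>x. x \<in> V \<inter> ball 0 r \<Longrightarrow> E x \<in> V \<inter> ball 0 R"
    "\<And>x. x \<in> V \<inter> ball 0 r \<Longrightarrow> E x = s (E ((1/2) *\<^sub>R x))"
    "\<And>x. x \<in> V \<inter> ball 0 r \<Longrightarrow> norm (E x - x) \<le> K * (norm x)\<^sup>2"
    "smooth_on V (V \<inter> ball 0 r) E"
proof (rule derivative_bounds)
  fix s' C
  assume C: "C > 0"
    and s': "\<And>x. x \<in> V \<inter> ball 0 R \<Longrightarrow> (s has_derivative s' x) (at x within V)"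
    and s'_smooth: "\<And>v. smooth_on V (V \<inter> ball 0 R) (\<lambda>x. s' x v)"
    and s'_in: "\<And>x v. x \<in> V \<inter> ball 0 R \<Longrightarrow> s' x v \<in> V"
    and lip: "\<And>x y v. x \<in> V \<inter> cball 0 (R/2) \<Longrightarrow> y \<in> V \<inter> cball 0 (R/2) \<Longrightarrow>
       norm (s' x v - s' y v) \<le> C * norm (x - y) * norm v"
    and est: "\<And>x v. x \<in> V \<inter> cball 0 (R/2) \<Longrightarrow>
       norm (s' x v - 2 *\<^sub>R subspace_proj V v) \<le> C * norm x * norm v"
    and main: "\<And>x y r. x \<in> V \<inter> cball 0 r \<Longrightarrow> y \<in> V \<inter> cball 0 r \<Longrightarrow> r \<le> R/2 \<Longrightarrow>
       norm (s x - s y - 2 *\<^sub>R (x - y)) \<le> C * r * norm (x - y)"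
  let ?P = "subspace_proj V"
  let ?h = "\<lambda>x::'e. (1/2) *\<^sub>R x"
  \<comment> \<open>\<open>R/4\<close> leaves room for the iterates, which can be twice as long as
    \<open>x\<close>, inside the ball of radius \<open>R/2\<close> on which the estimates hold.
    \<open>1 / (3 * C)\<close> gives \<open>C * norm x \<le> 1/3\<close>, so that one application of
    \<open>s\<close> expands the differences below by at most \<open>7/3\<close>.\<close>
  define r where "r = min (R/4) (1 / (3 * C))"
  have r: "0 < r" "r \<le> R/4" unfolding r_def using R C by auto
  have Cr: "C * r \<le> 1/3"
  proof -
    have "C * r \<le> C * (1 / (3 * C))" using C by (intro mult_left_mono) (auto simp: r_def)
    then show ?thesis using C by simp
  qed
  let ?B = "V \<inter> cball 0 r"
  let ?S = "V \<inter> ball 0 r"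
  have hB: "?h x \<in> ?B" if "x \<in> ?B" for x using half_in_ball(2)[OF V that] .
  have hS: "?h x \<in> ?S" if "x \<in> ?S" for x using half_in_ball(1)[OF V that] .
  have Cu: "C * norm x \<le> 1/3" if "x \<in> ?B" for x
  proof -
    have "C * norm x \<le> C * r" using that C by (intro mult_left_mono) auto
    then show ?thesis using Cr by simp
  qed
  \<comment> \<open>A bound by a fixed multiple of \<open>norm x\<close> would pick up a factor at
    every step. The factor \<open>1 + norm x / r\<close> reproduces itself: its correction is half
    as large at \<open>x / 2\<close>, and this slack absorbs
    \<open>1 + C * norm x / 2\<close>.\<close>
  have growth: "(1 + C * norm x / 2) * (1 + norm x / (2 * r)) \<le> 1 + norm x / r" if x: "x \<in> ?B" for x
  proof -
    define p where "p = norm x / (2 * r)"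
    have p: "0 \<le> p" "p \<le> 1/2" using x r by (auto simp: p_def field_simps)
    have "C * norm x = (C * r) * (2 * p)" using r by (simp add: p_def field_simps)
    also have "\<dots> \<le> 1/3 * (2 * p)" using Cr p by (intro mult_right_mono) auto
    finally have "C * norm x / 2 \<le> p / 3" by simp
    then have "(1 + C * norm x / 2) * (1 + p) \<le> (1 + p/3) * (1 + p)"
      using p by (intro mult_right_mono) auto
    also have "\<dots> = 1 + p * (4/3 + p/3)" by (simp add: field_simps)
    also have "\<dots> \<le> 1 + p * 2" using p by (intro add_left_mono mult_left_mono) auto
    also have "1 + p * 2 = 1 + norm x / r" using r by (simp add: p_def field_simps)
    finally show ?thesis unfolding p_def .
  qed
  have double: "norm x * (1 + norm x / r) \<le> 2 * norm x" if "x \<in> ?B" for x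
  proof -
    have "norm x / r \<le> 1" using that r by (simp add: field_simps)
    then have "norm x * (1 + norm x / r) \<le> norm x * 2" by (intro mult_left_mono) auto
    then show ?thesis by simp
  qed
  have s_est: "norm (s y) \<le> norm y * (2 + C * norm y)" and s_quad: "norm (s y - 2 *\<^sub>R y) \<le> C * norm y * norm y"
    if "y \<in> V \<inter> cball 0 (R/2)" for y
  proof -
    show q: "norm (s y - 2 *\<^sub>R y) \<le> C * norm y * norm y"
      using main[of y "norm y" 0] that subspace_0[OF V] s_0 by simp
    have "norm (s y) \<le> norm (2 *\<^sub>R y) + norm (s y - 2 *\<^sub>R y)"
      using norm_triangle_ineq[of "2 *\<^sub>R y" "s y - 2 *\<^sub>R y"] by simp
    then show "norm (s y) \<le> norm y * (2 + C * norm y)" using q by (simp add: algebra_simps)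
  qed
  \<comment> \<open>\<open>EE n x\<close> is \<open>s\<close> applied n times to
    \<open>x / 2 ^ n\<close>. Splitting off the outermost \<open>s\<close> makes the functional
    equation of the limit the limit of the recursion.\<close>
  define EE where "EE = rec_nat (\<lambda>x. x) (\<lambda>n En x. s (En (?h x)))"
  have EE0: "EE 0 x = x" and EES: "EE (Suc n) x = s (EE n (?h x))" for n x by (simp_all add: EE_def)
  have EE_bound: "EE n x \<in> V \<and> norm (EE n x) \<le> norm x * (1 + norm x / r)" if "x \<in> ?B" for n x
    using that
  proof (induction n arbitrary: x)
    case 0
    have "norm x * 1 \<le> norm x * (1 + norm x / r)" using r by (intro mult_left_mono) auto
    then show ?case using 0 by (simp add: EE0)
  next
    case (Suc n)
    let ?y = "EE n (?h x)"
    have y: "?y \<in> V" "norm ?y \<le> norm x / 2 * (1 + norm x / (2 * r))"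
      using Suc.IH[OF hB[OF Suc.prems]] by simp_all
    have yx: "norm ?y \<le> norm x" using y(2) double[OF hB[OF Suc.prems]] by simp
    then have y2: "?y \<in> V \<inter> cball 0 (R/2)" using y(1) Suc.prems r by auto
    have "norm (s ?y) \<le> norm ?y * (2 + C * norm ?y)" using s_est[OF y2] .
    also have "\<dots> \<le> (norm x / 2 * (1 + norm x / (2 * r))) * (2 + C * norm x)"
      using y(2) yx C order_trans[OF norm_ge_zero y(2)]
      by (intro mult_mono add_left_mono mult_left_mono) auto
    also have "\<dots> = norm x * ((1 + C * norm x / 2) * (1 + norm x / (2 * r)))"
      using arg_cong[of "2 + C * norm x" "2 * (1 + C * norm x / 2)" "\<lambda>c. norm x / 2 * (1 + norm x / (2 * r)) * c"]
      by (simp only: mult.assoc) (simp add: mult_ac)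
    also have "\<dots> \<le> norm x * (1 + norm x / r)" using growth[OF Suc.prems] by (intro mult_left_mono) auto
    finally show ?case using s_in y2 R by (auto simp: EES)
  qed
  have EEh: "EE n (?h x) \<in> V \<inter> cball 0 (norm x)" "EE n (?h x) \<in> V \<inter> cball 0 (R/2)"
      "EE n (?h x) \<in> V \<inter> ball 0 R" if "x \<in> ?B" for n x
  proof -
    have "norm (EE n (?h x)) \<le> norm x" using EE_bound[OF hB[OF that], of n] double[OF hB[OF that]] by simp
    then show "EE n (?h x) \<in> V \<inter> cball 0 (norm x)" "EE n (?h x) \<in> V \<inter> cball 0 (R/2)"
      "EE n (?h x) \<in> V \<inter> ball 0 R" using EE_bound[OF hB[OF that], of n] that r R by auto
  qed
  \<comment> \<open>The quadratic factor drops to a quarter at \<open>x / 2\<close> while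
    \<open>s\<close> expands by at most \<open>7/3\<close>; the resulting rate \<open>7/12\<close>
    is rounded up to \<open>3/4\<close>.\<close>
  have EE_step: "norm (EE (Suc n) x - EE n x) \<le> C * (norm x)\<^sup>2 * (3/4) ^ n" if "x \<in> ?B" for n x
    using that
  proof (induction n arbitrary: x)
    case 0
    have "?h x \<in> V \<inter> cball 0 (R/2)" using hB[OF 0] r R by auto
    from s_quad[OF this] have "norm (s (?h x) - x) \<le> C * (norm x / 2) * (norm x / 2)" by simp
    also have "\<dots> \<le> C * (norm x)\<^sup>2" using C by (simp add: power2_eq_square)
    finally show ?case by (simp add: EE0 EES)
  next
    case (Suc n)
    let ?a = "EE (Suc n) (?h x)" and ?b = "EE n (?h x)"
    have "norm x \<le> R/2" using Suc.prems r by auto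
    then have "norm (s ?a - s ?b - 2 *\<^sub>R (?a - ?b)) \<le> C * norm x * norm (?a - ?b)"
      using main EEh(1)[OF Suc.prems] by blast
    then have "norm (s ?a - s ?b) \<le> 2 * norm (?a - ?b) + C * norm x * norm (?a - ?b)"
      using norm_triangle_ineq[of "s ?a - s ?b - 2 *\<^sub>R (?a - ?b)" "2 *\<^sub>R (?a - ?b)"] by simp
    also have "\<dots> \<le> (2 + 1/3) * norm (?a - ?b)"
      using mult_right_mono[OF Cu[OF Suc.prems], of "norm (?a - ?b)"] by (simp add: algebra_simps)
    also have "\<dots> \<le> (2 + 1/3) * (C * (norm x / 2)\<^sup>2 * (3/4) ^ n)"
      using Suc.IH[OF hB[OF Suc.prems]] by (intro mult_left_mono) auto
    also have "\<dots> = (7/12) * (C * (norm x)\<^sup>2 * (3/4) ^ n)" by (simp add: power2_eq_square)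
    also have "\<dots> \<le> (3/4) * (C * (norm x)\<^sup>2 * (3/4) ^ n)" using C by (intro mult_right_mono) auto
    finally show ?case by (simp add: EES mult_ac)
  qed
  define E where "E x = lim (\<lambda>n. EE n x)" for x
  have E: "(\<lambda>n. EE n x) \<longlonglongrightarrow> E x" "norm (E x - EE n x) \<le> 4 * C * (norm x)\<^sup>2 * (3/4) ^ n" if x: "x \<in> ?B" for n x
  proof -
    obtain l where l: "(\<lambda>n. EE n x) \<longlonglongrightarrow> l" "\<And>n. norm (l - EE n x) \<le> C * (norm x)\<^sup>2 / (1 - 3/4) * (3/4) ^ n"
      using geometric_limit[OF EE_step[OF x]] by auto
    have "E x = l" unfolding E_def using limI[OF l(1)] .
    then show "(\<lambda>n. EE n x) \<longlonglongrightarrow> E x" "norm (E x - EE n x) \<le> 4 * C * (norm x)\<^sup>2 * (3/4) ^ n"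
      using l(1) l(2)[of n] by simp_all
  qed
  have EV: "E x \<in> V" if "x \<in> ?B" for x
    using closed_sequentially[OF closed_subspace[OF V] _ E(1)[OF that]] EE_bound[OF that] by blast
  have Eh: "E (?h x) \<in> V \<inter> cball 0 (norm x)" if "x \<in> ?B" for x
  proof -
    have "norm (E (?h x)) \<le> norm x"
      by (rule LIMSEQ_le_const2[OF tendsto_norm[OF E(1)[OF hB[OF that]]]]) (use EEh(1)[OF that] in auto)
    then show ?thesis using EV[OF hB[OF that]] by simp
  qed
  have EhR: "E (?h x) \<in> V \<inter> cball 0 (R/2)" "E (?h x) \<in> V \<inter> ball 0 R" if "x \<in> ?B" for x
    using Eh[OF that] that r R by auto
  have E_eq: "E x = s (E (?h x))" if "x \<in> ?B" for x
  proof -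
    have "continuous_on (V \<inter> ball 0 R) s"
      using Ck_on_imp_continuous_on[OF smooth_onD[OF smooth]] by blast
    then have "(\<lambda>n. s (EE n (?h x))) \<longlonglongrightarrow> s (E (?h x))"
      by (rule continuous_on_tendsto_compose[OF _ E(1)[OF hB[OF that]] EhR(2)[OF that] always_eventually])
         (use EEh(3)[OF that] in blast)
    then have "(\<lambda>n. EE (Suc n) x) \<longlonglongrightarrow> s (E (?h x))" by (simp only: EES)
    then show ?thesis using LIMSEQ_unique[OF LIMSEQ_Suc[OF E(1)[OF that]]] by blast
  qed
  have s'_half: "norm ((1/2) *\<^sub>R s' y w) \<le> (1 + C * norm x / 2) * norm w"
    if "x \<in> ?B" "y \<in> V \<inter> cball 0 (norm x)" for x y w
  proof -
    have "y \<in> V \<inter> cball 0 (R/2)" using that r by auto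
    from est[OF this] have "norm (s' y w - 2 *\<^sub>R ?P w) \<le> C * norm y * norm w" .
    also have "\<dots> \<le> C * norm x * norm w" using that C by (intro mult_right_mono mult_left_mono) auto
    finally have "norm (s' y w) \<le> C * norm x * norm w + 2 * norm (?P w)"
      using norm_triangle_ineq[of "s' y w - 2 *\<^sub>R ?P w" "2 *\<^sub>R ?P w"] by simp
    then show ?thesis using norm_subspace_proj_le[OF V, of w] by (simp add: algebra_simps)
  qed
  have s'_lin: "linear (s' y)" if "y \<in> V \<inter> ball 0 R" for y using s'[OF that] has_derivative_linear by blast
  \<comment> \<open>Derivative of \<open>EE n\<close> by the chain rule, with \<open>1/2\<close>
    from the inner \<open>x / 2\<close>. It starts with the projection, the normalised derivative of
    the identity within \<open>V\<close>.\<close>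
  define DD where "DD = rec_nat (\<lambda>x v. ?P v) (\<lambda>n Dn x v. (1/2) *\<^sub>R s' (EE n (?h x)) (Dn (?h x) v))"
  have DD0: "DD 0 x v = ?P v" and DDS: "DD (Suc n) x v = (1/2) *\<^sub>R s' (EE n (?h x)) (DD n (?h x) v)"
    for n x v by (simp_all add: DD_def)
  have DD_bound: "norm (DD n x v) \<le> (1 + norm x / r) * norm v" if "x \<in> ?B" for n x v
    using that
  proof (induction n arbitrary: x)
    case 0
    have "1 * norm v \<le> (1 + norm x / r) * norm v" using r by (intro mult_right_mono) auto
    then show ?case using norm_subspace_proj_le[OF V, of v] by (simp add: DD0)
  next
    case (Suc n)
    have "norm (DD (Suc n) x v) \<le> (1 + C * norm x / 2) * norm (DD n (?h x) v)"
      unfolding DDS using s'_half[OF Suc.prems EEh(1)[OF Suc.prems]] .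
    also have "\<dots> \<le> (1 + C * norm x / 2) * ((1 + norm x / (2 * r)) * norm v)"
      using Suc.IH[OF hB[OF Suc.prems]] C by (intro mult_left_mono) auto
    also have "\<dots> \<le> (1 + norm x / r) * norm v"
      using mult_right_mono[OF growth[OF Suc.prems], of "norm v"] by (simp add: mult_ac)
    finally show ?case .
  qed
  \<comment> \<open>Here the bound is only linear in \<open>norm x\<close>, so halving gains
    \<open>1/2\<close>. The main term contributes \<open>7/6 * 1/2 = 7/12\<close> and the change of
    \<open>s'\<close> between consecutive iterates \<open>1/12\<close>, in total \<open>2/3\<close>,
    which is below \<open>3/4\<close>.\<close>
  have DD_step: "norm (DD (Suc n) x v - DD n x v) \<le> C * norm x * norm v * (3/4) ^ n" if "x \<in> ?B" for n x v
    using that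
  proof (induction n arbitrary: x)
    case 0
    have h: "?h x \<in> V \<inter> cball 0 (R/2)" using hB[OF 0] r R by auto
    have PP: "?P (?P v) = ?P v" using subspace_proj_id[OF V subspace_proj_in[OF V]] .
    have "norm (s' (?h x) (?P v) - 2 *\<^sub>R ?P v) \<le> C * norm (?h x) * norm (?P v)"
      using est[OF h, of "?P v"] unfolding PP .
    also have "\<dots> \<le> C * norm x * norm v"
      using C norm_subspace_proj_le[OF V] by (intro mult_mono) auto
    finally have "norm (s' (?h x) (?P v) - 2 *\<^sub>R ?P v) \<le> C * norm x * norm v" .
    moreover have "0 \<le> C * norm x * norm v" using C by simp
    ultimately have "norm ((1/2) *\<^sub>R (s' (?h x) (?P v) - 2 *\<^sub>R ?P v)) \<le> C * norm x * norm v"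
      unfolding norm_scaleR by simp
    then show ?case by (simp add: DD0 DDS EE0 scaleR_diff_right)
  next
    case (Suc n)
    let ?y1 = "EE (Suc n) (?h x)" and ?y0 = "EE n (?h x)"
    let ?w1 = "DD (Suc n) (?h x) v" and ?w0 = "DD n (?h x) v"
    have "DD (Suc (Suc n)) x v - DD (Suc n) x v
        = (1/2) *\<^sub>R s' ?y1 (?w1 - ?w0) + (1/2) *\<^sub>R (s' ?y1 ?w0 - s' ?y0 ?w0)"
      using linear_diff[OF s'_lin[OF EEh(3)[OF Suc.prems, of "Suc n"]], of ?w1 ?w0]
      by (simp add: DDS[of "Suc n"] DDS[of n x] scaleR_diff_right)
    also have "norm \<dots> \<le> (7/6) * (C * (norm x / 2) * norm v * (3/4) ^ n)
        + (1/12) * (C * norm x * norm v * (3/4) ^ n)"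
    proof (rule norm_triangle_le, rule add_mono)
      have "norm ((1/2) *\<^sub>R s' ?y1 (?w1 - ?w0)) \<le> (1 + C * norm x / 2) * norm (?w1 - ?w0)"
        using s'_half[OF Suc.prems EEh(1)[OF Suc.prems]] .
      also have "\<dots> \<le> (7/6) * (C * (norm x / 2) * norm v * (3/4) ^ n)"
        using Suc.IH[OF hB[OF Suc.prems]] Cu[OF Suc.prems] by (intro mult_mono) auto
      finally show "norm ((1/2) *\<^sub>R s' ?y1 (?w1 - ?w0)) \<le> (7/6) * (C * (norm x / 2) * norm v * (3/4) ^ n)" .
      have w0: "norm ?w0 \<le> 2 * norm v"
      proof -
        have "norm (?h x) / r \<le> 1" using hB[OF Suc.prems] r by (simp add: field_simps)
        then have "(1 + norm (?h x) / r) * norm v \<le> 2 * norm v" by (intro mult_right_mono) auto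
        then show ?thesis using DD_bound[OF hB[OF Suc.prems], of n v] by (rule order_trans[rotated])
      qed
      have "norm (s' ?y1 ?w0 - s' ?y0 ?w0) \<le> C * norm (?y1 - ?y0) * norm ?w0"
        using lip[OF EEh(2)[OF Suc.prems] EEh(2)[OF Suc.prems]] .
      also have "\<dots> \<le> C * (C * (norm x / 2)\<^sup>2 * (3/4) ^ n) * (2 * norm v)"
        using EE_step[OF hB[OF Suc.prems], of n] w0 C by (intro mult_mono mult_left_mono) auto
      also have "\<dots> = (C * norm x) * (1/2 * (C * norm x * norm v * (3/4) ^ n))"
        by (simp add: power2_eq_square)
      also have "\<dots> \<le> (1/3) * (1/2 * (C * norm x * norm v * (3/4) ^ n))"
        using Cu[OF Suc.prems] C by (intro mult_right_mono) auto
      finally show "norm ((1/2) *\<^sub>R (s' ?y1 ?w0 - s' ?y0 ?w0)) \<le> (1/12) * (C * norm x * norm v * (3/4) ^ n)"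
        by simp
    qed
    also have "\<dots> = (2/3) * (C * norm x * norm v * (3/4) ^ n)" by simp
    also have "\<dots> \<le> (3/4) * (C * norm x * norm v * (3/4) ^ n)" using C by (intro mult_right_mono) auto
    finally show ?case by (simp add: mult_ac)
  qed
  define g where "g x v = lim (\<lambda>n. DD n x v)" for x v
  have g: "(\<lambda>n. DD n x v) \<longlonglongrightarrow> g x v"
    "norm (g x v - DD n x v) \<le> 4 * C * norm x * norm v * (3/4) ^ n" if x: "x \<in> ?B" for n x v
  proof -
    obtain l where l: "(\<lambda>n. DD n x v) \<longlonglongrightarrow> l"
        "\<And>n. norm (l - DD n x v) \<le> C * norm x * norm v / (1 - 3/4) * (3/4) ^ n"
      using geometric_limit[OF DD_step[OF x, of _ v]] by auto
    have "g x v = l" unfolding g_def using limI[OF l(1)] .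
    then show "(\<lambda>n. DD n x v) \<longlonglongrightarrow> g x v" "norm (g x v - DD n x v) \<le> 4 * C * norm x * norm v * (3/4) ^ n"
      using l(1) l(2)[of n] by simp_all
  qed
  \<comment> \<open>Base point and vector both move with n; the Lipschitz bound for
    \<open>s'\<close> controls the first and the operator bound the second.\<close>
  have g_eq: "g x v = (1/2) *\<^sub>R s' (E (?h x)) (g (?h x) v)" if x: "x \<in> ?B" for x v
  proof -
    let ?y = "E (?h x)" and ?w = "g (?h x) v"
    have "(\<lambda>n. (1/2) *\<^sub>R s' (EE n (?h x)) (DD n (?h x) v) - (1/2) *\<^sub>R s' ?y ?w) \<longlonglongrightarrow> 0"
    proof (rule Lim_null_comparison[OF always_eventually])
      show "\<forall>n. norm ((1/2) *\<^sub>R s' (EE n (?h x)) (DD n (?h x) v) - (1/2) *\<^sub>R s' ?y ?w)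
          \<le> (1 + C * norm x / 2) * norm (DD n (?h x) v - ?w) + (1/2) * (C * norm (EE n (?h x) - ?y) * norm ?w)"
      proof
        fix n
        let ?z = "EE n (?h x)"
        have "(1/2) *\<^sub>R s' ?z (DD n (?h x) v) - (1/2) *\<^sub>R s' ?y ?w
          = (1/2) *\<^sub>R s' ?z (DD n (?h x) v - ?w) + (1/2) *\<^sub>R (s' ?z ?w - s' ?y ?w)"
          using linear_diff[OF s'_lin[OF EEh(3)[OF x]], of n "DD n (?h x) v" ?w] by (simp add: scaleR_diff_right)
        also have "norm \<dots> \<le> (1 + C * norm x / 2) * norm (DD n (?h x) v - ?w)
            + (1/2) * (C * norm (?z - ?y) * norm ?w)"
          using s'_half[OF x EEh(1)[OF x], of n "DD n (?h x) v - ?w"] lip[OF EEh(2)[OF x] EhR(1)[OF x], of n ?w]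
          by (intro norm_triangle_le add_mono) simp_all
        finally show "norm ((1/2) *\<^sub>R s' ?z (DD n (?h x) v) - (1/2) *\<^sub>R s' ?y ?w)
          \<le> (1 + C * norm x / 2) * norm (DD n (?h x) v - ?w) + (1/2) * (C * norm (?z - ?y) * norm ?w)" .
      qed
      have "(\<lambda>n. (1 + C * norm x / 2) * norm (DD n (?h x) v - ?w) + (1/2) * (C * norm (EE n (?h x) - ?y) * norm ?w))
        \<longlonglongrightarrow> (1 + C * norm x / 2) * norm (?w - ?w) + (1/2) * (C * norm (?y - ?y) * norm ?w)"
        by (intro tendsto_intros g(1) E(1) hB x)
      then show "(\<lambda>n. (1 + C * norm x / 2) * norm (DD n (?h x) v - ?w) + (1/2) * (C * norm (EE n (?h x) - ?y) * norm ?w))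
        \<longlonglongrightarrow> 0" by simp
    qed
    then have "(\<lambda>n. DD (Suc n) x v) \<longlonglongrightarrow> (1/2) *\<^sub>R s' ?y ?w" unfolding DDS by (simp add: LIM_zero_iff)
    then show ?thesis using LIMSEQ_unique[OF LIMSEQ_Suc[OF g(1)[OF x]]] by blast
  qed
  have SB: "x \<in> ?B" if "x \<in> ?S" for x using that by auto
  have EE_deriv: "(EE n has_derivative DD n x) (at x within V)" if "x \<in> ?S" for n x
    using that
  proof (induction n arbitrary: x)
    case 0
    have "EE 0 = (\<lambda>x. x)" "DD 0 x = ?P" using EE0 DD0 by auto
    then show ?case using has_derivative_within_subspace_proj[OF V _ has_derivative_ident] 0 by simp
  next
    case (Suc n)
    have hx: "?h x \<in> ?S" using hS Suc.prems by blast
    have "(EE n has_derivative DD n (?h x)) (at (?h x) within ?h ` ?S)"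
      by (rule has_derivative_subset[OF Suc.IH[OF hx]]) (use hS in blast)
    moreover have "(?h has_derivative ?h) (at x within ?S)"
      by (intro bounded_linear_imp_has_derivative bounded_linear_scaleR_right)
    ultimately have 1: "((\<lambda>x. EE n (?h x)) has_derivative (\<lambda>v. DD n (?h x) (?h v))) (at x within ?S)"
      using has_derivative_in_compose by blast
    have "(\<lambda>x. EE n (?h x)) ` ?S \<subseteq> V" using EEh(1) SB by blast
    from has_derivative_subset[OF s'[OF EEh(3)[OF SB[OF Suc.prems]]] this]
    have "((\<lambda>x. s (EE n (?h x))) has_derivative (\<lambda>v. s' (EE n (?h x)) (DD n (?h x) (?h v)))) (at x within ?S)"
      by (rule has_derivative_in_compose[OF 1])
    moreover have "s' (EE n (?h x)) (DD n (?h x) (?h v)) = DD (Suc n) x v" for v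
      unfolding DDS using linear_scale[OF has_derivative_linear[OF Suc.IH[OF hx]], of "1/2" v]
        linear_scale[OF s'_lin[OF EEh(3)[OF SB[OF Suc.prems]]]] by simp
    moreover have "(\<lambda>x. s (EE n (?h x))) = EE (Suc n)" using EES by auto
    ultimately have "(EE (Suc n) has_derivative DD (Suc n) x) (at x within ?S)" by simp
    then show ?case unfolding at_within_relopen[OF relopen_ball Suc.prems] .
  qed
  have E_deriv: "(E has_derivative g x) (at x within V)" if x: "x \<in> ?S" for x
  proof -
    have null: "(\<lambda>n. 4 * C * r * (3/4) ^ n) \<longlonglongrightarrow> 0"
      using tendsto_mult[OF tendsto_const[of "4 * C * r"] LIMSEQ_power_zero[of "3/4::real"]] by simp
    have "\<exists>f. \<forall>x\<in>?S. (\<lambda>n. EE n x) \<longlonglongrightarrow> f x \<and> (f has_derivative g x) (at x within ?S)"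
    proof (rule has_derivative_sequence[where f' = DD])
      show "convex ?S" using V by (simp add: convex_Int subspace_imp_convex)
      show "(EE n has_derivative DD n x) (at x within ?S)" if "x \<in> ?S" for n x
        by (rule has_derivative_subset[OF EE_deriv[OF that]]) blast
      show "\<forall>\<^sub>F n in sequentially. \<forall>x\<in>?S. \<forall>v. norm (DD n x v - g x v) \<le> e * norm v" if "e > 0" for e
      proof -
        have "\<forall>\<^sub>F n in sequentially. 4 * C * r * (3/4) ^ n < e" using order_tendstoD(2)[OF null that] .
        then show ?thesis
        proof (rule eventually_mono)
          fix n assume n: "4 * C * r * (3/4) ^ n < e"
          show "\<forall>x\<in>?S. \<forall>v. norm (DD n x v - g x v) \<le> e * norm v"
          proof (intro ballI allI)
            fix x v assume x: "x \<in> ?S"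
            have "norm (DD n x v - g x v) \<le> 4 * C * norm x * norm v * (3/4) ^ n"
              using g(2)[OF SB[OF x]] by (simp add: norm_minus_commute)
            also have "\<dots> \<le> 4 * C * r * norm v * (3/4) ^ n"
              using x C by (intro mult_right_mono mult_left_mono) auto
            also have "\<dots> = (4 * C * r * (3/4) ^ n) * norm v" by simp
            also have "\<dots> \<le> e * norm v" using n by (intro mult_right_mono) auto
            finally show "norm (DD n x v - g x v) \<le> e * norm v" .
          qed
        qed
      qed
      show S0: "0 \<in> ?S" using r subspace_0[OF V] by simp
      show "(\<lambda>n. EE n 0) \<longlonglongrightarrow> E 0" using E(1)[OF SB[OF S0]] .
    qed
    then obtain f where f: "\<And>x. x \<in> ?S \<Longrightarrow> (\<lambda>n. EE n x) \<longlonglongrightarrow> f x"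
      "\<And>x. x \<in> ?S \<Longrightarrow> (f has_derivative g x) (at x within ?S)" by blast
    have fE: "f y = E y" if "y \<in> ?S" for y using LIMSEQ_unique[OF f(1)[OF that] E(1)[OF SB[OF that]]] .
    have "(f has_derivative g x) (at x within V)"
      using f(2)[OF x] unfolding at_within_relopen[OF relopen_ball x] .
    from has_derivative_transform_relopen[OF relopen_ball x fE this] show ?thesis .
  qed
  \<comment> \<open>The equation for the derivative becomes \<open>g x v = A x (g (x/2) v)\<close>.
    The bound obtained for \<open>A\<close> is \<open>7/6\<close>, above 1 but below the 2 allowed
    by \<open>Ck_on_halving_limit\<close>.\<close>
  define A where "A x w = (1/2) *\<^sub>R s' (E (?h x)) w" for x w
  have A_bound: "norm (A x w) \<le> 7/6 * norm w" if x: "x \<in> ?B" for x w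
  proof -
    have "norm (A x w) \<le> (1 + C * norm x / 2) * norm w" unfolding A_def using s'_half[OF x Eh[OF x]] .
    also have "\<dots> \<le> 7/6 * norm w" using Cu[OF x] by (intro mult_right_mono) auto
    finally show ?thesis .
  qed
  have A_lin: "linear (A x)" if "x \<in> ?S" for x
    unfolding A_def using linear_compose_scale_right[OF s'_lin[OF EhR(2)[OF SB[OF that]]]] .
  \<comment> \<open>Subtracting \<open>v\<close>, the value at 0, leaves a solution bounded by a
    multiple of \<open>norm x\<close>, with inhomogeneity \<open>A x v - v\<close>. Halving
    \<open>x\<close> then gains \<open>1/2\<close> against the operator bound \<open>7/6\<close>, so
    the iterates converge at rate \<open>7/12\<close>.\<close>
  have g_limit: "halving_limit V r A (\<lambda>x. A x v - v) (\<lambda>x. g x v - v)" if v: "v \<in> V" for v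
    unfolding halving_limit_def
  proof (intro allI impI)
    fix \<rho> assume \<rho>: "\<rho> < r"
    have "norm (halving_iter A (\<lambda>x. A x v - v) n x - (g x v - v)) \<le> 4 * C * norm x * norm v * (7/12) ^ n"
      if "x \<in> ?S" for x n
      using that
    proof (induction n arbitrary: x)
      case 0
      have "norm (v - g x v) \<le> 4 * C * norm x * norm v"
        using g(2)[OF SB[OF 0], of v 0] by (simp add: DD0 subspace_proj_id[OF V v] norm_minus_commute)
      then show ?case by simp
    next
      case (Suc n)
      let ?y = "?h x"
      let ?i = "halving_iter A (\<lambda>x. A x v - v) n ?y"
      have "halving_iter A (\<lambda>x. A x v - v) (Suc n) x - (g x v - v) = A x (?i - (g ?y v - v))"
      proof -
        have "g x v = A x (g ?y v)" unfolding A_def by (rule g_eq[OF SB[OF Suc.prems]])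
        then show ?thesis using A_lin[OF Suc.prems] by (simp add: linear_diff)
      qed
      also have "norm \<dots> \<le> 7/6 * norm (?i - (g ?y v - v))" using A_bound[OF SB[OF Suc.prems]] .
      also have "\<dots> \<le> 7/6 * (4 * C * norm ?y * norm v * (7/12) ^ n)"
        using Suc.IH[OF hS[OF Suc.prems]] by (intro mult_left_mono) auto
      finally show ?case by simp
    qed
    moreover have "4 * C * norm x * norm v * (7/12) ^ n \<le> 4 * C * r * norm v * (7/12) ^ n" if "x \<in> ?S" for x n
      using that C by (intro mult_right_mono mult_left_mono) auto
    ultimately have "norm (halving_iter A (\<lambda>x. A x v - v) n x - (g x v - v)) \<le> 4 * C * r * norm v * (7/12) ^ n"
      if "x \<in> ?S" for x n using that order_trans by blast
    moreover have "V \<inter> cball 0 \<rho> \<subseteq> ?S" using \<rho> by auto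
    ultimately show "\<exists>D q. 0 \<le> q \<and> q < 1 \<and> (\<forall>x\<in>V \<inter> cball 0 \<rho>. \<forall>n.
        norm (halving_iter A (\<lambda>x. A x v - v) n x - (g x v - v)) \<le> D * q ^ n)"
      by (intro exI[of _ "4 * C * r * norm v"] exI[of _ "7/12"]) auto
  qed
  \<comment> \<open>Bootstrap: if \<open>E\<close> has order \<open>k\<close>, so has
    \<open>A\<close>, hence so has the derivative \<open>g\<close>, and \<open>E\<close> gains one
    order.\<close>
  have E_Ck: "Ck_on k V ?S E" for k
  proof (induction k)
    case 0
    have "\<exists>f'. (E has_derivative f') (at x within ?S)" if "x \<in> ?S" for x
      using has_derivative_subset[OF E_deriv[OF that], of ?S] by blast
    then have "continuous (at x within ?S) E" if "x \<in> ?S" for x using has_derivative_continuous that by blast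
    then show ?case by (simp add: continuous_on_eq_continuous_within)
  next
    case (Suc k)
    have Ehk: "Ck_on k V ?S (\<lambda>x. E (?h x))" using Ck_on_halved_argument[OF V Suc] .
    have im: "(\<lambda>x. E (?h x)) ` ?S \<subseteq> V \<inter> ball 0 R" using EhR(2) SB by blast
    have Ak: "Ck_on k V ?S (\<lambda>x. A x w)" for w
      unfolding A_def
      by (rule Ck_on_linear_comp[OF bounded_linear_scaleR_right],
          rule Ck_on_compose[OF V V relopen_ball _ im Ehk smooth_onD[OF s'_smooth]]) simp
    have "Ck_on k V ?S (\<lambda>x. g x v)" if v: "v \<in> V" for v
    proof -
      have "Ck_on k V ?S (\<lambda>x. g x v - v)"
        by (rule Ck_on_halving_limit[OF V A_lin _ _ _ Ak _ g_limit[OF v], of "7/6"])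
           (use A_bound SB in \<open>auto intro: Ck_on_diff Ak Ck_on_const\<close>)
      from Ck_on_add[OF this Ck_on_const[of k V ?S v]] show ?thesis by simp
    qed
    then show ?case unfolding Ck_on.simps using E_deriv by blast
  qed
  show thesis
  proof (rule that[of r E "4 * C"])
    show "0 < r" "r \<le> R" using r R by auto
    show "E x \<in> V \<inter> ball 0 R" if x: "x \<in> ?S" for x
    proof -
      have "norm (E x) \<le> 2 * norm x"
      proof (rule LIMSEQ_le_const2[OF tendsto_norm[OF E(1)[OF SB[OF x]]]])
        have "norm (EE n x) \<le> 2 * norm x" for n
          using EE_bound[OF SB[OF x], of n] double[OF SB[OF x]] by linarith
        then show "\<exists>N. \<forall>n\<ge>N. norm (EE n x) \<le> 2 * norm x" by blast
      qed
      then show ?thesis using EV[OF SB[OF x]] x r R by auto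
    qed
    show "E x = s (E (?h x))" if "x \<in> ?S" for x using E_eq[OF SB[OF that]] .
    show "norm (E x - x) \<le> 4 * C * (norm x)\<^sup>2" if "x \<in> ?S" for x
      using E(2)[OF SB[OF that], of 0] by (simp add: EE0)
    show "smooth_on V ?S E" unfolding smooth_on_def using E_Ck by blast
  qed
qed

end

section \<open>Smooth maps in charts\<close>

lemma smooth_on_subset: "smooth_on W S f \<Longrightarrow> T \<subseteq> S \<Longrightarrow> smooth_on W T f"
  unfolding smooth_on_def using Ck_on_subset by blast

lemma smooth_on_cong:
  assumes "openin (top_of_set W) S" "\<And>x. x \<in> S \<Longrightarrow> f x = g x" "smooth_on W S f"
  shows "smooth_on W S g"
  unfolding smooth_on_def using Ck_on_cong[OF assms(1) assms(2) smooth_onD[OF assms(3)]] by (rule allI)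

lemma smooth_on_compose:
  fixes f :: "'e::euclidean_space \<Rightarrow> 'f::euclidean_space" and g :: "'f \<Rightarrow> 'h::real_normed_vector"
  assumes "subspace W" "subspace W'" "openin (top_of_set W) S" "S' \<subseteq> W'" "f ` S \<subseteq> S'"
    "smooth_on W S f" "smooth_on W' S' g"
  shows "smooth_on W S (\<lambda>x. g (f x))"
  unfolding smooth_on_def
  using Ck_on_compose[OF assms(1-5) smooth_onD[OF assms(6)] smooth_onD[OF assms(7)]] by (rule allI)

lemma smooth_on_local:
  assumes "subspace W" "\<And>x. x \<in> S \<Longrightarrow> \<exists>T. openin (top_of_set W) T \<and> x \<in> T \<and> smooth_on W T f"
  shows "smooth_on W S f"
  unfolding smooth_on_def
proof
  fix k
  show "Ck_on k W S f"
  proof (rule Ck_on_local[OF assms(1)])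
    fix x assume "x \<in> S"
    from assms(2)[OF this] obtain T where "openin (top_of_set W) T \<and> x \<in> T \<and> smooth_on W T f" ..
    then show "\<exists>T. openin (top_of_set W) T \<and> x \<in> T \<and> Ck_on k W T f" using smooth_onD by blast
  qed
qed

lemma smooth_on_bounded_linear: "bounded_linear L \<Longrightarrow> smooth_on W S L"
  unfolding smooth_on_def using Ck_on_bounded_linear by blast

lemma smooth_on_const: "smooth_on W S (\<lambda>x. c)"
  unfolding smooth_on_def using Ck_on_const by blast

lemma smooth_on_Pair: "smooth_on W S f \<Longrightarrow> smooth_on W S g \<Longrightarrow> smooth_on W S (\<lambda>x. (f x, g x))"
  unfolding smooth_on_def using Ck_on_Pair by blast

lemma smooth_on_add: "smooth_on W S f \<Longrightarrow> smooth_on W S g \<Longrightarrow> smooth_on W S (\<lambda>x. f x + g x)"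
  unfolding smooth_on_def using Ck_on_add by blast

lemma smooth_on_imp_continuous_on: "smooth_on W S f \<Longrightarrow> S \<subseteq> W \<Longrightarrow> continuous_on S f"
  using Ck_on_imp_continuous_on smooth_onD by blast

lemma
  assumes "is_chart T c"
  shows chart_openin_cdom: "openin T (cdom c)"
    and chart_subspace: "subspace (cspace c)"
    and chart_openin_image_cdom: "openin (top_of_set (cspace c)) (cmap c ` cdom c)"
    and chart_homeomorphic: "homeomorphic_map (subtopology T (cdom c)) (top_of_set (cmap c ` cdom c)) (cmap c)"
    and chart_inj: "inj_on (cmap c) (cdom c)"
    and chart_in_cspace: "p \<in> cdom c \<Longrightarrow> cmap c p \<in> cspace c"
proof -
  note d = assms[unfolded is_chart_def]
  show op: "openin T (cdom c)" and "subspace (cspace c)"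
    and im: "openin (top_of_set (cspace c)) (cmap c ` cdom c)"
    and h: "homeomorphic_map (subtopology T (cdom c)) (top_of_set (cmap c ` cdom c)) (cmap c)"
    using d by blast+
  have "topspace (subtopology T (cdom c)) = cdom c" using openin_subset[OF op] by auto
  then show "inj_on (cmap c) (cdom c)" using homeomorphic_imp_injective_map[OF h] by simp
  show "p \<in> cdom c \<Longrightarrow> cmap c p \<in> cspace c" using openin_imp_subset[OF im] by blast
qed

lemma cinv_cmap: "is_chart T c \<Longrightarrow> p \<in> cdom c \<Longrightarrow> cinv c (cmap c p) = p"
  unfolding cinv_def using inv_into_f_f chart_inj by metis

lemma chart_openin_image:
  assumes c: "is_chart T c" and A: "openin T A" "A \<subseteq> cdom c"
  shows "openin (top_of_set (cspace c)) (cmap c ` A)"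
proof -
  have "openin (subtopology T (cdom c)) A" using A by (metis inf.orderE openin_subtopology)
  then have "openin (top_of_set (cmap c ` cdom c)) (cmap c ` A)"
    using homeomorphic_imp_open_map[OF chart_homeomorphic[OF c]] by (simp add: open_map_def)
  then show ?thesis using chart_openin_image_cdom[OF c] openin_trans by blast
qed

lemma chart_openin_preimage:
  assumes c: "is_chart T c" and B: "openin (top_of_set (cspace c)) B"
  shows "openin T {p \<in> cdom c. cmap c p \<in> B}"
proof -
  have top: "topspace (subtopology T (cdom c)) = cdom c"
    using openin_subset[OF chart_openin_cdom[OF c]] by auto
  have "openin (top_of_set (cmap c ` cdom c)) (cmap c ` cdom c \<inter> B)"
    using B openin_imp_subset[OF chart_openin_image_cdom[OF c]]
    by (metis (no_types, lifting) inf_commute inf.absorb_iff2 openin_subtopology_Int2 subtopology_subtopology)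
  then have "openin (subtopology T (cdom c)) {p \<in> cdom c. cmap c p \<in> cmap c ` cdom c \<inter> B}"
    using openin_continuous_map_preimage[OF homeomorphic_imp_continuous_map[OF chart_homeomorphic[OF c]]]
    unfolding top by blast
  moreover have "{p \<in> cdom c. cmap c p \<in> cmap c ` cdom c \<inter> B} = {p \<in> cdom c. cmap c p \<in> B}" by blast
  ultimately show ?thesis using openin_trans_full[OF _ chart_openin_cdom[OF c]] by simp
qed

text \<open>The atlas conditions alone. The \<open>linear_manifold\<close> of a subspace satisfies
  them with its single chart, so maps between the group, its chart spaces and the real line can be
  treated alike.\<close>

definition smooth_atlas :: "('a, 'e::euclidean_space) manifold \<Rightarrow> bool" where
  "smooth_atlas M \<longleftrightarrow> (\<forall>c\<in>charts M. is_chart (mtop M) c) \<and>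
     (\<Union>c\<in>charts M. cdom c) = topspace (mtop M) \<and>
     (\<forall>c\<in>charts M. \<forall>d\<in>charts M.
        smooth_on (cspace c) (cmap c ` (cdom c \<inter> cdom d)) (cmap d \<circ> cinv c))"

lemma smooth_manifold_imp_atlas: "smooth_manifold M \<Longrightarrow> smooth_atlas M"
  by (simp add: smooth_manifold_def smooth_atlas_def)

lemma atlas_chart: "smooth_atlas M \<Longrightarrow> c \<in> charts M \<Longrightarrow> is_chart (mtop M) c"
  by (simp add: smooth_atlas_def)

lemma atlas_cover:
  assumes "smooth_atlas M" "p \<in> topspace (mtop M)"
  obtains c where "c \<in> charts M" "p \<in> cdom c"
  using assms unfolding smooth_atlas_def by blast

lemma atlas_transition:
  "smooth_atlas M \<Longrightarrow> c \<in> charts M \<Longrightarrow> d \<in> charts M \<Longrightarrow>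
    smooth_on (cspace c) (cmap c ` (cdom c \<inter> cdom d)) (cmap d \<circ> cinv c)"
  by (simp add: smooth_atlas_def)

section \<open>Smooth maps between atlases\<close>

lemma smooth_map_on_openin: "smooth_map_on M N U f \<Longrightarrow> openin (mtop M) U"
  and smooth_map_on_in: "smooth_map_on M N U f \<Longrightarrow> p \<in> U \<Longrightarrow> f p \<in> topspace (mtop N)"
  by (auto simp: smooth_map_on_def)

lemma smooth_map_onE:
  assumes "smooth_map_on M N U f" "p \<in> U"
  obtains c d A where "c \<in> charts M" "d \<in> charts N" "openin (mtop M) A" "p \<in> A"
    "A \<subseteq> U \<inter> cdom c" "f ` A \<subseteq> cdom d" "smooth_on (cspace c) (cmap c ` A) (cmap d \<circ> f \<circ> cinv c)"
  using assms unfolding smooth_map_on_def by metis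

lemma smooth_map_onI:
  assumes "openin (mtop M) U" "\<And>p. p \<in> U \<Longrightarrow> f p \<in> topspace (mtop N)"
    "\<And>p. p \<in> U \<Longrightarrow> \<exists>c\<in>charts M. \<exists>d\<in>charts N. \<exists>A. openin (mtop M) A \<and> p \<in> A \<and>
        A \<subseteq> U \<inter> cdom c \<and> f ` A \<subseteq> cdom d \<and> smooth_on (cspace c) (cmap c ` A) (cmap d \<circ> f \<circ> cinv c)"
  shows "smooth_map_on M N U f"
  using assms unfolding smooth_map_on_def by blast

text \<open>\<open>smooth_map_on\<close> provides one pair of charts near each point. Transition
  maps on both sides carry that coordinate expression to the given pair, and smoothness is a local
  property.\<close>

lemma smooth_map_on_in_charts:
  fixes M :: "('a, 'e::euclidean_space) manifold" and N :: "('b, 'f::euclidean_space) manifold"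
  assumes M: "smooth_atlas M" and N: "smooth_atlas N" and f: "smooth_map_on M N U f"
    and c: "c \<in> charts M" and d: "d \<in> charts N"
    and A: "openin (mtop M) A" "A \<subseteq> U \<inter> cdom c" "f ` A \<subseteq> cdom d"
  shows "smooth_on (cspace c) (cmap c ` A) (cmap d \<circ> f \<circ> cinv c)"
proof (rule smooth_on_local)
  note cc = atlas_chart[OF M c] and dd = atlas_chart[OF N d]
  show "subspace (cspace c)" using chart_subspace[OF cc] .
  fix y assume "y \<in> cmap c ` A"
  then obtain p where p: "p \<in> A" "y = cmap c p" by blast
  have "p \<in> U" using p A by blast
  obtain c' d' A' where c': "c' \<in> charts M" and d': "d' \<in> charts N" and A': "openin (mtop M) A'" "p \<in> A'"
    "A' \<subseteq> U \<inter> cdom c'" "f ` A' \<subseteq> cdom d'" and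
    sm: "smooth_on (cspace c') (cmap c' ` A') (cmap d' \<circ> f \<circ> cinv c')"
    using smooth_map_onE[OF f \<open>p \<in> U\<close>] by metis
  note cc' = atlas_chart[OF M c'] and dd' = atlas_chart[OF N d']
  define B where "B = A \<inter> A'"
  have B: "openin (mtop M) B" "B \<subseteq> cdom c" "B \<subseteq> cdom c'" unfolding B_def using A A' by auto
  have oB: "openin (top_of_set (cspace c)) (cmap c ` B)" using chart_openin_image[OF cc B(1,2)] .
  have oB': "openin (top_of_set (cspace c')) (cmap c' ` B)" using chart_openin_image[OF cc' B(1,3)] .
  have s1: "smooth_on (cspace c) (cmap c ` B) (cmap c' \<circ> cinv c)"
    by (rule smooth_on_subset[OF atlas_transition[OF M c c']]) (use B in blast)
  have im1: "(cmap c' \<circ> cinv c) ` cmap c ` B \<subseteq> cmap c' ` B"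
    using cinv_cmap[OF cc] B(2) by force
  have s2: "smooth_on (cspace c') (cmap c' ` B) (cmap d' \<circ> f \<circ> cinv c')"
    by (rule smooth_on_subset[OF sm]) (simp add: B_def image_mono)
  have s12: "smooth_on (cspace c) (cmap c ` B) (\<lambda>y. (cmap d' \<circ> f \<circ> cinv c') ((cmap c' \<circ> cinv c) y))"
    by (rule smooth_on_compose[OF chart_subspace[OF cc] chart_subspace[OF cc'] oB openin_imp_subset[OF oB'] im1 s1 s2])
  have pt: "(cmap d' \<circ> f \<circ> cinv c') ((cmap c' \<circ> cinv c) (cmap c q)) = cmap d' (f q)" if "q \<in> B" for q
    using cinv_cmap[OF cc] cinv_cmap[OF cc'] B that by (simp add: subsetD)
  have fB: "f q \<in> cdom d' \<inter> cdom d" if "q \<in> B" for q using that A(3) A'(4) unfolding B_def by blast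
  have im2: "(\<lambda>y. (cmap d' \<circ> f \<circ> cinv c') ((cmap c' \<circ> cinv c) y)) ` cmap c ` B \<subseteq> cmap d' ` (cdom d' \<inter> cdom d)"
    using pt fB by auto
  have sub: "cmap d' ` (cdom d' \<inter> cdom d) \<subseteq> cspace d'" using chart_in_cspace[OF dd'] by blast
  have s123: "smooth_on (cspace c) (cmap c ` B)
    (\<lambda>y. (cmap d \<circ> cinv d') ((cmap d' \<circ> f \<circ> cinv c') ((cmap c' \<circ> cinv c) y)))"
    by (rule smooth_on_compose[OF chart_subspace[OF cc] chart_subspace[OF dd'] oB sub im2 s12 atlas_transition[OF N d' d]])
  have "smooth_on (cspace c) (cmap c ` B) (cmap d \<circ> f \<circ> cinv c)"
  proof (rule smooth_on_cong[OF oB _ s123])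
    fix x assume "x \<in> cmap c ` B"
    then obtain q where q: "q \<in> B" "x = cmap c q" by blast
    have "cinv d' (cmap d' (f q)) = f q" using cinv_cmap[OF dd'] fB[OF q(1)] by blast
    then show "(cmap d \<circ> cinv d') ((cmap d' \<circ> f \<circ> cinv c') ((cmap c' \<circ> cinv c) x)) = (cmap d \<circ> f \<circ> cinv c) x"
      using pt[OF q(1)] q cinv_cmap[OF cc] B(2) by auto
  qed
  moreover have "y \<in> cmap c ` B" using p A' unfolding B_def by blast
  ultimately show "\<exists>T. openin (top_of_set (cspace c)) T \<and> y \<in> T \<and> smooth_on (cspace c) T (cmap d \<circ> f \<circ> cinv c)"
    using oB by blast
qed

text \<open>Continuity is not a clause of \<open>smooth_map_on\<close>; it is recovered from the
  smooth coordinate expressions, with injectivity of the charts bringing the preimage back to the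
  manifold.\<close>

lemma smooth_map_on_openin_preimage:
  assumes M: "smooth_atlas M" and N: "smooth_atlas N" and f: "smooth_map_on M N U f"
    and V: "openin (mtop N) V"
  shows "openin (mtop M) {x \<in> U. f x \<in> V}"
proof (subst openin_subopen, intro ballI)
  fix p assume p: "p \<in> {x \<in> U. f x \<in> V}"
  then have pU: "p \<in> U" by blast
  obtain c d A where c: "c \<in> charts M" and d: "d \<in> charts N" and A: "openin (mtop M) A" "p \<in> A"
    "A \<subseteq> U \<inter> cdom c" "f ` A \<subseteq> cdom d"
    and sm: "smooth_on (cspace c) (cmap c ` A) (cmap d \<circ> f \<circ> cinv c)"
    using smooth_map_onE[OF f pU] by metis
  note cc = atlas_chart[OF M c] and dd = atlas_chart[OF N d]
  let ?h = "cmap d \<circ> f \<circ> cinv c"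
  have oA: "openin (top_of_set (cspace c)) (cmap c ` A)" using chart_openin_image[OF cc A(1)] A(3) by blast
  have hq: "?h (cmap c q) = cmap d (f q)" if "q \<in> A" for q using cinv_cmap[OF cc] A(3) that by auto
  have "continuous_on (cmap c ` A) ?h" using smooth_on_imp_continuous_on[OF sm openin_imp_subset[OF oA]] .
  moreover have "?h \<in> cmap c ` A \<rightarrow> cspace d"
    using hq A(4) chart_in_cspace[OF dd] by force
  moreover have "openin (top_of_set (cspace d)) (cmap d ` (V \<inter> cdom d))"
    by (rule chart_openin_image[OF dd]) (use V chart_openin_cdom[OF dd] in auto)
  ultimately have "openin (top_of_set (cmap c ` A)) (cmap c ` A \<inter> ?h -` (cmap d ` (V \<inter> cdom d)))"
    by (rule continuous_openin_preimage)
  then have "openin (top_of_set (cspace c)) (cmap c ` A \<inter> ?h -` (cmap d ` (V \<inter> cdom d)))"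
    using oA openin_trans by blast
  from chart_openin_preimage[OF cc this]
  have o: "openin (mtop M) {q \<in> cdom c. cmap c q \<in> cmap c ` A \<inter> ?h -` (cmap d ` (V \<inter> cdom d))}" (is "openin _ ?T") .
  have "p \<in> ?T" using p A hq by auto
  moreover have "?T \<subseteq> {x \<in> U. f x \<in> V}"
  proof
    fix q assume q: "q \<in> ?T"
    then have "q \<in> A" using chart_inj[OF cc] A(3) by (auto dest: inj_onD)
    then obtain r where r: "r \<in> V \<inter> cdom d" "cmap d (f q) = cmap d r" using q hq by auto
    then have "f q = r" using chart_inj[OF dd] A(4) \<open>q \<in> A\<close> by (auto dest: inj_onD)
    then show "q \<in> {x \<in> U. f x \<in> V}" using r \<open>q \<in> A\<close> A(3) by blast
  qed
  ultimately show "\<exists>T. openin (mtop M) T \<and> p \<in> T \<and> T \<subseteq> {x \<in> U. f x \<in> V}" using o by blast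
qed

lemma smooth_map_on_compose:
  fixes M :: "('a, 'e::euclidean_space) manifold" and N :: "('b, 'f::euclidean_space) manifold"
    and Q :: "('c, 'g::euclidean_space) manifold"
  assumes M: "smooth_atlas M" and N: "smooth_atlas N" and f: "smooth_map_on M N U f"
    and g: "smooth_map_on N Q V g" and fU: "\<And>x. x \<in> U \<Longrightarrow> f x \<in> V"
  shows "smooth_map_on M Q U (\<lambda>x. g (f x))"
proof (rule smooth_map_onI)
  show "openin (mtop M) U" using smooth_map_on_openin[OF f] .
  show "g (f p) \<in> topspace (mtop Q)" if "p \<in> U" for p using smooth_map_on_in[OF g fU[OF that]] .
  fix p assume p: "p \<in> U"
  obtain e d A where e: "e \<in> charts N" and d: "d \<in> charts Q" and A: "openin (mtop N) A" "f p \<in> A"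
    "A \<subseteq> V \<inter> cdom e" "g ` A \<subseteq> cdom d" and sm: "smooth_on (cspace e) (cmap e ` A) (cmap d \<circ> g \<circ> cinv e)"
    using smooth_map_onE[OF g fU[OF p]] by metis
  obtain c where c: "c \<in> charts M" "p \<in> cdom c"
    using atlas_cover[OF M] openin_subset[OF smooth_map_on_openin[OF f]] p by blast
  note cc = atlas_chart[OF M c(1)] and ee = atlas_chart[OF N e]
  define B where "B = {x \<in> U. f x \<in> A} \<inter> cdom c"
  have B: "openin (mtop M) B"
    unfolding B_def using smooth_map_on_openin_preimage[OF M N f A(1)] chart_openin_cdom[OF cc] by blast
  have Bc: "B \<subseteq> U \<inter> cdom c" "f ` B \<subseteq> cdom e" "B \<subseteq> cdom c" unfolding B_def using A by auto
  have oB: "openin (top_of_set (cspace c)) (cmap c ` B)" using chart_openin_image[OF cc B Bc(3)] .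
  have s1: "smooth_on (cspace c) (cmap c ` B) (cmap e \<circ> f \<circ> cinv c)"
    by (rule smooth_map_on_in_charts[OF M N f c(1) e B Bc(1,2)])
  have pt: "(cmap e \<circ> f \<circ> cinv c) (cmap c q) = cmap e (f q)" "cinv e (cmap e (f q)) = f q" "f q \<in> A" if "q \<in> B" for q
    using cinv_cmap[OF cc] cinv_cmap[OF ee] that Bc unfolding B_def by auto
  have im: "(cmap e \<circ> f \<circ> cinv c) ` cmap c ` B \<subseteq> cmap e ` A" using pt by auto
  have sub: "cmap e ` A \<subseteq> cspace e" using chart_in_cspace[OF ee] A(3) by blast
  have "smooth_on (cspace c) (cmap c ` B) (\<lambda>y. (cmap d \<circ> g \<circ> cinv e) ((cmap e \<circ> f \<circ> cinv c) y))"
    by (rule smooth_on_compose[OF chart_subspace[OF cc] chart_subspace[OF ee] oB sub im s1 sm])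
  then have "smooth_on (cspace c) (cmap c ` B) (cmap d \<circ> (\<lambda>x. g (f x)) \<circ> cinv c)"
  proof (rule smooth_on_cong[OF oB, rotated])
    fix x assume "x \<in> cmap c ` B"
    then obtain q where q: "q \<in> B" "x = cmap c q" by blast
    then show "(cmap d \<circ> g \<circ> cinv e) ((cmap e \<circ> f \<circ> cinv c) x) = (cmap d \<circ> (\<lambda>x. g (f x)) \<circ> cinv c) x"
      using pt[OF q(1)] cinv_cmap[OF cc] Bc by auto
  qed
  moreover have "p \<in> B" using p A c unfolding B_def by blast
  moreover have "(\<lambda>x. g (f x)) ` B \<subseteq> cdom d" using pt(3) A(4) by blast
  ultimately show "\<exists>c\<in>charts M. \<exists>d\<in>charts Q. \<exists>A. openin (mtop M) A \<and> p \<in> A \<and> A \<subseteq> U \<inter> cdom c \<and>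
      (\<lambda>x. g (f x)) ` A \<subseteq> cdom d \<and> smooth_on (cspace c) (cmap c ` A) (cmap d \<circ> (\<lambda>x. g (f x)) \<circ> cinv c)"
    using c d B Bc by blast
qed

lemma smooth_map_on_subset:
  assumes f: "smooth_map_on M N U f" and V: "openin (mtop M) V" "V \<subseteq> U"
  shows "smooth_map_on M N V f"
proof (rule smooth_map_onI[OF V(1)])
  show "f p \<in> topspace (mtop N)" if "p \<in> V" for p using smooth_map_on_in[OF f] V(2) that by blast
  fix p assume p: "p \<in> V"
  then have "p \<in> U" using V by blast
  obtain c d A where c: "c \<in> charts M" and d: "d \<in> charts N" and A: "openin (mtop M) A" "p \<in> A"
    "A \<subseteq> U \<inter> cdom c" "f ` A \<subseteq> cdom d" "smooth_on (cspace c) (cmap c ` A) (cmap d \<circ> f \<circ> cinv c)"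
    using smooth_map_onE[OF f \<open>p \<in> U\<close>] by metis
  have "smooth_on (cspace c) (cmap c ` (A \<inter> V)) (cmap d \<circ> f \<circ> cinv c)"
    by (rule smooth_on_subset[OF A(5)]) blast
  then show "\<exists>c\<in>charts M. \<exists>d\<in>charts N. \<exists>A. openin (mtop M) A \<and> p \<in> A \<and> A \<subseteq> V \<inter> cdom c \<and>
      f ` A \<subseteq> cdom d \<and> smooth_on (cspace c) (cmap c ` A) (cmap d \<circ> f \<circ> cinv c)"
    using c d A p V(1) by (intro bexI[OF _ c] bexI[OF _ d] exI[of _ "A \<inter> V"]) auto
qed

lemma smooth_map_on_local:
  assumes "openin (mtop M) U"
    "\<And>p. p \<in> U \<Longrightarrow> \<exists>A. p \<in> A \<and> A \<subseteq> U \<and> smooth_map_on M N A f"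
  shows "smooth_map_on M N U f"
proof (rule smooth_map_onI[OF assms(1)])
  fix p assume p: "p \<in> U"
  from assms(2)[OF p] obtain V where V: "p \<in> V" "V \<subseteq> U" "smooth_map_on M N V f" by blast
  show "f p \<in> topspace (mtop N)" using smooth_map_on_in[OF V(3,1)] .
  obtain c d A where "c \<in> charts M" "d \<in> charts N" "openin (mtop M) A" "p \<in> A"
    "A \<subseteq> V \<inter> cdom c" "f ` A \<subseteq> cdom d" "smooth_on (cspace c) (cmap c ` A) (cmap d \<circ> f \<circ> cinv c)"
    using smooth_map_onE[OF V(3,1)] by metis
  then show "\<exists>c\<in>charts M. \<exists>d\<in>charts N. \<exists>A. openin (mtop M) A \<and> p \<in> A \<and> A \<subseteq> U \<inter> cdom c \<and>
      f ` A \<subseteq> cdom d \<and> smooth_on (cspace c) (cmap c ` A) (cmap d \<circ> f \<circ> cinv c)"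
    using V(2) by blast
qed

lemma smooth_map_on_cong:
  assumes M: "smooth_atlas M" and f: "smooth_map_on M N U f" and eq: "\<And>x. x \<in> U \<Longrightarrow> f x = g x"
  shows "smooth_map_on M N U g"
proof (rule smooth_map_onI[OF smooth_map_on_openin[OF f]])
  show "g p \<in> topspace (mtop N)" if "p \<in> U" for p using smooth_map_on_in[OF f that] eq[OF that] by simp
  fix p assume p: "p \<in> U"
  obtain c d A where c: "c \<in> charts M" and d: "d \<in> charts N" and A: "openin (mtop M) A" "p \<in> A"
    "A \<subseteq> U \<inter> cdom c" "f ` A \<subseteq> cdom d" and sm: "smooth_on (cspace c) (cmap c ` A) (cmap d \<circ> f \<circ> cinv c)"
    using smooth_map_onE[OF f p] by metis
  note cc = atlas_chart[OF M c]
  have oA: "openin (top_of_set (cspace c)) (cmap c ` A)" using chart_openin_image[OF cc A(1)] A(3) by blast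
  have "smooth_on (cspace c) (cmap c ` A) (cmap d \<circ> g \<circ> cinv c)"
  proof (rule smooth_on_cong[OF oA _ sm])
    fix x assume "x \<in> cmap c ` A"
    then obtain q where q: "q \<in> A" "x = cmap c q" by blast
    then have "q \<in> cdom c" "q \<in> U" using A(3) by auto
    then show "(cmap d \<circ> f \<circ> cinv c) x = (cmap d \<circ> g \<circ> cinv c) x"
      using cinv_cmap[OF cc] eq q(2) by simp
  qed
  moreover have "g ` A \<subseteq> cdom d" using A(3,4) eq by fastforce
  ultimately show "\<exists>c\<in>charts M. \<exists>d\<in>charts N. \<exists>A. openin (mtop M) A \<and> p \<in> A \<and> A \<subseteq> U \<inter> cdom c \<and>
      g ` A \<subseteq> cdom d \<and> smooth_on (cspace c) (cmap c ` A) (cmap d \<circ> g \<circ> cinv c)"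
    using c d A by blast
qed

lemma smooth_map_on_id:
  assumes M: "smooth_atlas M" and U: "openin (mtop M) U"
  shows "smooth_map_on M M U (\<lambda>x. x)"
proof (rule smooth_map_onI[OF U])
  fix p assume p: "p \<in> U"
  then show "p \<in> topspace (mtop M)" using openin_subset[OF U] by blast
  then obtain c where c: "c \<in> charts M" "p \<in> cdom c" using atlas_cover[OF M] by metis
  note cc = atlas_chart[OF M c(1)]
  have o: "openin (mtop M) (U \<inter> cdom c)" using U chart_openin_cdom[OF cc] by blast
  have "smooth_on (cspace c) (cmap c ` (U \<inter> cdom c)) (cmap c \<circ> cinv c)"
    by (rule smooth_on_subset[OF atlas_transition[OF M c(1) c(1)]]) blast
  then have "smooth_on (cspace c) (cmap c ` (U \<inter> cdom c)) (cmap c \<circ> (\<lambda>x. x) \<circ> cinv c)" by (simp add: comp_def)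
  then show "\<exists>c\<in>charts M. \<exists>d\<in>charts M. \<exists>A. openin (mtop M) A \<and> p \<in> A \<and> A \<subseteq> U \<inter> cdom c \<and>
      (\<lambda>x. x) ` A \<subseteq> cdom d \<and> smooth_on (cspace c) (cmap c ` A) (cmap d \<circ> (\<lambda>x. x) \<circ> cinv c)"
    using p c o by (intro bexI[OF _ c(1)] exI[of _ "U \<inter> cdom c"]) auto
qed

lemma smooth_map_on_const:
  assumes M: "smooth_atlas M" and N: "smooth_atlas N" and U: "openin (mtop M) U" and a: "a \<in> topspace (mtop N)"
  shows "smooth_map_on M N U (\<lambda>x. a)"
proof (rule smooth_map_onI[OF U])
  fix p assume p: "p \<in> U"
  show "a \<in> topspace (mtop N)" using a .
  have "p \<in> topspace (mtop M)" using openin_subset[OF U] p by blast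
  then obtain c where c: "c \<in> charts M" "p \<in> cdom c" using atlas_cover[OF M] by metis
  obtain d where d: "d \<in> charts N" "a \<in> cdom d" using atlas_cover[OF N a] by metis
  have o: "openin (mtop M) (U \<inter> cdom c)" using U chart_openin_cdom[OF atlas_chart[OF M c(1)]] by blast
  have "smooth_on (cspace c) (cmap c ` (U \<inter> cdom c)) (cmap d \<circ> (\<lambda>x. a) \<circ> cinv c)"
    using smooth_on_const by (simp add: comp_def)
  then show "\<exists>c\<in>charts M. \<exists>d\<in>charts N. \<exists>A. openin (mtop M) A \<and> p \<in> A \<and> A \<subseteq> U \<inter> cdom c \<and>
      (\<lambda>x. a) ` A \<subseteq> cdom d \<and> smooth_on (cspace c) (cmap c ` A) (cmap d \<circ> (\<lambda>x. a) \<circ> cinv c)"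
    using p c d o by (intro bexI[OF _ c(1)] bexI[OF _ d(1)] exI[of _ "U \<inter> cdom c"]) auto
qed

section \<open>Linear subspaces as manifolds, inverse charts and products of group-valued
  maps\<close>

abbreviation linear_chart :: "'e set \<Rightarrow> ('e, 'e) chart" where
  "linear_chart W \<equiv> \<lparr>cdom = W, cspace = W, cmap = id\<rparr>"

lemma linear_manifold_simps [simp]:
  "mtop (linear_manifold W) = top_of_set W" "charts (linear_manifold W) = {linear_chart W}"
  by (simp_all add: linear_manifold_def)

lemma cinv_linear_chart: "y \<in> W \<Longrightarrow> cinv (linear_chart W) y = y"
  unfolding cinv_def by (simp add: inv_into_f_f[of id W y, simplified])

lemma is_chart_linear: "subspace W \<Longrightarrow> is_chart (top_of_set W) (linear_chart W)"
  unfolding is_chart_def by (auto simp: homeomorphic_map_id subtopology_subtopology)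

lemma smooth_atlas_linear:
  fixes W :: "'e::euclidean_space set"
  assumes "subspace W"
  shows "smooth_atlas (linear_manifold W)"
proof -
  have o: "openin (top_of_set W) W" using openin_subtopology_self by blast
  have "smooth_on W W (id \<circ> cinv (linear_chart W))"
    by (rule smooth_on_cong[OF o _ smooth_on_bounded_linear[OF bounded_linear_ident]])
       (simp add: cinv_linear_chart)
  then show ?thesis unfolding smooth_atlas_def using is_chart_linear[OF assms] by simp
qed

lemma smooth_map_on_linear_domain:
  fixes W :: "'e::euclidean_space set" and N :: "('b, 'f::euclidean_space) manifold"
  assumes W: "subspace W" and N: "smooth_atlas N" and f: "smooth_map_on (linear_manifold W) N U f"
    and d: "d \<in> charts N" and A: "openin (top_of_set W) A" "A \<subseteq> U" "f ` A \<subseteq> cdom d"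
  shows "smooth_on W A (\<lambda>x. cmap d (f x))"
proof -
  have AW: "A \<subseteq> W" using A(1) openin_imp_subset by blast
  have "smooth_on (cspace (linear_chart W)) (cmap (linear_chart W) ` A) (cmap d \<circ> f \<circ> cinv (linear_chart W))"
    by (rule smooth_map_on_in_charts[OF smooth_atlas_linear[OF W] N f _ d]) (use A AW in auto)
  then have "smooth_on W A (cmap d \<circ> f \<circ> cinv (linear_chart W))" by simp
  then show ?thesis
  proof (rule smooth_on_cong[OF A(1), rotated])
    fix x assume "x \<in> A"
    then have "x \<in> W" using AW by blast
    then show "(cmap d \<circ> f \<circ> cinv (linear_chart W)) x = cmap d (f x)" by (simp add: cinv_linear_chart)
  qed
qed

lemma smooth_map_on_linearI:
  fixes W :: "'e::euclidean_space set" and W' :: "'f::euclidean_space set"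
  assumes W: "subspace W" and U: "openin (top_of_set W) U" and f: "smooth_on W U f" "f ` U \<subseteq> W'"
  shows "smooth_map_on (linear_manifold W) (linear_manifold W') U f"
proof (rule smooth_map_onI)
  have UW: "U \<subseteq> W" using U openin_imp_subset by blast
  show "openin (mtop (linear_manifold W)) U" using U by simp
  show "f p \<in> topspace (mtop (linear_manifold W'))" if "p \<in> U" for p using f(2) that by auto
  fix p assume p: "p \<in> U"
  have "smooth_on W U (id \<circ> f \<circ> cinv (linear_chart W))"
  proof (rule smooth_on_cong[OF U _ f(1)])
    fix x assume "x \<in> U"
    then have "x \<in> W" using UW by blast
    then show "f x = (id \<circ> f \<circ> cinv (linear_chart W)) x" by (simp add: cinv_linear_chart)
  qed
  then show "\<exists>c\<in>charts (linear_manifold W). \<exists>d\<in>charts (linear_manifold W'). \<exists>A. openin (mtop (linear_manifold W)) A \<and>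
      p \<in> A \<and> A \<subseteq> U \<inter> cdom c \<and> f ` A \<subseteq> cdom d \<and> smooth_on (cspace c) (cmap c ` A) (cmap d \<circ> f \<circ> cinv c)"
    using p U UW f(2) by (auto intro!: exI[of _ U])
qed

lemma smooth_map_on_cinv:
  fixes M :: "('a, 'e::euclidean_space) manifold"
  assumes M: "smooth_atlas M" and c: "c \<in> charts M"
  shows "smooth_map_on (linear_manifold (cspace c)) M (cmap c ` cdom c) (cinv c)"
proof (rule smooth_map_onI)
  note cc = atlas_chart[OF M c]
  note o = chart_openin_image_cdom[OF cc]
  have sub: "cmap c ` cdom c \<subseteq> cspace c" using openin_imp_subset[OF o] .
  show "openin (mtop (linear_manifold (cspace c))) (cmap c ` cdom c)" using o by simp
  have "cdom c \<subseteq> topspace (mtop M)" using openin_subset[OF chart_openin_cdom[OF cc]] .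
  then show "cinv c p \<in> topspace (mtop M)" if "p \<in> cmap c ` cdom c" for p using cinv_cmap[OF cc] that by auto
  fix p assume p: "p \<in> cmap c ` cdom c"
  have "smooth_on (cspace c) (cmap c ` cdom c) (cmap c \<circ> cinv c \<circ> cinv (linear_chart (cspace c)))"
  proof (rule smooth_on_cong[OF o _ smooth_on_bounded_linear[OF bounded_linear_ident]])
    fix x assume x: "x \<in> cmap c ` cdom c"
    then have "x \<in> cspace c" "cmap c (cinv c x) = x" using sub cinv_cmap[OF cc] by auto
    then show "x = (cmap c \<circ> cinv c \<circ> cinv (linear_chart (cspace c))) x" by (simp add: cinv_linear_chart)
  qed
  then show "\<exists>b\<in>charts (linear_manifold (cspace c)). \<exists>d\<in>charts M. \<exists>A. openin (mtop (linear_manifold (cspace c))) A \<and>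
      p \<in> A \<and> A \<subseteq> cmap c ` cdom c \<inter> cdom b \<and> cinv c ` A \<subseteq> cdom d \<and>
      smooth_on (cspace b) (cmap b ` A) (cmap d \<circ> cinv c \<circ> cinv b)"
    using p o sub cinv_cmap[OF cc] by (intro bexI[OF _ c] bexI[of _ "linear_chart (cspace c)"] exI[of _ "cmap c ` cdom c"]) auto
qed

text \<open>The pair of maps is followed into one product chart, coordinate by coordinate, and
  composed there with the coordinate form of multiplication.\<close>

lemma smooth_map_on_mult:
  fixes M :: "('g, 'e::euclidean_space) manifold" and N :: "('a, 'f::euclidean_space) manifold"
  assumes G: "lie_group G M" and N: "smooth_atlas N"
    and f: "smooth_map_on N M U f" and g: "smooth_map_on N M U g"
  shows "smooth_map_on N M U (\<lambda>x. f x \<otimes>\<^bsub>G\<^esub> g x)"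
proof (rule smooth_map_onI)
  have M: "smooth_atlas M" and top: "topspace (mtop M) = carrier G"
    and mult: "smooth_map (prod_manifold M M) M (\<lambda>(x, y). x \<otimes>\<^bsub>G\<^esub> y)" and grp: "group G"
    using G smooth_manifold_imp_atlas unfolding lie_group_def by blast+
  show "openin (mtop N) U" using smooth_map_on_openin[OF f] .
  show "f p \<otimes>\<^bsub>G\<^esub> g p \<in> topspace (mtop M)" if "p \<in> U" for p
    using smooth_map_on_in[OF f that] smooth_map_on_in[OF g that] grp top by (simp add: group.is_monoid monoid.m_closed)
  fix p assume p: "p \<in> U"
  have "(f p, g p) \<in> topspace (mtop (prod_manifold M M))"
    using smooth_map_on_in[OF f p] smooth_map_on_in[OF g p] by (simp add: prod_manifold_def)
  from smooth_map_onE[OF mult this] obtain b d A where b: "b \<in> charts (prod_manifold M M)" and d: "d \<in> charts M"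
    and A: "openin (mtop (prod_manifold M M)) A" "(f p, g p) \<in> A" "A \<subseteq> topspace (mtop (prod_manifold M M)) \<inter> cdom b"
    "(\<lambda>(x, y). x \<otimes>\<^bsub>G\<^esub> y) ` A \<subseteq> cdom d"
    and sm: "smooth_on (cspace b) (cmap b ` A) (cmap d \<circ> (\<lambda>(x, y). x \<otimes>\<^bsub>G\<^esub> y) \<circ> cinv b)" by metis
  obtain c1 c2 where c1: "c1 \<in> charts M" and c2: "c2 \<in> charts M"
    and b_def: "b = \<lparr>cdom = cdom c1 \<times> cdom c2, cspace = cspace c1 \<times> cspace c2, cmap = map_prod (cmap c1) (cmap c2)\<rparr>"
    using b by (auto simp: prod_manifold_def)
  note cc1 = atlas_chart[OF M c1] and cc2 = atlas_chart[OF M c2]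
  have "openin (prod_topology (mtop M) (mtop M)) A" using A(1) by (simp add: prod_manifold_def)
  then obtain U1 U2 where U12: "openin (mtop M) U1" "openin (mtop M) U2" "f p \<in> U1" "g p \<in> U2" "U1 \<times> U2 \<subseteq> A"
    using A(2) unfolding openin_prod_topology_alt by meson
  obtain e where e: "e \<in> charts N" "p \<in> cdom e"
    using atlas_cover[OF N] openin_subset[OF smooth_map_on_openin[OF f]] p by blast
  note ee = atlas_chart[OF N e(1)]
  define B where "B = {x \<in> U. f x \<in> U1} \<inter> {x \<in> U. g x \<in> U2} \<inter> cdom e"
  have B: "openin (mtop N) B"
    unfolding B_def using smooth_map_on_openin_preimage[OF N M f U12(1)]
      smooth_map_on_openin_preimage[OF N M g U12(2)] chart_openin_cdom[OF ee] by blast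
  have fg: "(f q, g q) \<in> A" "f q \<in> cdom c1" "g q \<in> cdom c2" if "q \<in> B" for q
    using that U12(5) A(3) unfolding B_def b_def by auto
  have Be: "B \<subseteq> U \<inter> cdom e" "B \<subseteq> cdom e" "f ` B \<subseteq> cdom c1" "g ` B \<subseteq> cdom c2" using fg unfolding B_def by auto
  have oB: "openin (top_of_set (cspace e)) (cmap e ` B)" using chart_openin_image[OF ee B Be(2)] .
  let ?F = "\<lambda>y. ((cmap c1 \<circ> f \<circ> cinv e) y, (cmap c2 \<circ> g \<circ> cinv e) y)"
  have s1: "smooth_on (cspace e) (cmap e ` B) ?F"
    by (intro smooth_on_Pair smooth_map_on_in_charts[OF N M f e(1) c1 B Be(1,3)]
        smooth_map_on_in_charts[OF N M g e(1) c2 B Be(1,4)])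
  have Fq: "?F (cmap e q) = cmap b (f q, g q)" if "q \<in> B" for q
    using cinv_cmap[OF ee] Be(2) that by (auto simp: b_def)
  have inv: "cinv b (cmap b (x, y)) = (x, y)" if "x \<in> cdom c1" "y \<in> cdom c2" for x y
  proof -
    have "inj_on (cmap b) (cdom b)"
      unfolding b_def using map_prod_inj_on[OF chart_inj[OF cc1] chart_inj[OF cc2]] by simp
    then show ?thesis unfolding cinv_def by (rule inv_into_f_f) (use that in \<open>simp add: b_def\<close>)
  qed
  have im: "?F ` cmap e ` B \<subseteq> cmap b ` A" using Fq fg(1) by force
  have sub: "cmap b ` A \<subseteq> cspace b"
    using A(3) chart_in_cspace[OF cc1] chart_in_cspace[OF cc2] unfolding b_def by auto
  have sb: "subspace (cspace b)" unfolding b_def using chart_subspace[OF cc1] chart_subspace[OF cc2] subspace_Times by simp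
  have "smooth_on (cspace e) (cmap e ` B) (\<lambda>y. (cmap d \<circ> (\<lambda>(x, y). x \<otimes>\<^bsub>G\<^esub> y) \<circ> cinv b) (?F y))"
    by (rule smooth_on_compose[OF chart_subspace[OF ee] sb oB sub im s1 sm])
  then have "smooth_on (cspace e) (cmap e ` B) (cmap d \<circ> (\<lambda>x. f x \<otimes>\<^bsub>G\<^esub> g x) \<circ> cinv e)"
  proof (rule smooth_on_cong[OF oB, rotated])
    fix x assume "x \<in> cmap e ` B"
    then obtain q where q: "q \<in> B" "x = cmap e q" by blast
    have "?F x = cmap b (f q, g q)" using Fq q by blast
    then show "(cmap d \<circ> (\<lambda>(x, y). x \<otimes>\<^bsub>G\<^esub> y) \<circ> cinv b) (?F x) = (cmap d \<circ> (\<lambda>x. f x \<otimes>\<^bsub>G\<^esub> g x) \<circ> cinv e) x"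
      using inv[OF fg(2,3)[OF q(1)]] q cinv_cmap[OF ee] Be(2) by auto
  qed
  moreover have "p \<in> B" using p U12 e unfolding B_def by blast
  moreover have "(\<lambda>x. f x \<otimes>\<^bsub>G\<^esub> g x) ` B \<subseteq> cdom d" using fg(1) A(4) by force
  ultimately show "\<exists>c\<in>charts N. \<exists>d\<in>charts M. \<exists>A. openin (mtop N) A \<and> p \<in> A \<and> A \<subseteq> U \<inter> cdom c \<and>
      (\<lambda>x. f x \<otimes>\<^bsub>G\<^esub> g x) ` A \<subseteq> cdom d \<and>
      smooth_on (cspace c) (cmap c ` A) (cmap d \<circ> (\<lambda>x. f x \<otimes>\<^bsub>G\<^esub> g x) \<circ> cinv c)"
    using e d B Be(1) by blast
qed

section \<open>Derivatives in charts and tangent vectors\<close>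

text \<open>Coordinate form of the differential of \<open>f\<close>. Being a derivative within
  \<open>cspace c\<close>, it carries information in directions of that subspace only.\<close>

definition chart_derivative ::
  "('a, 'e::euclidean_space) chart \<Rightarrow> ('b, 'f::euclidean_space) chart \<Rightarrow> ('a \<Rightarrow> 'b) \<Rightarrow> 'a \<Rightarrow> 'e \<Rightarrow> 'f"
where
  "chart_derivative c d f p = frechet_derivative (cmap d \<circ> f \<circ> cinv c) (at (cmap c p) within cspace c)"

lemma smooth_map_on_chart_derivative:
  fixes M :: "('a, 'e::euclidean_space) manifold" and N :: "('b, 'f::euclidean_space) manifold"
  assumes M: "smooth_atlas M" and N: "smooth_atlas N" and f: "smooth_map_on M N U f" and p: "p \<in> U"
    and c: "c \<in> charts M" "p \<in> cdom c" and d: "d \<in> charts N" "f p \<in> cdom d"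
  shows "(cmap d \<circ> f \<circ> cinv c has_derivative chart_derivative c d f p) (at (cmap c p) within cspace c)"
    and "v \<in> cspace c \<Longrightarrow> chart_derivative c d f p v \<in> cspace d"
proof -
  note cc = atlas_chart[OF M c(1)] and dd = atlas_chart[OF N d(1)]
  define A where "A = {x \<in> U. f x \<in> cdom d} \<inter> cdom c"
  have A: "openin (mtop M) A" unfolding A_def
    using smooth_map_on_openin_preimage[OF M N f chart_openin_cdom[OF dd]] chart_openin_cdom[OF cc] by blast
  have A2: "A \<subseteq> U \<inter> cdom c" "f ` A \<subseteq> cdom d" "A \<subseteq> cdom c" unfolding A_def by auto
  have pA: "cmap c p \<in> cmap c ` A" unfolding A_def using p c d by blast
  have oA: "openin (top_of_set (cspace c)) (cmap c ` A)" using chart_openin_image[OF cc A A2(3)] .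
  have "Ck_on (Suc 0) (cspace c) (cmap c ` A) (cmap d \<circ> f \<circ> cinv c)"
    using smooth_onD[OF smooth_map_on_in_charts[OF M N f c(1) d(1) A A2(1,2)]] .
  then obtain D where "(cmap d \<circ> f \<circ> cinv c has_derivative D) (at (cmap c p) within cspace c)"
    using pA by auto
  then show 1: "(cmap d \<circ> f \<circ> cinv c has_derivative chart_derivative c d f p) (at (cmap c p) within cspace c)"
    unfolding chart_derivative_def using differentiableI frechet_derivative_works by blast
  have im: "(cmap d \<circ> f \<circ> cinv c) ` cmap c ` A \<subseteq> cspace d"
  proof
    fix y assume "y \<in> (cmap d \<circ> f \<circ> cinv c) ` cmap c ` A"
    then obtain q where q: "q \<in> A" "y = cmap d (f (cinv c (cmap c q)))" by auto
    then have "y = cmap d (f q)" "f q \<in> cdom d" using cinv_cmap[OF cc] A2 by auto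
    then show "y \<in> cspace d" using chart_in_cspace[OF dd] by simp
  qed
  show "v \<in> cspace c \<Longrightarrow> chart_derivative c d f p v \<in> cspace d"
    by (rule has_derivative_value_in_subspace[OF chart_subspace[OF cc] chart_subspace[OF dd] oA pA im 1])
qed

lemma chart_derivative_eqI:
  assumes "is_chart T c" "p \<in> cdom c"
    "(cmap d \<circ> f \<circ> cinv c has_derivative D) (at (cmap c p) within cspace c)" "v \<in> cspace c"
  shows "chart_derivative c d f p v = D v"
  unfolding chart_derivative_def
  by (rule frechet_derivative_within_subspace[OF chart_subspace[OF assms(1)] chart_in_cspace[OF assms(1,2)] assms(3,4)])

text \<open>The coordinate expressions compose only where \<open>f\<close> lands in the middle
  chart; that set is open, so the derivative within \<open>cspace c\<close> can be computed on
  it.\<close>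

lemma chart_derivative_compose:
  fixes M :: "('a, 'e::euclidean_space) manifold" and N :: "('b, 'f::euclidean_space) manifold"
    and Q :: "('c, 'g::euclidean_space) manifold"
  assumes M: "smooth_atlas M" and N: "smooth_atlas N" and Q: "smooth_atlas Q"
    and f: "smooth_map_on M N U f" and g: "smooth_map_on N Q V g" and p: "p \<in> U" "f p \<in> V"
    and c: "c \<in> charts M" "p \<in> cdom c" and d: "d \<in> charts N" "f p \<in> cdom d"
    and e: "e \<in> charts Q" "g (f p) \<in> cdom e" and v: "v \<in> cspace c"
  shows "chart_derivative c e (\<lambda>x. g (f x)) p v = chart_derivative d e g (f p) (chart_derivative c d f p v)"
proof (rule chart_derivative_eqI[OF atlas_chart[OF M c(1)] c(2) _ v])
  note cc = atlas_chart[OF M c(1)] and dd = atlas_chart[OF N d(1)]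
  define A where "A = {x \<in> U. f x \<in> cdom d} \<inter> cdom c"
  have A: "openin (mtop M) A" unfolding A_def
    using smooth_map_on_openin_preimage[OF M N f chart_openin_cdom[OF dd]] chart_openin_cdom[OF cc] by blast
  have Ac: "A \<subseteq> cdom c" unfolding A_def by blast
  have pA: "cmap c p \<in> cmap c ` A" unfolding A_def using p c d by blast
  have oA: "openin (top_of_set (cspace c)) (cmap c ` A)" using chart_openin_image[OF cc A Ac] .
  have pt: "(cmap d \<circ> f \<circ> cinv c) (cmap c q) = cmap d (f q)" "cinv d (cmap d (f q)) = f q"
      "cmap d (f q) \<in> cspace d" "cinv c (cmap c q) = q" if "q \<in> A" for q
    using cinv_cmap[OF cc, of q] cinv_cmap[OF dd, of "f q"] chart_in_cspace[OF dd, of "f q"] that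
    unfolding A_def by auto
  have 1: "(cmap d \<circ> f \<circ> cinv c has_derivative chart_derivative c d f p) (at (cmap c p) within cmap c ` A)"
    using smooth_map_on_chart_derivative(1)[OF M N f p(1) c d] unfolding at_within_relopen[OF oA pA] .
  have eq: "(cmap d \<circ> f \<circ> cinv c) (cmap c p) = cmap d (f p)" using cinv_cmap[OF cc c(2)] by simp
  have sub: "(cmap d \<circ> f \<circ> cinv c) ` cmap c ` A \<subseteq> cspace d" using pt(1,3) by auto
  have "(cmap e \<circ> g \<circ> cinv d has_derivative chart_derivative d e g (f p))
      (at ((cmap d \<circ> f \<circ> cinv c) (cmap c p)) within (cmap d \<circ> f \<circ> cinv c) ` cmap c ` A)"
    unfolding eq by (rule has_derivative_subset[OF smooth_map_on_chart_derivative(1)[OF N Q g p(2) d e] sub])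
  from has_derivative_in_compose[OF 1 this]
  have "((\<lambda>x. (cmap e \<circ> g \<circ> cinv d) ((cmap d \<circ> f \<circ> cinv c) x)) has_derivative
      (\<lambda>v. chart_derivative d e g (f p) (chart_derivative c d f p v))) (at (cmap c p) within cspace c)"
    unfolding at_within_relopen[OF oA pA] .
  then show "(cmap e \<circ> (\<lambda>x. g (f x)) \<circ> cinv c has_derivative
      (\<lambda>v. chart_derivative d e g (f p) (chart_derivative c d f p v))) (at (cmap c p) within cspace c)"
  proof (rule has_derivative_transform_relopen[OF oA pA, rotated])
    fix y assume "y \<in> cmap c ` A"
    then obtain q where q: "q \<in> A" "y = cmap c q" by blast
    show "(cmap e \<circ> g \<circ> cinv d) ((cmap d \<circ> f \<circ> cinv c) y) = (cmap e \<circ> (\<lambda>x. g (f x)) \<circ> cinv c) y"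
      using pt[OF q(1)] q(2) by simp
  qed
qed

text \<open>The curve is asked to be differentiable at 0 only, because the level curves used later
  are no better. Its velocity lies in \<open>cspace c\<close> because the coordinate curve stays in
  this subspace near 0.\<close>

lemma has_vector_derivative_in_charts:
  fixes M :: "('a, 'e::euclidean_space) manifold" and N :: "('b, 'f::euclidean_space) manifold"
  assumes M: "smooth_atlas M" and N: "smooth_atlas N" and f: "smooth_map_on M N U f"
    and p: "\<gamma> 0 \<in> U" and c: "c \<in> charts M" and d: "d \<in> charts N" "f (\<gamma> 0) \<in> cdom d"
    and w: "((\<lambda>t. cmap c (\<gamma> t)) has_vector_derivative w) (at 0)"
    and e: "0 < e" "\<And>t. \<bar>t\<bar> < e \<Longrightarrow> \<gamma> t \<in> cdom c"
  shows "w \<in> cspace c"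
    and "((\<lambda>t. cmap d (f (\<gamma> t))) has_vector_derivative chart_derivative c d f (\<gamma> 0) w) (at 0)"
proof -
  note cc = atlas_chart[OF M c]
  let ?I = "{-e<..<e}"
  have I: "openin (top_of_set (UNIV :: real set)) ?I" "(0::real) \<in> ?I" "open ?I" using e by auto
  have gI: "\<gamma> t \<in> cdom c" if "t \<in> ?I" for t using e(2)[of t] that by auto
  have im: "(\<lambda>t. cmap c (\<gamma> t)) ` ?I \<subseteq> cspace c" using gI chart_in_cspace[OF cc] by blast
  have wd: "((\<lambda>t. cmap c (\<gamma> t)) has_derivative (\<lambda>t. t *\<^sub>R w)) (at 0 within UNIV)"
    using w by (simp add: has_vector_derivative_def)
  have "1 *\<^sub>R w \<in> cspace c"
    by (rule has_derivative_value_in_subspace[OF subspace_UNIV chart_subspace[OF cc] I(1,2) im wd UNIV_I])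
  then show wc: "w \<in> cspace c" by simp
  have c0: "\<gamma> 0 \<in> cdom c" using gI I(2) by blast
  note D = smooth_map_on_chart_derivative(1)[OF M N f p c c0 d]
  have 1: "((\<lambda>t. cmap c (\<gamma> t)) has_derivative (\<lambda>t. t *\<^sub>R w)) (at 0 within ?I)"
    using has_derivative_subset[OF wd] by blast
  have "((\<lambda>t. (cmap d \<circ> f \<circ> cinv c) (cmap c (\<gamma> t))) has_derivative
      (\<lambda>t. chart_derivative c d f (\<gamma> 0) (t *\<^sub>R w))) (at 0 within ?I)"
    by (rule has_derivative_in_compose[OF 1 has_derivative_subset[OF D im]])
  then have "((\<lambda>t. (cmap d \<circ> f \<circ> cinv c) (cmap c (\<gamma> t))) has_derivative
      (\<lambda>t. chart_derivative c d f (\<gamma> 0) (t *\<^sub>R w))) (at 0 within UNIV)"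
    using at_within_relopen[OF I(1,2)] by simp
  then have "((\<lambda>t. cmap d (f (\<gamma> t))) has_derivative (\<lambda>t. chart_derivative c d f (\<gamma> 0) (t *\<^sub>R w))) (at 0 within UNIV)"
    by (rule has_derivative_transform_relopen[OF I(1,2), rotated]) (simp add: cinv_cmap[OF cc gI])
  then show "((\<lambda>t. cmap d (f (\<gamma> t))) has_vector_derivative chart_derivative c d f (\<gamma> 0) w) (at 0)"
    using linear_scale[OF has_derivative_linear[OF D]] by (simp add: has_vector_derivative_def)
qed

text \<open>The curve is controlled through its coordinates, and only at 0: they enter the
  relatively open image of \<open>U\<close>, and injectivity of the chart brings the conclusion back
  to \<open>\<gamma>\<close>.\<close>

lemma chart_curve_in_open:
  assumes c: "is_chart T c" and U: "openin T U" "\<gamma> 0 \<in> U" and e: "0 < e" "\<And>t. \<bar>t\<bar> < e \<Longrightarrow> \<gamma> t \<in> cdom c"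
    and cont: "isCont (\<lambda>t. cmap c (\<gamma> t)) (0::real)"
  obtains d where "0 < d" "\<And>t. \<bar>t\<bar> < d \<Longrightarrow> \<gamma> t \<in> U"
proof -
  have \<gamma>0: "\<gamma> 0 \<in> U \<inter> cdom c" using U(2) e by simp
  have "openin T (U \<inter> cdom c)" using U(1) chart_openin_cdom[OF c] by blast
  then have "openin (top_of_set (cspace c)) (cmap c ` (U \<inter> cdom c))" using chart_openin_image[OF c] by blast
  then obtain B where B: "open B" "cmap c ` (U \<inter> cdom c) = cspace c \<inter> B" by (auto simp: openin_open)
  have "cmap c (\<gamma> 0) \<in> cmap c ` (U \<inter> cdom c)" using \<gamma>0 by (rule imageI)
  then have 0: "cmap c (\<gamma> 0) \<in> B" unfolding B(2) by simp
  have "\<forall>\<^sub>F t in at 0. cmap c (\<gamma> t) \<in> B" using cont[unfolded isCont_def] B(1) 0 by (rule topological_tendstoD)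
  then obtain d where d: "d > 0" "\<And>t. t \<noteq> 0 \<Longrightarrow> \<bar>t\<bar> < d \<Longrightarrow> cmap c (\<gamma> t) \<in> B"
    unfolding eventually_at by (auto simp: dist_real_def)
  have "\<gamma> t \<in> U" if "\<bar>t\<bar> < min e d" for t
  proof -
    have t: "\<gamma> t \<in> cdom c" using e that by simp
    have "cmap c (\<gamma> t) \<in> B" using d(2)[of t] 0 that by (cases "t = 0") auto
    then have "cmap c (\<gamma> t) \<in> cmap c ` (U \<inter> cdom c)" unfolding B(2) using chart_in_cspace[OF c t] by simp
    then obtain u where u: "u \<in> U \<inter> cdom c" "cmap c (\<gamma> t) = cmap c u" by (rule imageE) simp
    then have "\<gamma> t = u" using inj_onD[OF chart_inj[OF c] u(2) t] by simp
    then show ?thesis using u by simp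
  qed
  then show thesis using that[of "min e d"] e(1) d(1) by simp
qed

section \<open>Tangent vectors, velocities and differentials\<close>

lemma coord_tvec_eq:
  "coord_tvec M c p a d = (if d \<in> charts M \<and> p \<in> cdom d then chart_derivative c d (\<lambda>x. x) p a else 0)"
  by (simp add: coord_tvec_def chart_derivative_def comp_def)

context
  fixes M :: "('a, 'e::euclidean_space) manifold"
  assumes M: "smooth_atlas M"
begin

lemma smooth_map_on_topspace_id: "smooth_map_on M M (topspace (mtop M)) (\<lambda>x. x)"
  by (rule smooth_map_on_id[OF M openin_topspace])

lemma cdom_subset_topspace: "c \<in> charts M \<Longrightarrow> p \<in> cdom c \<Longrightarrow> p \<in> topspace (mtop M)"
  using openin_subset[OF chart_openin_cdom[OF atlas_chart[OF M]]] by blast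

lemma chart_derivative_ident:
  assumes c: "c \<in> charts M" "p \<in> cdom c" and f: "\<And>x. x \<in> cdom c \<Longrightarrow> f x = x" and v: "v \<in> cspace c"
  shows "chart_derivative c c f p v = v"
proof (rule chart_derivative_eqI[OF atlas_chart[OF M c(1)] c(2) _ v])
  note cc = atlas_chart[OF M c(1)]
  show "(cmap c \<circ> f \<circ> cinv c has_derivative (\<lambda>v. v)) (at (cmap c p) within cspace c)"
  proof (rule has_derivative_transform_relopen[OF chart_openin_image_cdom[OF cc] _ _ has_derivative_ident])
    show "cmap c p \<in> cmap c ` cdom c" using c by blast
    show "y = (cmap c \<circ> f \<circ> cinv c) y" if "y \<in> cmap c ` cdom c" for y
      using that cinv_cmap[OF cc] f by auto
  qed
qed

lemma coord_tvec_self: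
  assumes "c \<in> charts M" "p \<in> cdom c" "a \<in> cspace c"
  shows "coord_tvec M c p a c = a"
  using assms chart_derivative_ident[of c p "\<lambda>x. x" a] by (simp add: coord_tvec_eq)

end

lemma chart_derivative_change_domain:
  fixes M :: "('a, 'e::euclidean_space) manifold" and N :: "('b, 'f::euclidean_space) manifold"
  assumes M: "smooth_atlas M" and N: "smooth_atlas N" and f: "smooth_map_on M N U f" and p: "p \<in> U" and c: "c \<in> charts M" "p \<in> cdom c"
    and c': "c' \<in> charts M" "p \<in> cdom c'" and d: "d \<in> charts N" "f p \<in> cdom d" and v: "v \<in> cspace c"
  shows "chart_derivative c' d f p (chart_derivative c c' (\<lambda>x. x) p v) = chart_derivative c d f p v"
  using chart_derivative_compose[OF M M N smooth_map_on_topspace_id[OF M] f cdom_subset_topspace[OF M c] p c c' d v] by simp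

lemma chart_derivative_change_range:
  fixes M :: "('a, 'e::euclidean_space) manifold" and N :: "('b, 'f::euclidean_space) manifold"
  assumes M: "smooth_atlas M" and N: "smooth_atlas N" and f: "smooth_map_on M N U f" and p: "p \<in> U" and c: "c \<in> charts M" "p \<in> cdom c"
    and d: "d \<in> charts N" "f p \<in> cdom d" and d': "d' \<in> charts N" "f p \<in> cdom d'" and v: "v \<in> cspace c"
  shows "chart_derivative d d' (\<lambda>x. x) (f p) (chart_derivative c d f p v) = chart_derivative c d' f p v"
  using chart_derivative_compose[OF M N N f smooth_map_on_topspace_id[OF N] p smooth_map_on_in[OF f p] c d d' v]
  by simp

lemma tangent_spaceD:
  assumes "v \<in> tangent_space M p" "c \<in> charts M" "p \<in> cdom c"
  shows "v c \<in> cspace c" and "coord_tvec M c p (v c) = v"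
  using assms unfolding tangent_space_def by auto

context
  fixes M :: "('a, 'e::euclidean_space) manifold"
  assumes M: "smooth_atlas M"
begin

text \<open>Cocycle property of the transition derivatives; it is what allows a tangent vector to be
  built from its coordinates in any one chart.\<close>

lemma coord_tvec_change:
  assumes c: "c \<in> charts M" "p \<in> cdom c" and d: "d \<in> charts M" "p \<in> cdom d" and a: "a \<in> cspace c"
  shows "coord_tvec M d p (chart_derivative c d (\<lambda>x. x) p a) = coord_tvec M c p a"
  unfolding coord_tvec_eq
  using chart_derivative_change_domain[OF M M smooth_map_on_topspace_id[OF M] cdom_subset_topspace[OF M c] c d _ _ a]
  by (auto simp: fun_eq_iff coord_tvec_eq)

lemma coord_tvec_in_tangent_space:
  assumes c: "c \<in> charts M" "p \<in> cdom c" and a: "a \<in> cspace c"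
  shows "coord_tvec M c p a \<in> tangent_space M p"
  unfolding tangent_space_def
proof (intro CollectI conjI ballI allI impI)
  fix d assume d: "d \<in> charts M" "p \<in> cdom d"
  have eq: "coord_tvec M c p a d = chart_derivative c d (\<lambda>x. x) p a" using d by (simp add: coord_tvec_eq)
  show "coord_tvec M c p a d \<in> cspace d"
    unfolding eq using smooth_map_on_chart_derivative(2)[OF M M smooth_map_on_topspace_id[OF M]
      cdom_subset_topspace[OF M c] c d a] .
  show "coord_tvec M c p a = coord_tvec M d p (coord_tvec M c p a d)"
    unfolding eq using coord_tvec_change[OF c d a] by simp
qed (auto simp: coord_tvec_eq)

lemma linear_chart_derivative_ident:
  assumes c: "c \<in> charts M" "p \<in> cdom c" and d: "d \<in> charts M" "p \<in> cdom d"
  shows "linear (chart_derivative c d (\<lambda>x. x) p)"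
  using has_derivative_linear[OF smooth_map_on_chart_derivative(1)[OF M M smooth_map_on_topspace_id[OF M]
    cdom_subset_topspace[OF M c] c d]] .

lemma coord_tvec_add:
  assumes c: "c \<in> charts M" "p \<in> cdom c"
  shows "coord_tvec M c p (a + b) = coord_tvec M c p a + coord_tvec M c p b"
proof
  fix d
  show "coord_tvec M c p (a + b) d = (coord_tvec M c p a + coord_tvec M c p b) d"
  proof (cases "d \<in> charts M \<and> p \<in> cdom d")
    case True
    then show ?thesis using linear_chart_derivative_ident[OF c] by (simp add: coord_tvec_eq linear_add)
  next
    case False
    then show ?thesis by (simp only: coord_tvec_eq if_False plus_fun_apply add_0)
  qed
qed

lemma coord_tvec_minus:
  assumes c: "c \<in> charts M" "p \<in> cdom c"
  shows "coord_tvec M c p (- a) = - coord_tvec M c p a"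
proof
  fix d
  show "coord_tvec M c p (- a) d = (- coord_tvec M c p a) d"
  proof (cases "d \<in> charts M \<and> p \<in> cdom d")
    case True
    then show ?thesis using linear_chart_derivative_ident[OF c] by (simp add: coord_tvec_eq linear_neg)
  next
    case False
    then show ?thesis by (simp only: coord_tvec_eq if_False fun_Compl_def minus_zero)
  qed
qed

lemma tangent_space_add:
  assumes u: "u \<in> tangent_space M p" and v: "v \<in> tangent_space M p" and p: "p \<in> topspace (mtop M)"
  shows "u + v \<in> tangent_space M p"
proof -
  obtain c where c: "c \<in> charts M" "p \<in> cdom c" using atlas_cover[OF M p] by metis
  have a: "u c + v c \<in> cspace c"
    using subspace_add[OF chart_subspace[OF atlas_chart[OF M c(1)]]] tangent_spaceD(1)[OF u c]
      tangent_spaceD(1)[OF v c] by blast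
  have "coord_tvec M c p (u c + v c) = u + v"
    unfolding coord_tvec_add[OF c] tangent_spaceD(2)[OF u c] tangent_spaceD(2)[OF v c] ..
  then show ?thesis using coord_tvec_in_tangent_space[OF c a] by simp
qed

text \<open>\<open>velocity\<close> is computed in every chart separately; the chain rule for
  transition maps shows that one coordinate velocity determines the whole family.\<close>

lemma smooth_curve_velocity:
  assumes g: "smooth_map_on real_line M I \<gamma>" and I: "open I" "0 \<in> I" and c: "c \<in> charts M" "\<gamma> 0 \<in> cdom c"
  obtains w e where "w \<in> cspace c" "((\<lambda>t. cmap c (\<gamma> t)) has_vector_derivative w) (at 0)"
    "velocity M \<gamma> 0 = coord_tvec M c (\<gamma> 0) w" "0 < e" "\<And>t. \<bar>t\<bar> < e \<Longrightarrow> \<gamma> t \<in> cdom c"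
proof -
  note cc = atlas_chart[OF M c(1)]
  have R: "smooth_atlas real_line" using smooth_atlas_linear[OF subspace_UNIV] .
  define A where "A = {t \<in> I. \<gamma> t \<in> cdom c}"
  have "openin (mtop real_line) A"
    unfolding A_def by (rule smooth_map_on_openin_preimage[OF R M g chart_openin_cdom[OF cc]])
  then have oA: "openin (top_of_set UNIV) A" by simp
  have "smooth_on UNIV A (\<lambda>t. cmap c (\<gamma> t))"
    by (rule smooth_map_on_linear_domain[OF subspace_UNIV M g c(1) oA]) (auto simp: A_def)
  then have "Ck_on (Suc 0) UNIV A (\<lambda>t. cmap c (\<gamma> t))" by (rule smooth_onD)
  moreover have A0: "0 \<in> A" unfolding A_def using I c by blast
  ultimately obtain D where D: "((\<lambda>t. cmap c (\<gamma> t)) has_derivative D) (at 0 within UNIV)" by auto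
  have eq: "D = (\<lambda>t. t *\<^sub>R D 1)" 
  proof (rule ext)
    fix t show "D t = t *\<^sub>R D 1" using linear_scale[OF has_derivative_linear[OF D], of t 1] by simp
  qed
  have w: "((\<lambda>t. cmap c (\<gamma> t)) has_vector_derivative D 1) (at 0)"
    using D unfolding has_vector_derivative_def eq[symmetric] .
  have "open A" using oA by simp
  then obtain e where e: "e > 0" "ball 0 e \<subseteq> A" using A0 open_contains_ball by blast
  have inc: "\<gamma> t \<in> cdom c" if "\<bar>t\<bar> < e" for t
  proof -
    have "t \<in> A" using e(2) that by (auto simp: subset_iff)
    then show ?thesis unfolding A_def by blast
  qed
  note top = cdom_subset_topspace[OF M c]
  have wc: "D 1 \<in> cspace c"
    using has_vector_derivative_in_charts(1)[OF M M smooth_map_on_topspace_id[OF M] top c(1) c w e(1) inc] .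
  have "velocity M \<gamma> 0 = coord_tvec M c (\<gamma> 0) (D 1)"
  proof
    fix d
    show "velocity M \<gamma> 0 d = coord_tvec M c (\<gamma> 0) (D 1) d"
    proof (cases "d \<in> charts M \<and> \<gamma> 0 \<in> cdom d")
      case True
      then have d: "d \<in> charts M" "\<gamma> 0 \<in> cdom d" by blast+
      have "((\<lambda>t. cmap d (\<gamma> t)) has_vector_derivative chart_derivative c d (\<lambda>x. x) (\<gamma> 0) (D 1)) (at 0)"
        using has_vector_derivative_in_charts(2)[OF M M smooth_map_on_topspace_id[OF M] top c(1) d w e(1) inc] .
      from vector_derivative_at[OF this] show ?thesis
        using True by (simp add: velocity_def coord_tvec_eq comp_def)
    qed (simp only: velocity_def coord_tvec_eq if_False)
  qed
  from that[OF wc w this e(1) inc] show thesis .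
qed

end

text \<open>Frees \<open>differential\<close> from its arbitrary choice of a chart: changes of chart
  in domain and range are absorbed by the chain rule.\<close>

lemma differential_eq:
  fixes M :: "('a, 'e::euclidean_space) manifold" and N :: "('b, 'f::euclidean_space) manifold"
  assumes M: "smooth_atlas M" and N: "smooth_atlas N" and f: "smooth_map_on M N U f" and p: "p \<in> U" and c: "c \<in> charts M" "p \<in> cdom c"
    and d: "d \<in> charts N" "f p \<in> cdom d" and v: "v \<in> tangent_space M p"
  shows "differential M N f p v = coord_tvec N d (f p) (chart_derivative c d f p (v c))"
proof
  fix e
  define b where "b = (SOME c. c \<in> charts M \<and> p \<in> cdom c)"
  have b: "b \<in> charts M" "p \<in> cdom b" using someI[of "\<lambda>c. c \<in> charts M \<and> p \<in> cdom c" c] c unfolding b_def by blast+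
  have vc: "v c \<in> cspace c" using tangent_spaceD(1)[OF v c] .
  have vb: "v b = chart_derivative c b (\<lambda>x. x) p (v c)"
    using tangent_spaceD(2)[OF v c] b by (metis coord_tvec_eq)
  have dif: "differential M N f p v e = (if e \<in> charts N \<and> f p \<in> cdom e then chart_derivative b e f p (v b) else 0)"
    unfolding differential_def b_def[symmetric] Let_def chart_derivative_def ..
  show "differential M N f p v e = coord_tvec N d (f p) (chart_derivative c d f p (v c)) e"
  proof (cases "e \<in> charts N \<and> f p \<in> cdom e")
    case True
    then have e: "e \<in> charts N" "f p \<in> cdom e" by blast+
    show ?thesis
      unfolding dif vb coord_tvec_eq
      using chart_derivative_change_domain[OF M N f p c b e vc] chart_derivative_change_range[OF M N f p c d e vc] e by simp
  qed (simp only: dif coord_tvec_eq if_False)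
qed

lemma velocity_in_tangent_space:
  fixes M :: "('a, 'e::euclidean_space) manifold"
  assumes M: "smooth_atlas M" and g: "smooth_map_on real_line M I \<gamma>" and I: "open I" "0 \<in> I"
  shows "velocity M \<gamma> 0 \<in> tangent_space M (\<gamma> 0)"
proof -
  obtain c where c: "c \<in> charts M" "\<gamma> 0 \<in> cdom c" using atlas_cover[OF M smooth_map_on_in[OF g I(2)]] by metis
  obtain w where "w \<in> cspace c" "velocity M \<gamma> 0 = coord_tvec M c (\<gamma> 0) w"
    using smooth_curve_velocity[OF M g I c] by metis
  then show ?thesis using coord_tvec_in_tangent_space[OF M c] by simp
qed

section \<open>Critical values between subspaces\<close>

text \<open>\<open>baby_Sard\<close> concerns \<open>real ^ 'm\<close> with a finite well-ordered
  index type. Indexing coordinates by \<open>Basis\<close> itself gives every Euclidean space a copy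
  of this form with the right dimension.\<close>

typedef (overloaded) 'a basis_index = "Basis :: 'a::euclidean_space set"
  using nonempty_Basis by blast

lemma UNIV_basis_index: "(UNIV :: 'a::euclidean_space basis_index set) = Abs_basis_index ` Basis"
  using type_definition.Abs_image[OF type_definition_basis_index] by metis

instance basis_index :: (euclidean_space) finite
  by standard (simp add: UNIV_basis_index)

text \<open>An arbitrary injection into the natural numbers; it only serves to induce the well-order
  below.\<close>

definition basis_rank :: "'a::euclidean_space basis_index \<Rightarrow> nat" where
  "basis_rank = (SOME f. inj f)"

lemma inj_basis_rank: "inj (basis_rank :: 'a::euclidean_space basis_index \<Rightarrow> nat)"
proof -
  have "\<exists>f :: 'a basis_index \<Rightarrow> nat. inj f"
    using finite_imp_inj_to_nat_seg[of "UNIV :: 'a basis_index set"] by auto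
  then show ?thesis unfolding basis_rank_def by (rule someI_ex)
qed

instantiation basis_index :: (euclidean_space) wellorder
begin

definition less_eq_basis_index :: "'a basis_index \<Rightarrow> 'a basis_index \<Rightarrow> bool" where
  "i \<le> j \<longleftrightarrow> basis_rank i \<le> basis_rank j"

definition less_basis_index :: "'a basis_index \<Rightarrow> 'a basis_index \<Rightarrow> bool" where
  "i < j \<longleftrightarrow> basis_rank i < basis_rank j"

instance
proof
  fix P :: "'a basis_index \<Rightarrow> bool" and a :: "'a basis_index"
  assume "\<And>x. (\<And>y. y < x \<Longrightarrow> P y) \<Longrightarrow> P x"
  then show "P a" unfolding less_basis_index_def by (rule measure_induct_rule[of basis_rank])
qed (auto simp: less_eq_basis_index_def less_basis_index_def dest: injD[OF inj_basis_rank])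

end

lemma CARD_basis_index: "CARD('a::euclidean_space basis_index) = DIM('a)"
  using type_definition.card[OF type_definition_basis_index] .

definition to_vec :: "'a::euclidean_space \<Rightarrow> real ^ 'a basis_index" where
  "to_vec x = (\<chi> i. x \<bullet> Rep_basis_index i)"

definition of_vec :: "real ^ 'a::euclidean_space basis_index \<Rightarrow> 'a" where
  "of_vec v = (\<Sum>i\<in>UNIV. (v $ i) *\<^sub>R Rep_basis_index i)"

lemma linear_to_vec: "linear to_vec"
  by (rule linearI) (auto simp: to_vec_def vec_eq_iff inner_add_left)

lemma linear_of_vec: "linear of_vec"
  by (rule linearI) (auto simp: of_vec_def scaleR_add_left sum.distrib scaleR_sum_right)

lemma of_vec_to_vec: "of_vec (to_vec x) = x"
proof -
  have "bij_betw Rep_basis_index UNIV (Basis :: 'a set)"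
    by (rule bij_betw_imageI)
       (auto simp: inj_on_def Rep_basis_index_inject type_definition.Rep_range[OF type_definition_basis_index])
  from sum.reindex_bij_betw[OF this, of "\<lambda>b. (x \<bullet> b) *\<^sub>R b"]
  have "of_vec (to_vec x) = (\<Sum>b\<in>Basis. (x \<bullet> b) *\<^sub>R b)" unfolding of_vec_def to_vec_def by simp
  then show ?thesis by (simp only: euclidean_representation)
qed

text \<open>In equal dimensions a linear map that is not onto is not injective, so the matrix of the
  derivative has deficient rank and \<open>baby_Sard\<close> applies. The way back is a linear image
  of a negligible set.\<close>

lemma negligible_critical_values:
  fixes f :: "'e::euclidean_space \<Rightarrow> 'e"
  assumes der: "\<And>x. x \<in> S \<Longrightarrow> (f has_derivative f' x) (at x within S)"
    and ns: "\<And>x. x \<in> S \<Longrightarrow> \<not> surj (f' x)"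
  shows "negligible (f ` S)"
proof -
  let ?T = "to_vec ` S"
  let ?g = "\<lambda>v. to_vec (f (of_vec v))" and ?g' = "\<lambda>v h. to_vec (f' (of_vec v) (of_vec h))"
  have bt: "bounded_linear to_vec" and bo: "bounded_linear (of_vec :: real ^ 'e basis_index \<Rightarrow> 'e)"
    using linear_to_vec linear_of_vec linear_conv_bounded_linear by blast+
  have "negligible (?g ` ?T)"
  proof (rule baby_Sard[where f' = ?g'])
    show "CARD('e basis_index) \<le> CARD('e basis_index)" ..
    fix v assume "v \<in> ?T"
    then obtain x where x: "x \<in> S" "v = to_vec x" by blast
    have vx: "of_vec v = x" using x of_vec_to_vec by metis
    have "(of_vec has_derivative of_vec) (at v within ?T)" using bounded_linear_imp_has_derivative[OF bo] .
    moreover have "of_vec ` ?T = S" by (simp add: image_image of_vec_to_vec)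
    ultimately have "((\<lambda>v. f (of_vec v)) has_derivative (\<lambda>h. f' (of_vec v) (of_vec h))) (at v within ?T)"
      using has_derivative_in_compose[of of_vec of_vec v ?T f "f' (of_vec v)"] der[OF x(1)] vx by simp
    then show gd: "(?g has_derivative ?g' v) (at v within ?T)" by (rule bounded_linear.has_derivative[OF bt])
    have "\<not> inj (f' x)"
      using ns[OF x(1)] linear_injective_imp_surjective[OF has_derivative_linear[OF der[OF x(1)]]] by blast
    then obtain y z where yz: "f' x y = f' x z" "y \<noteq> z" unfolding inj_def by blast
    have "\<not> inj (?g' v)"
    proof
      assume "inj (?g' v)"
      moreover have "?g' v (to_vec y) = ?g' v (to_vec z)" using yz(1) of_vec_to_vec vx by metis
      ultimately have "to_vec y = to_vec z" by (rule injD)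
      then show False using yz(2) of_vec_to_vec by metis
    qed
    moreover have "(*v) (matrix (?g' v)) = ?g' v"
      using matrix_vector_mul(2)[OF has_derivative_linear[OF gd]] by auto
    ultimately show "rank (matrix (?g' v)) < CARD('e basis_index)" unfolding less_rank_noninjective by simp
  qed
  then have "negligible (of_vec ` ?g ` ?T)"
    by (rule negligible_differentiable_image_negligible[rotated])
       (auto simp: CARD_basis_index linear_imp_differentiable_on linear_of_vec)
  moreover have "of_vec ` ?g ` ?T = f ` S" by (simp add: image_image of_vec_to_vec)
  ultimately show ?thesis by simp
qed

text \<open>\<open>null_in_subspace\<close> speaks of the cylinder over a set, so \<open>f\<close>
  is extended to a map of the whole space: the component in \<open>W\<close> is sent to
  \<open>U\<close> by a left inverse of an isometric embedding, and the identity is added in the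
  directions orthogonal to \<open>W\<close>. The extension is critical wherever \<open>f\<close> is
  critical as a map to \<open>W\<close>, and its image contains the cylinder.\<close>

lemma null_critical_values_subspace:
  fixes f :: "'e::euclidean_space \<Rightarrow> 'e"
  assumes U: "subspace U" and W: "subspace W" and dim: "dim U \<le> dim W" and S: "S \<subseteq> U"
    and der: "\<And>x. x \<in> S \<Longrightarrow> (f has_derivative f' x) (at x within S)"
    and fW: "\<And>x. x \<in> S \<Longrightarrow> f x \<in> W" and f'W: "\<And>x v. x \<in> S \<Longrightarrow> v \<in> U \<Longrightarrow> f' x v \<in> W"
    and crit: "\<And>x. x \<in> S \<Longrightarrow> \<not> W \<subseteq> f' x ` U"
  shows "null_in_subspace W (f ` S)"
proof -
  let ?P = "subspace_proj W"
  obtain g where g: "linear g" "g \<in> U \<rightarrow> W" "\<And>x. x \<in> U \<Longrightarrow> norm (g x) = norm x"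
    by (rule isometry_subset_subspace[OF U W dim]) blast
  have "inj_on g U"
  proof (rule inj_onI)
    fix x y assume xy: "x \<in> U" "y \<in> U" "g x = g y"
    then have "norm (x - y) = norm (g (x - y))" using g(3) subspace_diff[OF U] by simp
    also have "\<dots> = 0" using xy(3) linear_diff[OF g(1)] by simp
    finally show "x = y" by simp
  qed
  from linear_exists_left_inverse_on[OF g(1) U this]
  obtain i where i: "range i \<subseteq> U" "linear i" "\<And>v. v \<in> U \<Longrightarrow> i (g v) = v" by blast
  define T where "T = {y. i (?P y) \<in> S}"
  \<comment> \<open>\<open>i\<close> after the projection reaches all of \<open>U\<close>, so every
    point of \<open>S\<close> is represented in \<open>T\<close>; the summand
    \<open>y - ?P y\<close> sweeps out the orthogonal directions of the cylinder.\<close>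
  let ?F = "\<lambda>y. f (i (?P y)) + (y - ?P y)"
  let ?F' = "\<lambda>y v. f' (i (?P y)) (i (?P v)) + (v - ?P v)"
  have "bounded_linear (\<lambda>y. i (?P y))"
    using linear_compose[OF linear_subspace_proj[OF W] i(2)] linear_conv_bounded_linear by (auto simp: comp_def)
  then have iP: "((\<lambda>y. i (?P y)) has_derivative (\<lambda>y. i (?P y))) (at y within T)" for y
    by (rule bounded_linear_imp_has_derivative)
  have "negligible (?F ` T)"
  proof (rule negligible_critical_values)
    fix y assume y: "y \<in> T"
    then have x: "i (?P y) \<in> S" by (simp add: T_def)
    have "(f has_derivative f' (i (?P y))) (at (i (?P y)) within (\<lambda>y. i (?P y)) ` T)"
      by (rule has_derivative_subset[OF der[OF x]]) (auto simp: T_def)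
    from has_derivative_in_compose[OF iP this]
    have 1: "((\<lambda>y. f (i (?P y))) has_derivative (\<lambda>v. f' (i (?P y)) (i (?P v)))) (at y within T)" .
    have 2: "(?P has_derivative ?P) (at y within T)"
      using bounded_linear_imp_has_derivative[OF bounded_linear_subspace_proj[OF W]] .
    show "(?F has_derivative ?F' y) (at y within T)"
      using has_derivative_add[OF 1 has_derivative_diff[OF has_derivative_ident 2]] .
    show "\<not> surj (?F' y)"
    proof
      assume sj: "surj (?F' y)"
      have "W \<subseteq> f' (i (?P y)) ` U"
      proof
        fix w assume w: "w \<in> W"
        have "w \<in> range (?F' y)" unfolding sj by (rule UNIV_I)
        then obtain v where v: "w = ?F' y v" by (rule rangeE)
        have iv: "i (?P v) \<in> U" using i(1) by blast
        \<comment> \<open>The orthogonal part of \<open>v\<close> turns out to lie in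
          \<open>W\<close> as well, so it vanishes, and the tangential part alone reaches
          \<open>w\<close>.\<close>
        have "v - ?P v = w - f' (i (?P y)) (i (?P v))" using v by (simp add: algebra_simps)
        then have "v - ?P v \<in> W" using subspace_diff[OF W w f'W[OF x iv]] by simp
        from subspace_proj_orthogonal[OF W this, of v] have "v - ?P v = 0" by (simp add: orthogonal_self)
        then have "w = f' (i (?P y)) (i (?P v))" unfolding v by simp
        then show "w \<in> f' (i (?P y)) ` U" using iv by blast
      qed
      then show False using crit[OF x] by blast
    qed
  qed
  moreover have "f ` S + orthogonal_comp W \<subseteq> ?F ` T"
  proof
    fix z assume "z \<in> f ` S + orthogonal_comp W"
    then obtain x n where x: "x \<in> S" and n: "n \<in> orthogonal_comp W" and z: "z = f x + n"
      by (auto elim: set_plus_elim)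
    have gx: "g x \<in> W" using g(2) x S by blast
    have "?P n \<in> W" using subspace_proj_in[OF W] .
    then have o: "(n - ?P n) \<bullet> ?P n = 0" "?P n \<bullet> n = 0"
      using subspace_proj_orthogonal[OF W] n by (auto simp: orthogonal_comp_def orthogonal_def)
    have "?P n \<bullet> ?P n = ?P n \<bullet> n - (n - ?P n) \<bullet> ?P n"
      by (simp only: inner_diff_left inner_commute[of n "?P n"])
    then have "?P n = 0" unfolding o by simp
    then have P: "?P (g x + n) = g x"
      using linear_add[OF linear_subspace_proj[OF W]] subspace_proj_id[OF W gx] by simp
    have ix: "i (g x) = x" using i(3) x S by blast
    have "g x + n \<in> T" unfolding T_def using P ix x by simp
    moreover have "z = ?F (g x + n)" unfolding P ix z by simp
    ultimately show "z \<in> ?F ` T" by (rule image_eqI[rotated])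
  qed
  ultimately have "negligible (f ` S + orthogonal_comp W)" by (rule negligible_subset)
  moreover have "f ` S \<subseteq> W" using fW by blast
  ultimately show ?thesis unfolding null_in_subspace_def by (rule conjI[rotated])
qed

text \<open>
  A kernel vector of the derivative is the velocity of a curve in the level set: with a right
  inverse \<open>A\<close> of the derivative \<open>H\<close>, the map \<open>x \<mapsto> x + A (f x - H x)\<close> straightens the level set.
\<close>

lemma level_curve:
  fixes f :: "'e::euclidean_space \<Rightarrow> 'f::euclidean_space"
  assumes D: "subspace D" and W: "subspace W" and S: "openin (top_of_set D) S" and f: "Ck_on (Suc 0) D S f"
    and fW: "f ` S \<subseteq> W" and y0: "y0 \<in> S" and H: "(f has_derivative H) (at y0 within D)"
    and onto: "\<And>w. w \<in> W \<Longrightarrow> \<exists>v\<in>D. H v = w" and z: "z \<in> D" "H z = 0"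
  obtains \<eta> e where "\<eta> 0 = y0" "0 < e" "\<And>t::real. \<bar>t\<bar> < e \<Longrightarrow> \<eta> t \<in> S \<and> f (\<eta> t) = f y0"
    "(\<eta> has_vector_derivative z) (at 0)"
proof -
  let ?P = "subspace_proj D"
  have SD: "S \<subseteq> D" using S openin_imp_subset by blast
  have y0D: "y0 \<in> D" using y0 SD by blast
  have linH: "linear H" using H has_derivative_linear by blast
  obtain A where A: "range A \<subseteq> D" "linear A" "\<And>w. w \<in> W \<Longrightarrow> H (A w) = w"
    using linear_exists_right_inverse_on[OF linH D] onto by (metis image_eqI)
  have bA: "bounded_linear A" using A(2) linear_conv_bounded_linear by blast
  obtain f' where f': "\<And>x. x \<in> S \<Longrightarrow> (f has_derivative f' x) (at x within D)"
    "\<And>v. Ck_on 0 D S (\<lambda>x. f' x v)" "\<And>x v. f' x v = f' x (?P v)"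
    using Ck_on_Suc_derivative[OF D SD f] by metis
  define U where "U = ?P -` S"
  have "open U"
  proof -
    obtain T where T: "open T" "S = D \<inter> T" using S by (auto simp: openin_open)
    have "U = ?P -` T" unfolding U_def T(2) using subspace_proj_in[OF D] by blast
    then show ?thesis
      using open_vimage[OF T(1)] bounded_linear_subspace_proj[OF D] linear_continuous_on by metis
  qed
  have PS: "?P x \<in> S" if "x \<in> U" for x using that by (simp add: U_def)
  \<comment> \<open>On \<open>S\<close> the correction gives \<open>H (?\<Phi> x) = f x\<close>, so
    level sets of \<open>f\<close> become those of the linear map \<open>H\<close>. Projecting first
    makes the map live on an open set of the whole type, as the inverse function theorem requires;
    its derivative at \<open>y0\<close> is the identity.\<close>
  let ?\<Phi> = "\<lambda>x. x + A (f (?P x) - H (?P x))"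
  let ?\<Phi>' = "\<lambda>x v. v + A (f' (?P x) v - H (?P v))"
  have der: "(?\<Phi> has_derivative ?\<Phi>' x) (at x)" if x: "x \<in> U" for x
  proof -
    have P: "(?P has_derivative ?P) (at x)"
      using bounded_linear_imp_has_derivative[OF bounded_linear_subspace_proj[OF D]] .
    have "(f has_derivative f' (?P x)) (at (?P x) within range ?P)"
      by (rule has_derivative_subset[OF f'(1)[OF PS[OF x]]]) (use subspace_proj_in[OF D] in blast)
    from has_derivative_in_compose[OF P this]
    have "((\<lambda>x. f (?P x)) has_derivative (\<lambda>v. f' (?P x) v)) (at x)" using f'(3) by simp
    moreover have "((\<lambda>x. H (?P x)) has_derivative (\<lambda>v. H (?P v))) (at x)"
      using bounded_linear.has_derivative[OF _ P] linH linear_conv_bounded_linear by blast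
    ultimately show ?thesis
      by (intro has_derivative_add has_derivative_ident bounded_linear.has_derivative[OF bA] has_derivative_diff)
  qed
  have bl: "bounded_linear (?\<Phi>' x)" if "x \<in> U" for x using der[OF that] has_derivative_bounded_linear by blast
  define B where "B x = Blinfun (?\<Phi>' x)" for x
  have B: "blinfun_apply (B x) = ?\<Phi>' x" if "x \<in> U" for x
    unfolding B_def using bounded_linear_Blinfun_apply[OF bl[OF that]] .
  \<comment> \<open>The inverse function theorem wants the derivative continuous in operator norm;
    in finite dimension continuity at each basis vector is enough.\<close>
  have contB: "continuous_on U B"
  proof (rule continuous_on_blinfun_componentwise)
    fix i :: 'e
    have "continuous_on U (\<lambda>x. f' (?P x) i)"
    proof (rule continuous_on_compose2[of S "\<lambda>x. f' x i"])
      show "continuous_on S (\<lambda>x. f' x i)" using f'(2)[of i] by simp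
      show "continuous_on U ?P" using bounded_linear_subspace_proj[OF D] linear_continuous_on by blast
    qed (use PS in blast)
    then have "continuous_on U (\<lambda>x. ?\<Phi>' x i)"
      by (intro continuous_intros bounded_linear.continuous_on[OF bA])
    then show "continuous_on U (\<lambda>x. blinfun_apply (B x) i)" by (simp add: B cong: continuous_on_cong)
  qed
  have Py0: "?P y0 = y0" using subspace_proj_id[OF D y0D] .
  have y0U: "y0 \<in> U" unfolding U_def using Py0 y0 by simp
  have f'H: "f' y0 v = H (?P v)" for v
    using f'(3) has_derivative_within_subspace_unique[OF D y0D f'(1)[OF y0] H subspace_proj_in[OF D]] by metis
  have By0: "blinfun_apply (B y0) = (\<lambda>v. v)"
    unfolding B[OF y0U] Py0 using f'H linear_0[OF A(2)] by simp
  then have inv: "id_blinfun o\<^sub>L B y0 = id_blinfun" by (intro blinfun_eqI) simp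
  have derB: "(?\<Phi> has_derivative blinfun_apply (B x)) (at x)" if "x \<in> U" for x
    unfolding B[OF that] using der[OF that] .
  obtain U' V' g g' where U': "open U'" "U' \<subseteq> U" "y0 \<in> U'" and V': "open V'" "?\<Phi> y0 \<in> V'"
    and hom: "homeomorphism U' V' ?\<Phi> g"
    and gd: "\<And>y. y \<in> V' \<Longrightarrow> (g has_derivative g' y) (at y)"
    and g': "\<And>y. y \<in> V' \<Longrightarrow> g' y = inv_into UNIV (blinfun_apply (B (g y)))"
    and "\<And>y. y \<in> V' \<Longrightarrow> bij (blinfun_apply (B (g y)))"
    by (rule inverse_function_theorem[OF \<open>open U\<close> derB contB y0U inv]) (assumption, rule that)
  have gy0: "g (?\<Phi> y0) = y0" using homeomorphism_apply1[OF hom U'(3)] .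
  have g'0: "g' (?\<Phi> y0) = (\<lambda>v. v)" unfolding g'[OF V'(2)] gy0 By0 by (rule ext, rule inv_f_eq) (auto simp: inj_on_def)
  \<comment> \<open>\<open>H\<close> is constant along this line since \<open>H z = 0\<close>; the
    local inverse \<open>g\<close> carries it into a level set of \<open>f\<close>, with velocity
    \<open>z\<close>.\<close>
  let ?l = "\<lambda>t. ?\<Phi> y0 + t *\<^sub>R z"
  have "open (?l -` V')" by (intro open_vimage V'(1) continuous_intros)
  moreover have "0 \<in> ?l -` V'" using V'(2) by simp
  ultimately obtain e where e: "e > 0" "ball 0 e \<subseteq> ?l -` V'" using open_contains_ball by blast
  have \<Phi>D: "?\<Phi> y0 \<in> D" using y0D A(1) subspace_add[OF D] by blast
  have H\<Phi>: "H (?\<Phi> x) = f x" if "x \<in> S" for x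
  proof -
    have xD: "x \<in> D" using that SD by blast
    have "f x - H x \<in> W"
    proof (rule subspace_diff[OF W])
      show "f x \<in> W" using fW that by blast
      show "H x \<in> W" using has_derivative_value_in_subspace[OF D W S y0 fW H xD] .
    qed
    from A(3)[OF this] show ?thesis using linear_add[OF linH] subspace_proj_id[OF D xD] by simp
  qed
  have lev: "g (?l t) \<in> S \<and> f (g (?l t)) = f y0" if t: "\<bar>t\<bar> < e" for t
  proof -
    let ?x = "g (?l t)"
    have "t \<in> ball 0 e" using t by simp
    then have lV: "?l t \<in> V'" using e(2) by blast
    have xU: "?x \<in> U" using homeomorphism_image2[OF hom] lV U'(2) by blast
    have \<Phi>x: "?\<Phi> ?x = ?l t" using homeomorphism_apply2[OF hom lV] .
    \<comment> \<open>The correction takes values in \<open>D\<close>, so a preimage of a point of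
      \<open>D\<close> lies in \<open>D\<close> again.\<close>
    have "?l t \<in> D" using \<Phi>D subspace_add[OF D _ subspace_scale[OF D z(1)]] by blast
    moreover have "?x = ?l t - A (f (?P ?x) - H (?P ?x))" using \<Phi>x by (simp add: algebra_simps)
    moreover have "A (f (?P ?x) - H (?P ?x)) \<in> D" using A(1) by blast
    ultimately have xD: "?x \<in> D" using subspace_diff[OF D] by metis
    have xS: "?x \<in> S" using PS[OF xU] subspace_proj_id[OF D xD] by simp
    have "f ?x = H (?l t)" using H\<Phi>[OF xS] \<Phi>x by simp
    also have "\<dots> = H (?\<Phi> y0)" using linear_add[OF linH] linear_scale[OF linH] z(2) by simp
    also have "\<dots> = f y0" by (rule H\<Phi>[OF y0])
    finally show ?thesis using xS by blast
  qed
  have ld: "(?l has_derivative (\<lambda>t. t *\<^sub>R z)) (at 0)" by (auto intro!: derivative_eq_intros)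
  have "(g has_derivative (\<lambda>v. v)) (at (?l 0))" using gd[OF V'(2)] unfolding g'0 by simp
  from has_derivative_compose[OF ld this]
  have hv: "((\<lambda>t. g (?l t)) has_vector_derivative z) (at 0)" unfolding has_vector_derivative_def .
  show thesis
  proof (rule that[of "\<lambda>t. g (?l t)" e])
    show "g (?l 0) = y0" using gy0 by simp
  qed (rule e(1), rule lev, assumption, rule hv)
qed

section \<open>The exponential map of a Lie group\<close>

locale lie_group_manifold =
  fixes G :: "('g, 'b) monoid_scheme" (structure) and M :: "('g, 'e::euclidean_space) manifold"
  assumes lie_group: "lie_group G M"
begin

lemma atlas: "smooth_atlas M"
  and carrier_eq: "topspace (mtop M) = carrier G"
  and Hausdorff: "Hausdorff_space (mtop M)"
  and smooth_inv: "smooth_map M M (\<lambda>x. inv x)"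
  using lie_group smooth_manifold_imp_atlas unfolding lie_group_def smooth_manifold_def by blast+

sublocale group G using lie_group unfolding lie_group_def by blast

definition c0 :: "('g, 'e) chart" where "c0 = (SOME c. c \<in> charts M \<and> \<one> \<in> cdom c)"

abbreviation V :: "'e set" where "V \<equiv> cspace c0"
abbreviation x0 :: 'e where "x0 \<equiv> cmap c0 \<one>"

lemma c0: "c0 \<in> charts M" "\<one> \<in> cdom c0"
proof -
  obtain c where "c \<in> charts M \<and> \<one> \<in> cdom c"
    using atlas_cover[OF atlas, of \<one>] carrier_eq by auto
  from someI[of "\<lambda>c. c \<in> charts M \<and> \<one> \<in> cdom c", OF this]
  show "c0 \<in> charts M" "\<one> \<in> cdom c0" unfolding c0_def by blast+
qed

lemma is_chart_c0: "is_chart (mtop M) c0" using atlas_chart[OF atlas c0(1)] .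

lemma V: "subspace V" using chart_subspace[OF is_chart_c0] .
lemma x0: "x0 \<in> V" using chart_in_cspace[OF is_chart_c0 c0(2)] .
lemma V_atlas: "smooth_atlas (linear_manifold V)" using smooth_atlas_linear[OF V] .
lemma real_atlas: "smooth_atlas real_line" using smooth_atlas_linear[OF subspace_UNIV] .

lemma smooth_mult:
  fixes N :: "('a, 'f::euclidean_space) manifold"
  shows "smooth_atlas N \<Longrightarrow> smooth_map_on N M U f \<Longrightarrow> smooth_map_on N M U g \<Longrightarrow>
    smooth_map_on N M U (\<lambda>x. f x \<otimes> g x)"
  using smooth_map_on_mult[OF lie_group] .

lemma smooth_id: "smooth_map M M (\<lambda>x. x)" using smooth_map_on_id[OF atlas] by simp

lemma smooth_pow: "smooth_map M M (\<lambda>x. x [^] (n::nat))"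
proof (induction n)
  case 0
  show ?case using smooth_map_on_const[OF atlas atlas openin_topspace, of \<one>] carrier_eq by simp
next
  case (Suc n)
  then show ?case using smooth_mult[OF atlas Suc smooth_id] by simp
qed

lemma smooth_left_translation:
  assumes "a \<in> carrier G"
  shows "smooth_map M M (\<lambda>x. a \<otimes> x)"
  by (rule smooth_mult[OF atlas smooth_map_on_const[OF atlas atlas openin_topspace] smooth_id])
     (simp add: assms carrier_eq)

text \<open>Multiplication by the identity on either side is the identity map, which gives the two
  partial derivatives; linearity adds them.\<close>

lemma chart_mult_derivative:
  obtains A D where "openin (top_of_set (V \<times> V)) A" "(x0, x0) \<in> A"
    "A \<subseteq> (cmap c0 ` cdom c0) \<times> (cmap c0 ` cdom c0)"
    "\<And>y z. (y, z) \<in> A \<Longrightarrow> cinv c0 y \<otimes> cinv c0 z \<in> cdom c0"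
    "smooth_on (V \<times> V) A (\<lambda>p. cmap c0 (cinv c0 (fst p) \<otimes> cinv c0 (snd p)))"
    "((\<lambda>p. cmap c0 (cinv c0 (fst p) \<otimes> cinv c0 (snd p))) has_derivative D) (at (x0, x0) within V \<times> V)"
    "\<And>v w. v \<in> V \<Longrightarrow> w \<in> V \<Longrightarrow> D (v, w) = v + w"
proof -
  let ?\<Omega> = "cmap c0 ` cdom c0"
  let ?m = "\<lambda>p. cinv c0 (fst p) \<otimes> cinv c0 (snd p)"
  have VV: "subspace (V \<times> V)" using V subspace_Times by blast
  have N: "smooth_atlas (linear_manifold (V \<times> V))" using smooth_atlas_linear[OF VV] .
  have o: "openin (top_of_set V) ?\<Omega>" using chart_openin_image_cdom[OF is_chart_c0] .
  have O: "openin (top_of_set (V \<times> V)) (?\<Omega> \<times> ?\<Omega>)" using openin_Times[OF o o] .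
  have s1: "smooth_map_on (linear_manifold (V \<times> V)) M (?\<Omega> \<times> ?\<Omega>) (\<lambda>p. cinv c0 (fst p))"
  proof (rule smooth_map_on_compose[OF N V_atlas _ smooth_map_on_cinv[OF atlas c0(1)]])
    show "smooth_map_on (linear_manifold (V \<times> V)) (linear_manifold V) (?\<Omega> \<times> ?\<Omega>) fst"
      by (rule smooth_map_on_linearI[OF VV O smooth_on_bounded_linear[OF bounded_linear_fst]])
         (use openin_imp_subset[OF o] in auto)
  qed auto
  have s2: "smooth_map_on (linear_manifold (V \<times> V)) M (?\<Omega> \<times> ?\<Omega>) (\<lambda>p. cinv c0 (snd p))"
  proof (rule smooth_map_on_compose[OF N V_atlas _ smooth_map_on_cinv[OF atlas c0(1)]])
    show "smooth_map_on (linear_manifold (V \<times> V)) (linear_manifold V) (?\<Omega> \<times> ?\<Omega>) snd"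
      by (rule smooth_map_on_linearI[OF VV O smooth_on_bounded_linear[OF bounded_linear_snd]])
         (use openin_imp_subset[OF o] in auto)
  qed auto
  have m: "smooth_map_on (linear_manifold (V \<times> V)) M (?\<Omega> \<times> ?\<Omega>) ?m" using smooth_mult[OF N s1 s2] .
  define A where "A = {p \<in> ?\<Omega> \<times> ?\<Omega>. ?m p \<in> cdom c0}"
  have A: "openin (top_of_set (V \<times> V)) A"
    using smooth_map_on_openin_preimage[OF N atlas m chart_openin_cdom[OF is_chart_c0]] by (simp add: A_def)
  have x0O: "x0 \<in> ?\<Omega>" using c0 by blast
  have cx0: "cinv c0 x0 = \<one>" using cinv_cmap[OF is_chart_c0 c0(2)] .
  have xA: "(x0, x0) \<in> A" unfolding A_def using x0O cx0 c0(2) by simp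
  have sm: "smooth_on (V \<times> V) A (\<lambda>p. cmap c0 (?m p))"
    by (rule smooth_map_on_linear_domain[OF VV atlas m c0(1) A]) (auto simp: A_def)
  obtain D where D: "((\<lambda>p. cmap c0 (?m p)) has_derivative D) (at (x0, x0) within V \<times> V)"
    using smooth_onD[OF sm, of "Suc 0"] xA by auto
  have carr: "cinv c0 y \<in> carrier G" "cmap c0 (cinv c0 y) = y" if "y \<in> ?\<Omega>" for y
    using that cinv_cmap[OF is_chart_c0] openin_subset[OF chart_openin_cdom[OF is_chart_c0]] carrier_eq by auto
  have D1: "D (v, 0) = v" if v: "v \<in> V" for v
  proof -
    have 1: "((\<lambda>y. (y, x0)) has_derivative (\<lambda>v. (v, 0))) (at x0 within V)"
      by (auto intro!: derivative_eq_intros)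
    have "(\<lambda>y. (y, x0)) ` V \<subseteq> V \<times> V" using x0 by auto
    from has_derivative_in_compose[OF 1 has_derivative_subset[OF D this]]
    have "((\<lambda>y. cmap c0 (?m (y, x0))) has_derivative (\<lambda>v. D (v, 0))) (at x0 within V)" .
    then have "((\<lambda>y. y) has_derivative (\<lambda>v. D (v, 0))) (at x0 within V)"
      by (rule has_derivative_transform_relopen[OF o x0O, rotated]) (simp add: cx0 carr)
    from has_derivative_within_subspace_unique[OF V x0 this has_derivative_ident v] show ?thesis .
  qed
  have D2: "D (0, v) = v" if v: "v \<in> V" for v
  proof -
    have 1: "((\<lambda>y. (x0, y)) has_derivative (\<lambda>v. (0, v))) (at x0 within V)"
      by (auto intro!: derivative_eq_intros)
    have "(\<lambda>y. (x0, y)) ` V \<subseteq> V \<times> V" using x0 by auto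
    from has_derivative_in_compose[OF 1 has_derivative_subset[OF D this]]
    have "((\<lambda>y. cmap c0 (?m (x0, y))) has_derivative (\<lambda>v. D (0, v))) (at x0 within V)" .
    then have "((\<lambda>y. y) has_derivative (\<lambda>v. D (0, v))) (at x0 within V)"
      by (rule has_derivative_transform_relopen[OF o x0O, rotated]) (simp add: cx0 carr)
    from has_derivative_within_subspace_unique[OF V x0 this has_derivative_ident v] show ?thesis .
  qed
  have "D (v, w) = v + w" if "v \<in> V" "w \<in> V" for v w
    using linear_add[OF has_derivative_linear[OF D], of "(v, 0)" "(0, w)"] D1[OF that(1)] D2[OF that(2)] by simp
  moreover have "A \<subseteq> ?\<Omega> \<times> ?\<Omega>" "\<And>y z. (y, z) \<in> A \<Longrightarrow> cinv c0 y \<otimes> cinv c0 z \<in> cdom c0"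
    unfolding A_def by auto
  ultimately show thesis using that[OF A xA _ _ sm D] by blast
qed

text \<open>
  Differentiability is required at \<open>0\<close> only, so that curves obtained from the inverse function
  theorem, for which no higher regularity is available, are covered.
\<close>

definition curve_at_one :: "(real \<Rightarrow> 'g) \<Rightarrow> 'e \<Rightarrow> bool" where
  "curve_at_one \<alpha> w \<longleftrightarrow> (\<forall>t. \<alpha> t \<in> carrier G) \<and> \<alpha> 0 = \<one> \<and>
     (\<exists>e>0. \<forall>t. \<bar>t\<bar> < e \<longrightarrow> \<alpha> t \<in> cdom c0) \<and>
     ((\<lambda>t. cmap c0 (\<alpha> t)) has_vector_derivative w) (at 0)"

section \<open>Velocities at the identity of images, products, powers and inverses\<close>

lemma curve_at_one_unique: "curve_at_one \<alpha> v \<Longrightarrow> curve_at_one \<alpha> w \<Longrightarrow> v = w"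
  unfolding curve_at_one_def using vector_derivative_unique_at by blast

lemma curve_at_one_velocity: "curve_at_one \<alpha> w \<Longrightarrow> w \<in> V"
  unfolding curve_at_one_def
  using has_vector_derivative_in_charts(1)[OF atlas atlas smooth_id _ c0(1), of \<alpha> c0 w] c0 carrier_eq by fastforce

lemma curve_at_one_const: "curve_at_one (\<lambda>t. \<one>) 0"
  unfolding curve_at_one_def using c0(2) by (auto intro: exI[of _ 1])

lemma curve_at_one_map:
  assumes f: "smooth_map M M f" and f1: "f \<one> = \<one>" and \<alpha>: "curve_at_one \<alpha> w"
  shows "curve_at_one (\<lambda>t. f (\<alpha> t)) (chart_derivative c0 c0 f \<one> w)"
proof -
  note \<alpha>' = \<alpha>[unfolded curve_at_one_def]
  obtain e where e: "e > 0" "\<And>t. \<bar>t\<bar> < e \<Longrightarrow> \<alpha> t \<in> cdom c0" using \<alpha>' by blast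
  have \<alpha>0: "\<alpha> 0 = \<one>" using \<alpha>' by blast
  have top: "\<alpha> 0 \<in> topspace (mtop M)" using \<alpha>0 carrier_eq by simp
  have f0: "f (\<alpha> 0) \<in> cdom c0" using \<alpha>0 f1 c0 by simp
  have w: "((\<lambda>t. cmap c0 (\<alpha> t)) has_vector_derivative w) (at 0)" using \<alpha>' by blast
  have der: "((\<lambda>t. cmap c0 (f (\<alpha> t))) has_vector_derivative chart_derivative c0 c0 f \<one> w) (at 0)"
    using has_vector_derivative_in_charts(2)[OF atlas atlas f top c0(1) c0(1) f0 w e] \<alpha>0 by simp
  have U: "openin (mtop M) {x \<in> topspace (mtop M). f x \<in> cdom c0}"
    by (rule smooth_map_on_openin_preimage[OF atlas atlas f chart_openin_cdom[OF is_chart_c0]])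
  have \<alpha>U: "\<alpha> 0 \<in> {x \<in> topspace (mtop M). f x \<in> cdom c0}" using top f0 by simp
  obtain d where d: "d > 0" "\<And>t. \<bar>t\<bar> < d \<Longrightarrow> \<alpha> t \<in> {x \<in> topspace (mtop M). f x \<in> cdom c0}"
    by (rule chart_curve_in_open[where \<gamma> = \<alpha>, OF is_chart_c0 U \<alpha>U e has_vector_derivative_continuous[OF w]]) blast+
  then have "\<exists>d>0. \<forall>t. \<bar>t\<bar> < d \<longrightarrow> f (\<alpha> t) \<in> cdom c0" by blast
  moreover have "f (\<alpha> t) \<in> carrier G" for t using smooth_map_on_in[OF f] \<alpha>' carrier_eq by blast
  ultimately show ?thesis
    unfolding curve_at_one_def using der by (simp add: \<alpha>0 f1)
qed

lemma curve_at_one_mult: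
  assumes \<alpha>: "curve_at_one \<alpha> v" and \<beta>: "curve_at_one \<beta> w"
  shows "curve_at_one (\<lambda>t. \<alpha> t \<otimes> \<beta> t) (v + w)"
proof (rule chart_mult_derivative)
  fix A D
  assume A: "openin (top_of_set (V \<times> V)) A" "(x0, x0) \<in> A"
    and Am: "\<And>y z. (y, z) \<in> A \<Longrightarrow> cinv c0 y \<otimes> cinv c0 z \<in> cdom c0"
    and D: "((\<lambda>p. cmap c0 (cinv c0 (fst p) \<otimes> cinv c0 (snd p))) has_derivative D) (at (x0, x0) within V \<times> V)"
    and Dadd: "\<And>v w. v \<in> V \<Longrightarrow> w \<in> V \<Longrightarrow> D (v, w) = v + w"
  note \<alpha>' = \<alpha>[unfolded curve_at_one_def] and \<beta>' = \<beta>[unfolded curve_at_one_def]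
  obtain e1 e2 where e: "e1 > 0" "e2 > 0" "\<And>t. \<bar>t\<bar> < e1 \<Longrightarrow> \<alpha> t \<in> cdom c0" "\<And>t. \<bar>t\<bar> < e2 \<Longrightarrow> \<beta> t \<in> cdom c0"
    using \<alpha>' \<beta>' by blast
  have 0: "\<alpha> 0 = \<one>" "\<beta> 0 = \<one>" using \<alpha>' \<beta>' by blast+
  define e0 where "e0 = min e1 e2"
  let ?I = "{-e0<..<e0}"
  let ?p = "\<lambda>t. (cmap c0 (\<alpha> t), cmap c0 (\<beta> t))"
  have e0: "e0 > 0" unfolding e0_def using e by simp
  have I: "openin (top_of_set (UNIV :: real set)) ?I" "(0::real) \<in> ?I" using e0 by auto
  have dom: "\<alpha> t \<in> cdom c0" "\<beta> t \<in> cdom c0" if "t \<in> ?I" for t using that e(3)[of t] e(4)[of t] by (auto simp: e0_def)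
  have im: "?p ` ?I \<subseteq> V \<times> V" using dom chart_in_cspace[OF is_chart_c0] by blast
  have vd: "((\<lambda>t. cmap c0 (\<alpha> t)) has_derivative (\<lambda>t. t *\<^sub>R v)) (at 0)"
    "((\<lambda>t. cmap c0 (\<beta> t)) has_derivative (\<lambda>t. t *\<^sub>R w)) (at 0)"
    using \<alpha>' \<beta>' unfolding has_vector_derivative_def by blast+
  have pd: "(?p has_derivative (\<lambda>t. (t *\<^sub>R v, t *\<^sub>R w))) (at 0)" using has_derivative_Pair[OF vd] .
  have p0: "?p 0 = (x0, x0)" using 0 by simp
  have "((\<lambda>p. cmap c0 (cinv c0 (fst p) \<otimes> cinv c0 (snd p))) has_derivative D) (at (?p 0) within ?p ` ?I)"
    unfolding p0 by (rule has_derivative_subset[OF D im])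
  from has_derivative_in_compose[OF has_derivative_subset[OF pd subset_UNIV] this]
  have "((\<lambda>t. cmap c0 (cinv c0 (fst (?p t)) \<otimes> cinv c0 (snd (?p t)))) has_derivative
      (\<lambda>t. D (t *\<^sub>R v, t *\<^sub>R w))) (at 0 within ?I)" .
  moreover have "D (t *\<^sub>R v, t *\<^sub>R w) = t *\<^sub>R (v + w)" for t
    using Dadd subspace_scale[OF V] curve_at_one_velocity[OF \<alpha>] curve_at_one_velocity[OF \<beta>]
    by (simp add: scaleR_add_right)
  ultimately have "((\<lambda>t. cmap c0 (cinv c0 (fst (?p t)) \<otimes> cinv c0 (snd (?p t)))) has_derivative
      (\<lambda>t. t *\<^sub>R (v + w))) (at 0 within UNIV)" using at_within_relopen[OF I] by simp
  then have der: "((\<lambda>t. cmap c0 (\<alpha> t \<otimes> \<beta> t)) has_derivative (\<lambda>t. t *\<^sub>R (v + w))) (at 0 within UNIV)"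
    by (rule has_derivative_transform_relopen[OF I, rotated]) (simp add: cinv_cmap[OF is_chart_c0] dom)
  obtain T where T: "open T" "A = (V \<times> V) \<inter> T" using A(1) by (auto simp: openin_open)
  have pT: "?p 0 \<in> T" using A(2) T(2) p0 by auto
  have "isCont ?p 0" using pd has_derivative_continuous by blast
  then have "\<forall>\<^sub>F t in at 0. ?p t \<in> T" using T(1) pT unfolding isCont_def by (rule topological_tendstoD)
  then obtain d where d: "d > 0" "\<And>t. t \<noteq> 0 \<Longrightarrow> \<bar>t\<bar> < d \<Longrightarrow> ?p t \<in> T"
    unfolding eventually_at by (auto simp: dist_real_def)
  have "\<alpha> t \<otimes> \<beta> t \<in> cdom c0" if "\<bar>t\<bar> < min e0 d" for t
  proof -
    have tI: "t \<in> ?I" using that by auto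
    have "?p t \<in> T" using d(2)[of t] pT that by (cases "t = 0") auto
    then have "?p t \<in> A" using T(2) im tI by blast
    from Am[OF this] show ?thesis using cinv_cmap[OF is_chart_c0] dom[OF tI] by simp
  qed
  then show ?thesis
    unfolding curve_at_one_def has_vector_derivative_def
    using der 0 \<alpha>' \<beta>' e0 d(1) by (auto intro!: exI[of _ "min e0 d"])
qed

lemma curve_at_one_pow: "curve_at_one \<alpha> w \<Longrightarrow> curve_at_one (\<lambda>t. \<alpha> t [^] n) (real n *\<^sub>R w)"
proof (induction n)
  case 0
  then show ?case using curve_at_one_const by simp
next
  case (Suc n)
  then show ?case using curve_at_one_mult[OF Suc.IH[OF Suc.prems] Suc.prems] by (simp add: algebra_simps)
qed

text \<open>The product with the original curve is constant, so the two velocities add up to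
  0.\<close>

lemma curve_at_one_inv:
  assumes \<alpha>: "curve_at_one \<alpha> w"
  shows "curve_at_one (\<lambda>t. inv (\<alpha> t)) (- w)"
proof -
  let ?w = "chart_derivative c0 c0 (\<lambda>x. inv x) \<one> w"
  have i: "curve_at_one (\<lambda>t. inv (\<alpha> t)) ?w" using curve_at_one_map[OF smooth_inv _ \<alpha>] by simp
  have "(\<lambda>t. \<alpha> t \<otimes> inv (\<alpha> t)) = (\<lambda>t. \<one>)" using \<alpha> unfolding curve_at_one_def by auto
  then have "curve_at_one (\<lambda>t. \<one>) (w + ?w)" using curve_at_one_mult[OF \<alpha> i] by simp
  then have "w + ?w = 0" using curve_at_one_unique curve_at_one_const by blast
  then have "?w = - w" by (simp add: add_eq_0_iff)
  then show ?thesis using i by simp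
qed

lemma curve_at_one_scale:
  assumes \<alpha>: "curve_at_one \<alpha> w"
  shows "curve_at_one (\<lambda>t. \<alpha> (k * t)) (k *\<^sub>R w)"
proof -
  note \<alpha>' = \<alpha>[unfolded curve_at_one_def]
  obtain e where e: "e > 0" "\<And>t. \<bar>t\<bar> < e \<Longrightarrow> \<alpha> t \<in> cdom c0" using \<alpha>' by blast
  \<comment> \<open>The denominator \<open>\<bar>k\<bar> + 1\<close> also covers
    \<open>k = 0\<close>.\<close>
  have "\<alpha> (k * t) \<in> cdom c0" if "\<bar>t\<bar> < e / (\<bar>k\<bar> + 1)" for t
  proof -
    have "\<bar>k * t\<bar> \<le> (\<bar>k\<bar> + 1) * \<bar>t\<bar>" by (simp add: abs_mult algebra_simps)
    also have "\<dots> < e" using that by (simp add: field_simps)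
    finally show ?thesis by (rule e(2))
  qed
  moreover have "e / (\<bar>k\<bar> + 1) > 0" using e by simp
  moreover have "((\<lambda>t. cmap c0 (\<alpha> (k * t))) has_vector_derivative k *\<^sub>R w) (at 0)"
  proof -
    have 1: "((\<lambda>t. k * t) has_vector_derivative k) (at 0)" by (auto intro!: derivative_eq_intros)
    have "((\<lambda>t. cmap c0 (\<alpha> t)) has_vector_derivative w) (at (k * 0))" using \<alpha>' by simp
    from vector_diff_chain_at[OF 1 this] show ?thesis by (simp add: comp_def)
  qed
  ultimately show ?thesis unfolding curve_at_one_def using \<alpha>' by (metis mult_zero_right)
qed

end

text \<open>Difference quotients within \<open>W\<close> see only vectors of \<open>W\<close>, so
  off \<open>W\<close> the derivative may be exchanged for that of any bounded linear map agreeing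
  with it on \<open>W\<close>.\<close>

lemma has_derivative_within_subspace_cong:
  assumes "subspace W" "x \<in> W" "(f has_derivative f1) (at x within W)"
    "bounded_linear f2" "\<And>v. v \<in> W \<Longrightarrow> f1 v = f2 v"
  shows "(f has_derivative f2) (at x within W)"
proof -
  have "y - x \<in> W" if "y \<in> W" for y using subspace_diff[OF assms(1) that assms(2)] .
  then show ?thesis using assms(3,4,5) unfolding has_derivative_within_alt by metis
qed

section \<open>Squaring in the centred chart and construction of the exponential map\<close>

context lie_group_manifold
begin

text \<open>Squaring is multiplication along the diagonal, whose derivative at the identity is
  \<open>v + v\<close>; subtracting \<open>x0\<close> moves the fixed point to 0.\<close>

lemma centred_square:
  obtains R where "0 < R"
    "\<And>x. x \<in> V \<inter> ball 0 R \<Longrightarrow> x0 + x \<in> cmap c0 ` cdom c0"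
    "\<And>x. x \<in> V \<inter> ball 0 R \<Longrightarrow> cinv c0 (x0 + x) \<otimes> cinv c0 (x0 + x) \<in> cdom c0"
    "doubling_map V (\<lambda>x. cmap c0 (cinv c0 (x0 + x) \<otimes> cinv c0 (x0 + x)) - x0) R"
proof (rule chart_mult_derivative)
  fix A D
  let ?m = "\<lambda>p. cmap c0 (cinv c0 (fst p) \<otimes> cinv c0 (snd p))"
  let ?j = "\<lambda>x. (x0 + x, x0 + x)"
  assume A: "openin (top_of_set (V \<times> V)) A" "(x0, x0) \<in> A"
    and A\<Omega>: "A \<subseteq> (cmap c0 ` cdom c0) \<times> (cmap c0 ` cdom c0)"
    and Am: "\<And>y z. (y, z) \<in> A \<Longrightarrow> cinv c0 y \<otimes> cinv c0 z \<in> cdom c0"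
    and sm: "smooth_on (V \<times> V) A ?m"
    and D: "(?m has_derivative D) (at (x0, x0) within V \<times> V)"
    and Dadd: "\<And>v w. v \<in> V \<Longrightarrow> w \<in> V \<Longrightarrow> D (v, w) = v + w"
  have VV: "subspace (V \<times> V)" using V subspace_Times by blast
  obtain T where T: "open T" "A = (V \<times> V) \<inter> T" using A(1) by (auto simp: openin_open)
  have "open (?j -` T)" by (intro open_vimage T(1) continuous_intros)
  moreover have "0 \<in> ?j -` T" using A(2) T(2) by simp
  ultimately obtain R where R: "R > 0" "ball 0 R \<subseteq> ?j -` T" using open_contains_ball by blast
  have jA: "?j x \<in> A" if "x \<in> V \<inter> ball 0 R" for x
    using that R(2) T(2) subspace_add[OF V x0] by auto
  have jsm: "smooth_on V (V \<inter> ball 0 R) ?j"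
    by (intro smooth_on_Pair smooth_on_add smooth_on_const smooth_on_bounded_linear bounded_linear_ident)
  have ms: "smooth_on V (V \<inter> ball 0 R) (\<lambda>x. ?m (?j x))"
    by (rule smooth_on_compose[OF V VV relopen_ball openin_imp_subset[OF A(1)] _ jsm sm]) (use jA in blast)
  have msq: "?m (?j x) = cmap c0 (cinv c0 (x0 + x) \<otimes> cinv c0 (x0 + x))" for x by simp
  show thesis
  proof (rule that[OF R(1)])
    show "x0 + x \<in> cmap c0 ` cdom c0" if "x \<in> V \<inter> ball 0 R" for x using jA[OF that] A\<Omega> by blast
    show inc: "cinv c0 (x0 + x) \<otimes> cinv c0 (x0 + x) \<in> cdom c0" if "x \<in> V \<inter> ball 0 R" for x
      using Am[OF jA[OF that]] .
    show "doubling_map V (\<lambda>x. cmap c0 (cinv c0 (x0 + x) \<otimes> cinv c0 (x0 + x)) - x0) R"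
    proof
      show "subspace V" by (rule V)
      show "0 < R" by (rule R(1))
      show "smooth_on V (V \<inter> ball 0 R) (\<lambda>x. cmap c0 (cinv c0 (x0 + x) \<otimes> cinv c0 (x0 + x)) - x0)"
        using smooth_on_add[OF ms smooth_on_const[of _ _ "- x0"]] by simp
      show "cmap c0 (cinv c0 (x0 + 0) \<otimes> cinv c0 (x0 + 0)) - x0 = 0"
        using cinv_cmap[OF is_chart_c0 c0(2)] by simp
      show "cmap c0 (cinv c0 (x0 + x) \<otimes> cinv c0 (x0 + x)) - x0 \<in> V" if "x \<in> V \<inter> ball 0 R" for x
        using subspace_diff[OF V chart_in_cspace[OF is_chart_c0 inc[OF that]] x0] .
      have jd: "(?j has_derivative (\<lambda>v. (v, v))) (at 0 within V)" by (auto intro!: derivative_eq_intros)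
      have im: "?j ` V \<subseteq> V \<times> V" using subspace_add[OF V x0] by blast
      have "(?m has_derivative D) (at (?j 0) within ?j ` V)" using has_derivative_subset[OF D im] by simp
      from has_derivative_in_compose[OF jd this]
      have "((\<lambda>x. ?m (?j x) - x0) has_derivative (\<lambda>v. D (v, v) - 0)) (at 0 within V)"
        by (intro has_derivative_diff has_derivative_const)
      then have "((\<lambda>x. cmap c0 (cinv c0 (x0 + x) \<otimes> cinv c0 (x0 + x)) - x0) has_derivative (\<lambda>v. D (v, v))) (at 0 within V)"
        by simp
      from has_derivative_within_subspace_cong[OF V subspace_0[OF V] this bounded_linear_scaleR_right[of 2]]
      show "((\<lambda>x. cmap c0 (cinv c0 (x0 + x) \<otimes> cinv c0 (x0 + x)) - x0) has_derivative (\<lambda>v. 2 *\<^sub>R v)) (at 0 within V)"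
        using Dadd by (simp add: scaleR_2)
    qed
  qed
qed

text \<open>The quadratic error bound is kept because it fixes the value at 0 and the initial
  velocity of every ray.\<close>

lemma local_exponential:
  obtains r e K where "0 < r" "smooth_map_on (linear_manifold V) M (V \<inter> ball 0 r) e"
    "\<And>x. x \<in> V \<inter> ball 0 r \<Longrightarrow> e x = e ((1/2) *\<^sub>R x) \<otimes> e ((1/2) *\<^sub>R x)"
    "\<And>x. x \<in> V \<inter> ball 0 r \<Longrightarrow> e x \<in> cdom c0"
    "\<And>x. x \<in> V \<inter> ball 0 r \<Longrightarrow> norm (cmap c0 (e x) - x0 - x) \<le> K * (norm x)\<^sup>2"
proof (rule centred_square)
  fix R
  let ?s = "\<lambda>x. cmap c0 (cinv c0 (x0 + x) \<otimes> cinv c0 (x0 + x)) - x0"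
  assume R: "0 < R" and in\<Omega>: "\<And>x. x \<in> V \<inter> ball 0 R \<Longrightarrow> x0 + x \<in> cmap c0 ` cdom c0"
    and sq: "\<And>x. x \<in> V \<inter> ball 0 R \<Longrightarrow> cinv c0 (x0 + x) \<otimes> cinv c0 (x0 + x) \<in> cdom c0"
    and dm: "doubling_map V ?s R"
  show thesis
  proof (rule doubling_map.linearization[OF dm])
    fix r K E
    assume r: "0 < r" "r \<le> R" and E: "\<And>x. x \<in> V \<inter> ball 0 r \<Longrightarrow> E x \<in> V \<inter> ball 0 R"
      and eq: "\<And>x. x \<in> V \<inter> ball 0 r \<Longrightarrow> E x = ?s (E ((1/2) *\<^sub>R x))"
      and K: "\<And>x. x \<in> V \<inter> ball 0 r \<Longrightarrow> norm (E x - x) \<le> K * (norm x)\<^sup>2"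
      and sm: "smooth_on V (V \<inter> ball 0 r) E"
    let ?e = "\<lambda>x. cinv c0 (x0 + E x)"
    have \<Omega>: "x0 + E x \<in> cmap c0 ` cdom c0" if "x \<in> V \<inter> ball 0 r" for x using in\<Omega>[OF E[OF that]] .
    have eE: "cmap c0 (?e x) = x0 + E x" "?e x \<in> cdom c0" if "x \<in> V \<inter> ball 0 r" for x
      using \<Omega>[OF that] cinv_cmap[OF is_chart_c0] by auto
    show thesis
    proof (rule that[of r ?e K])
      show "0 < r" by (rule r)
      show "smooth_map_on (linear_manifold V) M (V \<inter> ball 0 r) ?e"
      proof (rule smooth_map_on_compose[OF V_atlas V_atlas _ smooth_map_on_cinv[OF atlas c0(1)] \<Omega>])
        show "smooth_map_on (linear_manifold V) (linear_manifold V) (V \<inter> ball 0 r) (\<lambda>x. x0 + E x)"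
        proof (rule smooth_map_on_linearI[OF V relopen_ball smooth_on_add[OF smooth_on_const sm]])
          show "(\<lambda>x. x0 + E x) ` (V \<inter> ball 0 r) \<subseteq> V" using E subspace_add[OF V x0] by blast
        qed
      qed
      show "?e x = ?e ((1/2) *\<^sub>R x) \<otimes> ?e ((1/2) *\<^sub>R x)" if x: "x \<in> V \<inter> ball 0 r" for x
      proof -
        have "x0 + E x = cmap c0 (?e ((1/2) *\<^sub>R x) \<otimes> ?e ((1/2) *\<^sub>R x))"
          by (subst eq[OF x]) simp
        then show ?thesis
          using cinv_cmap[OF is_chart_c0 sq[OF E[OF half_in_ball(1)[OF V x]]]] by simp
      qed
      show "?e x \<in> cdom c0" if "x \<in> V \<inter> ball 0 r" for x using eE(2)[OF that] .
      show "norm (cmap c0 (?e x) - x0 - x) \<le> K * (norm x)\<^sup>2" if "x \<in> V \<inter> ball 0 r" for x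
        using K[OF that] eE(1)[OF that] by simp
    qed
  qed
qed

text \<open>
  A curve with \<open>\<alpha> (2 t) = \<alpha> t \<otimes> \<alpha> t\<close> is determined by its velocity at \<open>0\<close>, because squaring expands
  distances near \<open>\<one>\<close> by a factor close to \<open>2\<close>.
\<close>

lemma doubling_curve_unique:
  assumes \<alpha>: "curve_at_one \<alpha> w" and \<beta>: "curve_at_one \<beta> w"
    and \<alpha>2: "\<And>t. \<alpha> (2 * t) = \<alpha> t \<otimes> \<alpha> t" and \<beta>2: "\<And>t. \<beta> (2 * t) = \<beta> t \<otimes> \<beta> t"
  shows "\<alpha> t = \<beta> t"
proof (cases "t = 0")
  case True
  then show ?thesis using \<alpha> \<beta> by (simp add: curve_at_one_def)
next
  case t0: False
  obtain R where R: "0 < R" and in\<Omega>: "\<And>x. x \<in> V \<inter> ball 0 R \<Longrightarrow> x0 + x \<in> cmap c0 ` cdom c0"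
    and dm: "doubling_map V (\<lambda>x. cmap c0 (cinv c0 (x0 + x) \<otimes> cinv c0 (x0 + x)) - x0) R"
  proof (rule centred_square)
    fix R assume "0 < R" "\<And>x. x \<in> V \<inter> ball 0 R \<Longrightarrow> x0 + x \<in> cmap c0 ` cdom c0"
      "doubling_map V (\<lambda>x. cmap c0 (cinv c0 (x0 + x) \<otimes> cinv c0 (x0 + x)) - x0) R"
    then show thesis by (rule that)
  qed
  let ?s = "\<lambda>x. cmap c0 (cinv c0 (x0 + x) \<otimes> cinv c0 (x0 + x)) - x0"
  obtain r where r: "0 < r" "r \<le> R" and
    uniq: "\<And>a b c. \<lbrakk>\<And>n. a n \<in> V \<inter> ball 0 r; \<And>n. b n \<in> V \<inter> ball 0 r;
       \<And>n. a n = ?s (a (Suc n)); \<And>n. b n = ?s (b (Suc n));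
       \<And>n. norm (a n) \<le> c / 2 ^ n; \<And>n. norm (b n) \<le> c / 2 ^ n;
       (\<lambda>n. 2 ^ n *\<^sub>R (a n - b n)) \<longlonglongrightarrow> 0\<rbrakk> \<Longrightarrow> a 0 = b 0"
    by (rule doubling_map.halving_orbit_unique[OF dm]) blast
  \<comment> \<open>Differentiability at 0 bounds the coordinates linearly in the parameter; the 1
    is an arbitrary margin over the speed \<open>norm w\<close>.\<close>
  have growth: "\<exists>d>0. \<forall>u. \<bar>u\<bar> < d \<longrightarrow> \<gamma> u \<in> cdom c0 \<and> norm (cmap c0 (\<gamma> u) - x0) \<le> (norm w + 1) * \<bar>u\<bar>"
    if \<gamma>: "curve_at_one \<gamma> w" for \<gamma>
  proof -
    note \<gamma>' = \<gamma>[unfolded curve_at_one_def]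
    obtain e where e: "e > 0" "\<And>u. \<bar>u\<bar> < e \<Longrightarrow> \<gamma> u \<in> cdom c0" using \<gamma>' by blast
    have "((\<lambda>t. cmap c0 (\<gamma> t)) has_derivative (\<lambda>t. t *\<^sub>R w)) (at 0)"
      using \<gamma>' by (simp add: has_vector_derivative_def)
    then obtain d where d: "d > 0"
      "\<And>u. norm (u - 0) < d \<Longrightarrow> norm (cmap c0 (\<gamma> u) - cmap c0 (\<gamma> 0) - (u - 0) *\<^sub>R w) \<le> 1 * norm (u - 0)"
      unfolding has_derivative_at_alt using zero_less_one by metis
    have "norm (cmap c0 (\<gamma> u) - x0) \<le> (norm w + 1) * \<bar>u\<bar>" if "\<bar>u\<bar> < d" for u
    proof -
      have g0: "\<gamma> 0 = \<one>" using \<gamma>' by blast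
      have "norm (cmap c0 (\<gamma> u) - x0 - u *\<^sub>R w) \<le> \<bar>u\<bar>" using d(2)[of u] that g0 by simp
      moreover have "norm (cmap c0 (\<gamma> u) - x0) \<le> norm (cmap c0 (\<gamma> u) - x0 - u *\<^sub>R w) + norm (u *\<^sub>R w)"
        using norm_triangle_ineq[of "cmap c0 (\<gamma> u) - x0 - u *\<^sub>R w" "u *\<^sub>R w"] by simp
      ultimately show ?thesis by (simp add: algebra_simps)
    qed
    then show ?thesis using e d(1) by (intro exI[of _ "min e d"]) auto
  qed
  obtain da where da: "da > 0" "\<And>u. \<bar>u\<bar> < da \<Longrightarrow> \<alpha> u \<in> cdom c0 \<and> norm (cmap c0 (\<alpha> u) - x0) \<le> (norm w + 1) * \<bar>u\<bar>"
    using growth[OF \<alpha>] by blast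
  obtain db where db: "db > 0" "\<And>u. \<bar>u\<bar> < db \<Longrightarrow> \<beta> u \<in> cdom c0 \<and> norm (cmap c0 (\<beta> u) - x0) \<le> (norm w + 1) * \<bar>u\<bar>"
    using growth[OF \<beta>] by blast
  \<comment> \<open>The last entry places the coordinates of both curves inside the ball of radius
    \<open>r\<close>, where halving orbits are unique.\<close>
  define d where "d = min (min da db) (r / (norm w + 1))"
  have nw: "norm w + 1 > 0" using norm_ge_zero[of w] by linarith
  have d: "d > 0" unfolding d_def using da db r nw by simp
  have "(\<lambda>m. \<bar>t\<bar> * (1/2) ^ m) \<longlonglongrightarrow> 0"
    using tendsto_mult[OF tendsto_const[of "\<bar>t\<bar>"] LIMSEQ_power_zero[of "1/2::real"]] by simp
  then obtain m where "\<bar>t\<bar> * (1/2) ^ m < d"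
    using order_tendstoD(2)[OF _ d] eventually_happens' sequentially_bot by blast
  \<comment> \<open>Equality is proved at a small parameter \<open>u\<close>, whose successive
    halves form the two orbits, and then transported to \<open>t\<close> by m doublings.\<close>
  define u where "u = t / 2 ^ m"
  have "\<bar>u\<bar> = \<bar>t\<bar> * (1/2) ^ m" unfolding u_def by (simp add: abs_divide power_divide)
  then have u: "\<bar>u\<bar> < d" "u \<noteq> 0" using \<open>\<bar>t\<bar> * (1/2) ^ m < d\<close> t0 by (simp, simp add: u_def)
  have un: "\<bar>u / 2 ^ n\<bar> \<le> \<bar>u\<bar>" "\<bar>u / 2 ^ n\<bar> < d" for n
  proof -
    have "\<bar>u\<bar> / 2 ^ n \<le> \<bar>u\<bar> / 1" by (intro divide_left_mono) auto
    then show "\<bar>u / 2 ^ n\<bar> \<le> \<bar>u\<bar>" "\<bar>u / 2 ^ n\<bar> < d" using u by (simp_all add: abs_divide)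
  qed
  have orbit: "cmap c0 (\<gamma> (u / 2 ^ n)) - x0 \<in> V \<inter> ball 0 r \<and>
      cmap c0 (\<gamma> (u / 2 ^ n)) - x0 = ?s (cmap c0 (\<gamma> (u / 2 ^ Suc n)) - x0) \<and>
      norm (cmap c0 (\<gamma> (u / 2 ^ n)) - x0) \<le> (norm w + 1) * \<bar>u\<bar> / 2 ^ n"
    if \<gamma>_all: "\<forall>u. \<bar>u\<bar> < d \<longrightarrow> \<gamma> u \<in> cdom c0 \<and> norm (cmap c0 (\<gamma> u) - x0) \<le> (norm w + 1) * \<bar>u\<bar>"
      and \<gamma>2_all: "\<forall>t. \<gamma> (2 * t) = \<gamma> t \<otimes> \<gamma> t" for \<gamma> n
  proof (intro conjI)
    note \<gamma> = \<gamma>_all[rule_format] and \<gamma>2 = \<gamma>2_all[rule_format]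
    have b: "norm (cmap c0 (\<gamma> (u / 2 ^ n)) - x0) \<le> (norm w + 1) * \<bar>u / 2 ^ n\<bar>" using \<gamma>[OF un(2)] by blast
    then show "norm (cmap c0 (\<gamma> (u / 2 ^ n)) - x0) \<le> (norm w + 1) * \<bar>u\<bar> / 2 ^ n" by (simp add: abs_divide)
    have "(norm w + 1) * \<bar>u / 2 ^ n\<bar> < (norm w + 1) * (r / (norm w + 1))"
      using un(2)[of n] nw unfolding d_def by (intro mult_strict_left_mono) auto
    then have "norm (cmap c0 (\<gamma> (u / 2 ^ n)) - x0) < r" using b nw by simp
    moreover have "cmap c0 (\<gamma> (u / 2 ^ n)) - x0 \<in> V"
      using subspace_diff[OF V chart_in_cspace[OF is_chart_c0] x0] \<gamma>[OF un(2)] by blast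
    ultimately show "cmap c0 (\<gamma> (u / 2 ^ n)) - x0 \<in> V \<inter> ball 0 r" by simp
    have "\<gamma> (u / 2 ^ Suc n) \<in> cdom c0" using \<gamma>[OF un(2)] by blast
    then have "cinv c0 (cmap c0 (\<gamma> (u / 2 ^ Suc n))) = \<gamma> (u / 2 ^ Suc n)" using cinv_cmap[OF is_chart_c0] by blast
    then show "cmap c0 (\<gamma> (u / 2 ^ n)) - x0 = ?s (cmap c0 (\<gamma> (u / 2 ^ Suc n)) - x0)"
      using \<gamma>2[of "u / 2 ^ Suc n"] by simp
  qed
  have \<alpha>d: "\<alpha> u \<in> cdom c0 \<and> norm (cmap c0 (\<alpha> u) - x0) \<le> (norm w + 1) * \<bar>u\<bar>" if "\<bar>u\<bar> < d" for u
    using da(2) that unfolding d_def by simp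
  have \<beta>d: "\<beta> u \<in> cdom c0 \<and> norm (cmap c0 (\<beta> u) - x0) \<le> (norm w + 1) * \<bar>u\<bar>" if "\<bar>u\<bar> < d" for u
    using db(2) that unfolding d_def by simp
  \<comment> \<open>Equal velocities make the difference of the coordinate curves of smaller order
    than the parameter. Along \<open>u / 2 ^ n\<close>, and multiplied by
    \<open>\<bar>u\<bar>\<close>, this is the rescaled limit condition of the uniqueness statement
    for orbits.\<close>
  have lim: "(\<lambda>n. 2 ^ n *\<^sub>R ((cmap c0 (\<alpha> (u / 2 ^ n)) - x0) - (cmap c0 (\<beta> (u / 2 ^ n)) - x0))) \<longlonglongrightarrow> 0"
  proof -
    let ?f = "\<lambda>t. cmap c0 (\<alpha> t) - cmap c0 (\<beta> t)"
    have "(?f has_vector_derivative w - w) (at 0)"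
      using \<alpha> \<beta> unfolding curve_at_one_def by (intro has_vector_derivative_diff) blast+
    then have "(?f has_derivative (\<lambda>t. 0)) (at 0)" by (simp add: has_vector_derivative_def)
    then have L: "((\<lambda>y. norm (?f y - ?f 0 - 0) / norm (y - 0)) \<longlongrightarrow> 0) (at 0)"
      unfolding has_derivative_iff_norm by blast
    have "(\<lambda>n. u * (1/2) ^ n) \<longlonglongrightarrow> 0"
      using tendsto_mult[OF tendsto_const[of u] LIMSEQ_power_zero[of "1/2::real"]] by simp
    then have "(\<lambda>n. u / 2 ^ n) \<longlonglongrightarrow> 0" by (simp add: power_divide)
    then have "filterlim (\<lambda>n. u / 2 ^ n) (at 0) sequentially"
      unfolding filterlim_at using u(2) by simp
    from filterlim_compose[OF L this]
    have "(\<lambda>n. norm (?f (u / 2 ^ n) - ?f 0 - 0) / norm (u / 2 ^ n - 0)) \<longlonglongrightarrow> 0" .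
    moreover have "?f 0 = 0" using \<alpha> \<beta> by (simp add: curve_at_one_def)
    ultimately have "(\<lambda>n. norm (?f (u / 2 ^ n)) / norm (u / 2 ^ n)) \<longlonglongrightarrow> 0" by simp
    from tendsto_mult[OF tendsto_const[of "\<bar>u\<bar>"] this]
    have "(\<lambda>n. \<bar>u\<bar> * (norm (?f (u / 2 ^ n)) / norm (u / 2 ^ n))) \<longlonglongrightarrow> 0" by simp
    moreover have "\<bar>u\<bar> * (norm (?f (u / 2 ^ n)) / norm (u / 2 ^ n)) = norm (2 ^ n *\<^sub>R ?f (u / 2 ^ n))" for n
      using u(2) by (simp add: abs_divide)
    ultimately have "(\<lambda>n. norm (2 ^ n *\<^sub>R ?f (u / 2 ^ n))) \<longlonglongrightarrow> 0" by simp
    then show ?thesis by (simp only: tendsto_norm_zero_iff diff_diff_eq2 diff_add_cancel)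
  qed
  have "cmap c0 (\<alpha> (u / 2 ^ 0)) - x0 = cmap c0 (\<beta> (u / 2 ^ 0)) - x0"
  proof (rule uniq[of "\<lambda>n. cmap c0 (\<alpha> (u / 2 ^ n)) - x0" "\<lambda>n. cmap c0 (\<beta> (u / 2 ^ n)) - x0" "(norm w + 1) * \<bar>u\<bar>"])
    show "cmap c0 (\<alpha> (u / 2 ^ n)) - x0 \<in> V \<inter> ball 0 r"
      "cmap c0 (\<alpha> (u / 2 ^ n)) - x0 = ?s (cmap c0 (\<alpha> (u / 2 ^ Suc n)) - x0)"
      "norm (cmap c0 (\<alpha> (u / 2 ^ n)) - x0) \<le> (norm w + 1) * \<bar>u\<bar> / 2 ^ n" for n
      using orbit[of "\<alpha>" n] \<alpha>d \<alpha>2 by blast+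
    show "cmap c0 (\<beta> (u / 2 ^ n)) - x0 \<in> V \<inter> ball 0 r"
      "cmap c0 (\<beta> (u / 2 ^ n)) - x0 = ?s (cmap c0 (\<beta> (u / 2 ^ Suc n)) - x0)"
      "norm (cmap c0 (\<beta> (u / 2 ^ n)) - x0) \<le> (norm w + 1) * \<bar>u\<bar> / 2 ^ n" for n
      using orbit[of "\<beta>" n] \<beta>d \<beta>2 by blast+
  qed (rule lim)
  then have "cmap c0 (\<alpha> u) = cmap c0 (\<beta> u)" by simp
  moreover have "\<alpha> u \<in> cdom c0" "\<beta> u \<in> cdom c0" using \<alpha>d[OF u(1)] \<beta>d[OF u(1)] by blast+
  ultimately have eq: "\<alpha> u = \<beta> u" using chart_inj[OF is_chart_c0] by (auto dest: inj_onD)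
  have "\<alpha> (2 ^ n * u) = \<beta> (2 ^ n * u)" for n
  proof (induction n)
    case (Suc n)
    then show ?case using \<alpha>2[of "2 ^ n * u"] \<beta>2[of "2 ^ n * u"] by (simp add: mult.assoc)
  qed (simp add: eq)
  from this[of m] show ?thesis by (simp add: u_def)
qed

text \<open>The local map extends by taking the \<open>2 ^ n\<close>-th power of its value at
  \<open>a / 2 ^ n\<close> for large n. Its doubling equation makes the result independent of n, so
  near each point one fixed n exhibits the extension as a composition of smooth maps.\<close>

lemma doubling_exponential:
  obtains Ex where "smooth_map (linear_manifold V) M Ex"
    "\<And>a. a \<in> V \<Longrightarrow> Ex (2 *\<^sub>R a) = Ex a \<otimes> Ex a"
    "\<And>a. a \<in> V \<Longrightarrow> curve_at_one (\<lambda>t. Ex (t *\<^sub>R a)) a"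
proof (rule local_exponential)
  fix r e K
  assume r: "0 < r" and sm: "smooth_map_on (linear_manifold V) M (V \<inter> ball 0 r) e"
    and e2: "\<And>x. x \<in> V \<inter> ball 0 r \<Longrightarrow> e x = e ((1/2) *\<^sub>R x) \<otimes> e ((1/2) *\<^sub>R x)"
    and ec: "\<And>x. x \<in> V \<inter> ball 0 r \<Longrightarrow> e x \<in> cdom c0"
    and K: "\<And>x. x \<in> V \<inter> ball 0 r \<Longrightarrow> norm (cmap c0 (e x) - x0 - x) \<le> K * (norm x)\<^sup>2"
  have carr: "e x \<in> carrier G" if "x \<in> V \<inter> ball 0 r" for x using smooth_map_on_in[OF sm that] carrier_eq by simp
  define Ex where "Ex a = (let n = LEAST n. norm a < 2 ^ n * r in e ((1 / 2 ^ n) *\<^sub>R a) [^] ((2::nat) ^ n))" for a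
  have scaled: "(1 / 2 ^ n) *\<^sub>R a \<in> V \<inter> ball 0 r" if "a \<in> V" "norm a < 2 ^ n * r" for a n
    using subspace_scale[OF V that(1), of "1 / 2 ^ n"] that(2) by (simp add: field_simps)
  have bound: "\<exists>n. norm a < 2 ^ n * r" for a :: 'e
  proof -
    obtain n where "norm a / r < 2 ^ n" using real_arch_pow[of 2 "norm a / r"] by auto
    then show ?thesis using r by (auto simp: field_simps)
  qed
  \<comment> \<open>The least exponent only serves to define a function; that every larger one gives
    the same value allows one n for a whole ball.\<close>
  have Ex: "Ex a = e ((1 / 2 ^ n) *\<^sub>R a) [^] ((2::nat) ^ n)" if a: "a \<in> V" and n: "norm a < 2 ^ n * r" for a n
  proof -
    define N where "N = (LEAST n. norm a < 2 ^ n * r)"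
    have N: "norm a < 2 ^ N * r" unfolding N_def using LeastI_ex[OF bound] .
    have "N \<le> n" unfolding N_def using Least_le[of "\<lambda>n. norm a < 2 ^ n * r", OF n] .
    then have "e ((1 / 2 ^ n) *\<^sub>R a) [^] ((2::nat) ^ n) = e ((1 / 2 ^ N) *\<^sub>R a) [^] ((2::nat) ^ N)"
    proof (induction n rule: dec_induct)
      case (step k)
      have "norm a < 2 ^ k * r"
      proof -
        have "(2::real) ^ N * r \<le> 2 ^ k * r" using step(1) r by (intro mult_right_mono power_increasing) auto
        then show ?thesis using N by linarith
      qed
      note x = scaled[OF a this]
      let ?y = "e ((1 / 2 ^ Suc k) *\<^sub>R a)"
      have half: "(1/2) *\<^sub>R (1 / 2 ^ k) *\<^sub>R a = (1 / 2 ^ Suc k) *\<^sub>R a" by simp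
      have y: "?y \<in> carrier G" using carr[OF half_in_ball(1)[OF V x]] unfolding half .
      have "e ((1 / 2 ^ k) *\<^sub>R a) = ?y [^] (2::nat)" using e2[OF x] y unfolding half by (simp add: numeral_2_eq_2)
      then have "e ((1 / 2 ^ k) *\<^sub>R a) [^] ((2::nat) ^ k) = ?y [^] ((2::nat) ^ Suc k)"
        using nat_pow_pow[OF y, of 2 "2 ^ k"] by simp
      then show ?case using step.IH by simp
    qed simp
    then show ?thesis unfolding Ex_def Let_def N_def by simp
  qed
  show thesis
  proof (rule that[of Ex])
    show "smooth_map (linear_manifold V) M Ex"
    proof (rule smooth_map_on_local)
      fix a assume "a \<in> topspace (mtop (linear_manifold V))"
      then have a: "a \<in> V" by simp
      obtain n where n: "norm a < 2 ^ n * r" using bound by blast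
      let ?A = "V \<inter> ball 0 (2 ^ n * r)"
      have s1: "smooth_map_on (linear_manifold V) (linear_manifold V) ?A (\<lambda>x. (1 / 2 ^ n) *\<^sub>R x)"
        by (rule smooth_map_on_linearI[OF V relopen_ball smooth_on_bounded_linear[OF bounded_linear_scaleR_right]])
           (use subspace_scale[OF V] in blast)
      have s2: "smooth_map_on (linear_manifold V) M ?A (\<lambda>x. e ((1 / 2 ^ n) *\<^sub>R x))"
        by (rule smooth_map_on_compose[OF V_atlas V_atlas s1 sm]) (use scaled in auto)
      have "smooth_map_on (linear_manifold V) M ?A (\<lambda>x. e ((1 / 2 ^ n) *\<^sub>R x) [^] ((2::nat) ^ n))"
        by (rule smooth_map_on_compose[OF V_atlas atlas s2 smooth_pow]) (use smooth_map_on_in[OF s2] in blast)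
      then have "smooth_map_on (linear_manifold V) M ?A Ex"
        by (rule smooth_map_on_cong[OF V_atlas]) (use Ex in auto)
      then show "\<exists>A. a \<in> A \<and> A \<subseteq> topspace (mtop (linear_manifold V)) \<and> smooth_map_on (linear_manifold V) M A Ex"
        using a n by (intro exI[of _ ?A]) auto
    qed (rule openin_topspace)
    show "Ex (2 *\<^sub>R a) = Ex a \<otimes> Ex a" if a: "a \<in> V" for a
    proof -
      obtain n where n: "norm a < 2 ^ n * r" using bound by blast
      then have n2: "norm (2 *\<^sub>R a) < 2 ^ Suc n * r" by simp
      have c: "e ((1 / 2 ^ n) *\<^sub>R a) \<in> carrier G" using carr[OF scaled[OF a n]] .
      have h: "(1 / 2 ^ Suc n) *\<^sub>R 2 *\<^sub>R a = (1 / 2 ^ n) *\<^sub>R a" and p: "(2::nat) ^ Suc n = 2 ^ n + 2 ^ n" by simp_all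
      show ?thesis
        unfolding Ex[OF subspace_scale[OF V a] n2] Ex[OF a n] h p nat_pow_mult[OF c] ..
    qed
    show "curve_at_one (\<lambda>t. Ex (t *\<^sub>R a)) a" if a: "a \<in> V" for a
    proof -
      have na: "norm a + 1 > 0" using norm_ge_zero[of a] by linarith
      define d where "d = r / (norm a + 1)"
      have d: "d > 0" unfolding d_def using r na by simp
      have small: "t *\<^sub>R a \<in> V \<inter> ball 0 r" "Ex (t *\<^sub>R a) = e (t *\<^sub>R a)" if "\<bar>t\<bar> < d" for t
      proof -
        have "norm (t *\<^sub>R a) \<le> \<bar>t\<bar> * (norm a + 1)" by (simp add: algebra_simps)
        also have "\<dots> < r" using that na unfolding d_def by (simp add: field_simps)
        finally show 1: "t *\<^sub>R a \<in> V \<inter> ball 0 r" using subspace_scale[OF V a] by simp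
        then show "Ex (t *\<^sub>R a) = e (t *\<^sub>R a)" using Ex[of "t *\<^sub>R a" 0] carr[OF 1] by simp
      qed
      \<comment> \<open>At 0 the error bound is 0, which forces \<open>e 0\<close> to have the
        coordinates of the identity.\<close>
      have cmap0: "cmap c0 (e 0) = x0" using K[of 0] small(1)[of 0] d by simp
      have "e 0 \<in> cdom c0" using ec small(1)[of 0] d by simp
      then have e0: "e 0 = \<one>" using cmap0 c0(2) chart_inj[OF is_chart_c0] by (auto dest: inj_onD)
      have "((\<lambda>t. cmap c0 (Ex (t *\<^sub>R a))) has_derivative (\<lambda>t. t *\<^sub>R a)) (at 0)"
        unfolding has_derivative_at_alt
      proof (intro conjI allI impI)
        show "bounded_linear (\<lambda>t. t *\<^sub>R a)" by (rule bounded_linear_scaleR_left)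
        fix \<epsilon> :: real assume \<epsilon>: "0 < \<epsilon>"
        \<comment> \<open>The added 1 keeps \<open>B\<close> positive even when \<open>K\<close> or
          \<open>a\<close> vanishes, so that \<open>\<epsilon> / B\<close> is a legitimate
          radius.\<close>
        define B where "B = \<bar>K\<bar> * (norm a)\<^sup>2 + 1"
        have B: "B > 0" unfolding B_def by (simp add: add_nonneg_pos)
        show "\<exists>d>0. \<forall>y. norm (y - 0) < d \<longrightarrow>
          norm (cmap c0 (Ex (y *\<^sub>R a)) - cmap c0 (Ex (0 *\<^sub>R a)) - (y - 0) *\<^sub>R a) \<le> \<epsilon> * norm (y - 0)"
        proof (intro exI[of _ "min d (\<epsilon> / B)"] conjI allI impI)
          show "0 < min d (\<epsilon> / B)" using d \<epsilon> B by simp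
          fix y :: real assume y: "norm (y - 0) < min d (\<epsilon> / B)"
          then have yd: "\<bar>y\<bar> < d" and yB: "B * \<bar>y\<bar> < \<epsilon>" using B by (simp_all add: field_simps)
          have "norm (cmap c0 (Ex (y *\<^sub>R a)) - x0 - y *\<^sub>R a) \<le> K * (norm (y *\<^sub>R a))\<^sup>2"
            using K[OF small(1)[OF yd]] small(2)[OF yd] by simp
          also have "\<dots> \<le> \<bar>K\<bar> * (norm (y *\<^sub>R a))\<^sup>2" by (intro mult_right_mono) auto
          also have "\<dots> = (\<bar>K\<bar> * (norm a)\<^sup>2) * \<bar>y\<bar> * \<bar>y\<bar>" by (simp add: power2_eq_square)
          also have "\<dots> \<le> B * \<bar>y\<bar> * \<bar>y\<bar>" unfolding B_def by (intro mult_right_mono) auto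
          also have "\<dots> \<le> \<epsilon> * \<bar>y\<bar>" using yB by (intro mult_right_mono) auto
          finally show "norm (cmap c0 (Ex (y *\<^sub>R a)) - cmap c0 (Ex (0 *\<^sub>R a)) - (y - 0) *\<^sub>R a) \<le> \<epsilon> * norm (y - 0)"
            using small(2)[of 0] d cmap0 by simp
        qed
      qed
      moreover have "Ex (t *\<^sub>R a) \<in> carrier G" for t
      proof -
        have ta: "t *\<^sub>R a \<in> V" using subspace_scale[OF V a] .
        obtain n where n: "norm (t *\<^sub>R a) < 2 ^ n * r" using bound by blast
        show ?thesis unfolding Ex[OF ta n] using carr[OF scaled[OF ta n]] by simp
      qed
      ultimately show ?thesis
        unfolding curve_at_one_def has_vector_derivative_def
        using small(2)[of 0] d e0 ec small by (auto intro!: exI[of _ d])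
    qed
  qed
qed

end

lemma smooth_map_continuous:
  assumes "smooth_atlas M" "smooth_atlas N" "smooth_map M N f"
  shows "continuous_map (mtop M) (mtop N) f"
  unfolding continuous_map_def
  using smooth_map_on_in[OF assms(3)] smooth_map_on_openin_preimage[OF assms] by auto

section \<open>Additivity of doubling curves and the basic properties of \<open>Exp\<close>\<close>

context lie_group_manifold
begin

text \<open>As curves in \<open>t\<close>, both sides satisfy the doubling equation with initial
  velocity \<open>k\<close> times \<open>a\<close>; on the right because \<open>\<gamma> t\<close>
  commutes with itself. Uniqueness of doubling curves identifies them.\<close>

lemma doubling_curve_pow:
  assumes \<gamma>: "curve_at_one \<gamma> a" and \<gamma>2: "\<And>t. \<gamma> (2 * t) = \<gamma> t \<otimes> \<gamma> t"
  shows "\<gamma> (real k * t) = \<gamma> t [^] k"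
proof (rule doubling_curve_unique[OF curve_at_one_scale[OF \<gamma>] curve_at_one_pow[OF \<gamma>]])
  have carr: "\<gamma> t \<in> carrier G" for t using \<gamma> by (simp add: curve_at_one_def)
  show "\<gamma> (real k * (2 * t)) = \<gamma> (real k * t) \<otimes> \<gamma> (real k * t)" for t
    using \<gamma>2[of "real k * t"] by (simp add: mult.left_commute)
  show "\<gamma> (2 * t) [^] k = \<gamma> t [^] k \<otimes> \<gamma> t [^] k" for t
    unfolding \<gamma>2 by (rule pow_mult_distrib[OF refl carr carr])
qed

text \<open>Again two doubling curves with one velocity, here \<open>- a\<close>.\<close>

lemma doubling_curve_inv:
  assumes \<gamma>: "curve_at_one \<gamma> a" and \<gamma>2: "\<And>t. \<gamma> (2 * t) = \<gamma> t \<otimes> \<gamma> t"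
  shows "\<gamma> (- t) = inv (\<gamma> t)"
proof -
  have carr: "\<gamma> t \<in> carrier G" for t using \<gamma> by (simp add: curve_at_one_def)
  have c1: "curve_at_one (\<lambda>t. \<gamma> (- t)) (- a)" using curve_at_one_scale[OF \<gamma>, of "-1"] by simp
  show ?thesis
  proof (rule doubling_curve_unique[OF c1 curve_at_one_inv[OF \<gamma>]])
    show "\<gamma> (- (2 * t)) = \<gamma> (- t) \<otimes> \<gamma> (- t)" for t using \<gamma>2[of "- t"] by simp
    show "inv (\<gamma> (2 * t)) = inv (\<gamma> t) \<otimes> inv (\<gamma> t)" for t
      unfolding \<gamma>2 by (rule inv_mult_group[OF carr carr])
  qed
qed

lemma doubling_curve_int_pow:
  assumes \<gamma>: "curve_at_one \<gamma> a" and \<gamma>2: "\<And>t. \<gamma> (2 * t) = \<gamma> t \<otimes> \<gamma> t"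
  shows "\<gamma> (of_int i * t) = \<gamma> t [^] i"
proof (cases i rule: int_cases)
  case (nonneg n)
  then show ?thesis using doubling_curve_pow[OF assms, of n t] by (simp add: int_pow_int)
next
  case (neg n)
  have carr: "\<gamma> t \<in> carrier G" using \<gamma> by (simp add: curve_at_one_def)
  have "\<gamma> (of_int i * t) = \<gamma> (- (real (Suc n) * t))" by (rule arg_cong[of _ _ \<gamma>]) (simp add: neg algebra_simps)
  also have "\<dots> = inv (\<gamma> t [^] Suc n)" unfolding doubling_curve_inv[OF assms] doubling_curve_pow[OF assms] ..
  also have "\<dots> = \<gamma> t [^] i" unfolding neg int_pow_neg[OF carr] int_pow_int ..
  finally show ?thesis .
qed

text \<open>The denominator \<open>Suc n\<close> is prescribed, so that two real numbers can be
  approximated at the same time by integer multiples of one unit.\<close>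

lemma floor_multiple_tendsto: "(\<lambda>n. of_int \<lfloor>real (Suc n) * s\<rfloor> / real (Suc n)) \<longlonglongrightarrow> s" for s :: real
proof -
  have "norm (of_int \<lfloor>real (Suc n) * s\<rfloor> / real (Suc n) - s) \<le> inverse (real (Suc n))" for n
  proof -
    have "of_int \<lfloor>real (Suc n) * s\<rfloor> / real (Suc n) - s = (of_int \<lfloor>real (Suc n) * s\<rfloor> - real (Suc n) * s) / real (Suc n)"
      by (simp add: diff_divide_distrib del: of_nat_Suc)
    moreover have "\<bar>of_int \<lfloor>real (Suc n) * s\<rfloor> - real (Suc n) * s\<bar> \<le> 1" by linarith
    then have "\<bar>of_int \<lfloor>real (Suc n) * s\<rfloor> - real (Suc n) * s\<bar> / real (Suc n) \<le> 1 / real (Suc n)"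
      by (intro divide_right_mono) auto
    ultimately show ?thesis by (simp add: abs_divide inverse_eq_divide del: of_nat_Suc)
  qed
  then have "(\<lambda>n. of_int \<lfloor>real (Suc n) * s\<rfloor> / real (Suc n) - s) \<longlonglongrightarrow> 0"
    by (intro Lim_null_comparison[OF always_eventually LIMSEQ_inverse_real_of_nat]) blast
  then show ?thesis by (rule LIM_zero_cancel)
qed

text \<open>Powers give additivity on rationally dependent arguments, and continuity does the rest.\<close>

lemma doubling_curve_add:
  assumes \<gamma>: "curve_at_one \<gamma> a" and \<gamma>2: "\<And>t. \<gamma> (2 * t) = \<gamma> t \<otimes> \<gamma> t" and sm: "smooth_map real_line M \<gamma>"
  shows "\<gamma> (s + t) = \<gamma> s \<otimes> \<gamma> t"
proof -
  let ?N = "linear_manifold (UNIV :: (real \<times> real) set)"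
  have N: "smooth_atlas ?N" using smooth_atlas_linear[OF subspace_UNIV] .
  have carr: "\<gamma> t \<in> carrier G" for t using \<gamma> by (simp add: curve_at_one_def)
  have lin: "smooth_map ?N M (\<lambda>p. \<gamma> (L p))" if L: "bounded_linear L" for L
  proof (rule smooth_map_on_compose[OF N real_atlas _ sm])
    show "smooth_map ?N real_line L"
      by (rule smooth_map_on_linearI[OF subspace_UNIV _ smooth_on_bounded_linear[OF L]]) auto
  qed simp
  have c1: "continuous_map (mtop ?N) (mtop M) (\<lambda>p. \<gamma> (fst p + snd p))"
    by (rule smooth_map_continuous[OF N atlas lin[OF bounded_linear_add[OF bounded_linear_fst bounded_linear_snd]]])
  have c2: "continuous_map (mtop ?N) (mtop M) (\<lambda>p. \<gamma> (fst p) \<otimes> \<gamma> (snd p))"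
    by (rule smooth_map_continuous[OF N atlas smooth_mult[OF N lin[OF bounded_linear_fst] lin[OF bounded_linear_snd]]])
  \<comment> \<open>Equality of two continuous maps into a Hausdorff space is a closed condition, so
    it passes from pairs with a common unit to all pairs.\<close>
  let ?S = "{p. \<gamma> (fst p + snd p) = \<gamma> (fst p) \<otimes> \<gamma> (snd p)}"
  have cl: "closed ?S" using closedin_continuous_maps_eq[OF Hausdorff c1 c2] by simp
  let ?f = "\<lambda>n. (of_int \<lfloor>real (Suc n) * s\<rfloor> / real (Suc n), of_int \<lfloor>real (Suc n) * t\<rfloor> / real (Suc n))"
  have "?f n \<in> ?S" for n
  proof -
    let ?u = "1 / real (Suc n)" and ?i = "\<lfloor>real (Suc n) * s\<rfloor>" and ?j = "\<lfloor>real (Suc n) * t\<rfloor>"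
    have "\<gamma> (of_int ?i * ?u + of_int ?j * ?u) = \<gamma> (of_int (?i + ?j) * ?u)"
      by (simp only: of_int_add distrib_right)
    also have "\<dots> = \<gamma> ?u [^] (?i + ?j)" by (rule doubling_curve_int_pow[OF \<gamma> \<gamma>2])
    also have "\<dots> = \<gamma> ?u [^] ?i \<otimes> \<gamma> ?u [^] ?j" by (rule int_pow_mult[OF carr])
    also have "\<dots> = \<gamma> (of_int ?i * ?u) \<otimes> \<gamma> (of_int ?j * ?u)"
      unfolding doubling_curve_int_pow[OF \<gamma> \<gamma>2] ..
    finally show ?thesis by simp
  qed
  moreover have "?f \<longlonglongrightarrow> (s, t)" by (intro tendsto_Pair floor_multiple_tendsto)
  ultimately have "(s, t) \<in> ?S" by (rule closed_sequentially[OF cl])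
  then show ?thesis by simp
qed

lemma smooth_curve_at_one:
  assumes sm: "smooth_map real_line M \<gamma>" and \<gamma>0: "\<gamma> 0 = \<one>"
  obtains w where "curve_at_one \<gamma> w" "velocity M \<gamma> 0 = coord_tvec M c0 \<one> w"
proof -
  have sm': "smooth_map_on real_line M UNIV \<gamma>" using sm by simp
  have g0: "\<gamma> 0 \<in> cdom c0" using \<gamma>0 c0 by simp
  obtain w where w: "((\<lambda>t. cmap c0 (\<gamma> t)) has_vector_derivative w) (at 0)"
    "velocity M \<gamma> 0 = coord_tvec M c0 (\<gamma> 0) w"
    using smooth_curve_velocity[OF atlas sm' open_UNIV UNIV_I c0(1) g0] by metis
  have "openin (mtop real_line) {t \<in> UNIV. \<gamma> t \<in> cdom c0}"
    by (rule smooth_map_on_openin_preimage[OF real_atlas atlas sm' chart_openin_cdom[OF is_chart_c0]])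
  then have "open {t. \<gamma> t \<in> cdom c0}" by simp
  then obtain e where e: "e > 0" "ball 0 e \<subseteq> {t. \<gamma> t \<in> cdom c0}" using g0 open_contains_ball by blast
  have "\<gamma> t \<in> cdom c0" if "\<bar>t\<bar> < e" for t using e(2) that by (auto simp: subset_iff)
  moreover have "\<gamma> t \<in> carrier G" for t using smooth_map_on_in[OF sm' UNIV_I] carrier_eq by simp
  ultimately have "curve_at_one \<gamma> w" unfolding curve_at_one_def using w(1) \<gamma>0 e(1) by blast
  then show thesis using that w(2) \<gamma>0 by simp
qed

text \<open>The exponential map in the coordinates of \<open>c0\<close>: a map on the subspace
  \<open>V\<close>, to which the derivative calculus applies.\<close>

definition Exp :: "'e \<Rightarrow> 'g" where "Exp a = lie_exp G M (coord_tvec M c0 \<one> a)"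

text \<open>The definite description in \<open>lie_exp\<close> is resolved here. Rays of the
  doubling exponential are one-parameter subgroups with the required velocity, and any other such
  subgroup is a doubling curve with that velocity, so it ends at the same point.\<close>

lemma Exp_properties:
  shows smooth_Exp: "smooth_map (linear_manifold V) M Exp"
    and Exp_curve: "a \<in> V \<Longrightarrow> curve_at_one (\<lambda>t. Exp (t *\<^sub>R a)) a"
    and Exp_add: "a \<in> V \<Longrightarrow> Exp ((s + t) *\<^sub>R a) = Exp (s *\<^sub>R a) \<otimes> Exp (t *\<^sub>R a)"
proof -
  obtain Ex where sm: "smooth_map (linear_manifold V) M Ex"
    and Ex2: "\<And>a. a \<in> V \<Longrightarrow> Ex (2 *\<^sub>R a) = Ex a \<otimes> Ex a"
    and Exc: "\<And>a. a \<in> V \<Longrightarrow> curve_at_one (\<lambda>t. Ex (t *\<^sub>R a)) a"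
    by (rule doubling_exponential) blast
  have ray: "smooth_map real_line M (\<lambda>t. Ex (t *\<^sub>R a))" if a: "a \<in> V" for a
  proof (rule smooth_map_on_compose[OF real_atlas V_atlas _ sm])
    show "smooth_map real_line (linear_manifold V) (\<lambda>t. t *\<^sub>R a)"
      by (rule smooth_map_on_linearI[OF subspace_UNIV _ smooth_on_bounded_linear[OF bounded_linear_scaleR_left]])
         (use subspace_scale[OF V a] in auto)
    show "t *\<^sub>R a \<in> topspace (mtop (linear_manifold V))" for t using subspace_scale[OF V a] by simp
  qed
  have ray2: "Ex ((2 * t) *\<^sub>R a) = Ex (t *\<^sub>R a) \<otimes> Ex (t *\<^sub>R a)" if a: "a \<in> V" for a t
    using Ex2[OF subspace_scale[OF V a, of t]] by simp
  have add: "Ex ((s + t) *\<^sub>R a) = Ex (s *\<^sub>R a) \<otimes> Ex (t *\<^sub>R a)" if a: "a \<in> V" for a s t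
    using doubling_curve_add[OF Exc[OF a] ray2[OF a] ray[OF a]] .
  have Exp_Ex: "Exp a = Ex a" if a: "a \<in> V" for a
    unfolding Exp_def lie_exp_def
  proof (rule the_equality)
    have ray0: "Ex (0 *\<^sub>R a) = \<one>" using Exc[OF a] unfolding curve_at_one_def by blast
    obtain w where w: "curve_at_one (\<lambda>t. Ex (t *\<^sub>R a)) w" "velocity M (\<lambda>t. Ex (t *\<^sub>R a)) 0 = coord_tvec M c0 \<one> w"
      by (rule smooth_curve_at_one[OF ray[OF a] ray0])
    have "w = a" using curve_at_one_unique[OF w(1) Exc[OF a]] .
    then show "\<exists>\<gamma>. one_parameter_subgroup G M \<gamma> \<and> velocity M \<gamma> 0 = coord_tvec M c0 \<one> a \<and> Ex a = \<gamma> 1"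
      unfolding one_parameter_subgroup_def using ray[OF a] add[OF a] w(2)
      by (intro exI[of _ "\<lambda>t. Ex (t *\<^sub>R a)"]) simp
  next
    fix g assume "\<exists>\<gamma>. one_parameter_subgroup G M \<gamma> \<and> velocity M \<gamma> 0 = coord_tvec M c0 \<one> a \<and> g = \<gamma> 1"
    then obtain \<gamma> where \<gamma>: "smooth_map real_line M \<gamma>" "\<And>s t. \<gamma> (s + t) = \<gamma> s \<otimes> \<gamma> t"
      "velocity M \<gamma> 0 = coord_tvec M c0 \<one> a" "g = \<gamma> 1"
      unfolding one_parameter_subgroup_def by blast
    have "\<gamma> 0 \<in> carrier G" using smooth_map_on_in[OF \<gamma>(1)] carrier_eq by simp
    moreover have "\<gamma> 0 \<otimes> \<gamma> 0 = \<gamma> 0" using \<gamma>(2)[of 0 0] by simp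
    ultimately have g0: "\<gamma> 0 = \<one>" using l_cancel_one by blast
    obtain w where w: "curve_at_one \<gamma> w" "velocity M \<gamma> 0 = coord_tvec M c0 \<one> w"
      by (rule smooth_curve_at_one[OF \<gamma>(1) g0])
    have "w = coord_tvec M c0 \<one> w c0" using coord_tvec_self[OF atlas c0 curve_at_one_velocity[OF w(1)]] by simp
    also have "\<dots> = coord_tvec M c0 \<one> a c0" using w(2) \<gamma>(3) by simp
    also have "\<dots> = a" by (rule coord_tvec_self[OF atlas c0 a])
    finally have "curve_at_one \<gamma> a" using w(1) by simp
    moreover have "\<gamma> (2 * t) = \<gamma> t \<otimes> \<gamma> t" for t using \<gamma>(2)[of t t] unfolding mult_2 .
    ultimately have "\<gamma> 1 = Ex (1 *\<^sub>R a)" by (rule doubling_curve_unique[OF _ Exc[OF a] _ ray2[OF a]])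
    then show "g = Ex a" using \<gamma>(4) by simp
  qed
  show "smooth_map (linear_manifold V) M Exp"
    by (rule smooth_map_on_cong[OF V_atlas sm]) (simp add: Exp_Ex)
  have scaled: "Exp (t *\<^sub>R a) = Ex (t *\<^sub>R a)" if "a \<in> V" for a t using Exp_Ex[OF subspace_scale[OF V that]] .
  show "curve_at_one (\<lambda>t. Exp (t *\<^sub>R a)) a" if "a \<in> V" using Exc[OF that] unfolding scaled[OF that] .
  show "Exp ((s + t) *\<^sub>R a) = Exp (s *\<^sub>R a) \<otimes> Exp (t *\<^sub>R a)" if "a \<in> V"
    using add[OF that] unfolding scaled[OF that] .
qed

end

section \<open>Transversality\<close>

locale symmetric_triple = lie_group_manifold G M
  for G :: "('g, 'b) monoid_scheme" (structure) and M :: "('g, 'e::euclidean_space) manifold" +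
  fixes \<sigma> :: "'g \<Rightarrow> 'g" and K :: "'g set"
  assumes \<sigma>_hom: "\<sigma> \<in> hom G G" and \<sigma>_smooth: "smooth_map M M \<sigma>"
    and K_eq: "K = {g \<in> carrier G. \<sigma> g = g}"
begin

lemma \<sigma>_one: "\<sigma> \<one> = \<one>"
  using hom_one[OF \<sigma>_hom is_group is_group] .

lemma subgroup_K: "subgroup K G"
proof
  interpret \<sigma>: group_hom G G \<sigma> using \<sigma>_hom by unfold_locales
  show "K \<subseteq> carrier G" "\<one> \<in> K" using K_eq \<sigma>_one by auto
  show "x \<otimes> y \<in> K" if "x \<in> K" "y \<in> K" for x y using that K_eq by simp
  show "inv x \<in> K" if "x \<in> K" for x using that K_eq by simp
qed

lemma lcoset_eqD:
  assumes x: "x \<in> carrier G" and y: "y \<in> carrier G" and eq: "x <# K = y <# K"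
  shows "inv y \<otimes> x \<in> K"
  using subgroup.lcos_module_imp[OF subgroup_K is_group y] lcos_self[OF x subgroup_K] eq by simp

definition S :: "'e \<Rightarrow> 'e" where "S = chart_derivative c0 c0 \<sigma> \<one>"

lemma has_derivative_S: "(cmap c0 \<circ> \<sigma> \<circ> cinv c0 has_derivative S) (at x0 within V)"
  and S_in: "v \<in> V \<Longrightarrow> S v \<in> V"
  unfolding S_def using smooth_map_on_chart_derivative[OF atlas atlas \<sigma>_smooth _ c0 c0(1)] c0 \<sigma>_one carrier_eq
  by simp_all

lemma linear_S: "linear S" using has_derivative_S has_derivative_linear by blast

lemma curve_at_one_\<sigma>: "curve_at_one \<alpha> w \<Longrightarrow> curve_at_one (\<lambda>t. \<sigma> (\<alpha> t)) (S w)"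
  unfolding S_def using curve_at_one_map[OF \<sigma>_smooth \<sigma>_one] .

text \<open>The space p in the coordinates of \<open>c0\<close>: a subspace of the model space,
  where dimensions and critical values make sense.\<close>

definition p0 :: "'e set" where "p0 = {a \<in> V. S a = - a}"

lemma subspace_p0: "subspace p0"
  unfolding subspace_def p0_def
  using V linear_S by (auto simp: linear_0 linear_add linear_scale subspace_0 subspace_add subspace_scale)

lemma p0_V: "p0 \<subseteq> V" by (auto simp: p0_def)

lemma minus_eigenspace_eq: "minus_eigenspace G M \<sigma> = coord_tvec M c0 \<one> ` p0"
proof -
  have one: "\<one> \<in> topspace (mtop M)" using carrier_eq by simp
  have \<sigma>c: "\<sigma> \<one> \<in> cdom c0" using \<sigma>_one c0 by simp
  have dif: "differential M M \<sigma> \<one> X = coord_tvec M c0 \<one> (S (X c0))" if "X \<in> tangent_space M \<one>" for X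
    using differential_eq[OF atlas atlas \<sigma>_smooth one c0 c0(1) \<sigma>c that] \<sigma>_one by (simp add: S_def)
  show ?thesis
  proof (intro equalityI subsetI)
    fix X assume "X \<in> minus_eigenspace G M \<sigma>"
    then have X: "X \<in> tangent_space M \<one>" "differential M M \<sigma> \<one> X = - X" by (auto simp: minus_eigenspace_def)
    note a = tangent_spaceD[OF X(1) c0]
    have "S (X c0) = coord_tvec M c0 \<one> (S (X c0)) c0" using coord_tvec_self[OF atlas c0 S_in[OF a(1)]] by simp
    also have "\<dots> = (- X) c0" using dif[OF X(1)] X(2) by simp
    finally have "X c0 \<in> p0" using a(1) by (simp add: p0_def)
    then show "X \<in> coord_tvec M c0 \<one> ` p0" using a(2) by (metis imageI)
  next
    fix X assume "X \<in> coord_tvec M c0 \<one> ` p0"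
    then obtain a where a: "a \<in> V" "S a = - a" "X = coord_tvec M c0 \<one> a" by (auto simp: p0_def)
    have Xt: "X \<in> tangent_space M \<one>" using coord_tvec_in_tangent_space[OF atlas c0 a(1)] a(3) by simp
    have "X c0 = a" using coord_tvec_self[OF atlas c0 a(1)] a(3) by simp
    then have "differential M M \<sigma> \<one> X = - X" using dif[OF Xt] a coord_tvec_minus[OF atlas c0] by simp
    then show "X \<in> minus_eigenspace G M \<sigma>" using Xt by (simp add: minus_eigenspace_def)
  qed
qed

lemma lie_exp_minus_eigenspace: "lie_exp G M ` minus_eigenspace G M \<sigma> = Exp ` p0"
  unfolding minus_eigenspace_eq by (simp add: image_image Exp_def)

text \<open>\<open>\<sigma>\<close> maps the ray to a doubling curve with velocity
  \<open>S b = b\<close>, so by uniqueness the ray is fixed pointwise.\<close>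

lemma Exp_fixed:
  assumes b: "b \<in> V" "S b = b"
  shows "Exp (t *\<^sub>R b) \<in> K"
proof -
  note c = Exp_curve[OF b(1)]
  have carr: "Exp (t *\<^sub>R b) \<in> carrier G" for t using c by (simp add: curve_at_one_def)
  have two: "Exp ((2 * t) *\<^sub>R b) = Exp (t *\<^sub>R b) \<otimes> Exp (t *\<^sub>R b)" for t
    unfolding mult_2 by (rule Exp_add[OF b(1)])
  have "curve_at_one (\<lambda>t. \<sigma> (Exp (t *\<^sub>R b))) b" using curve_at_one_\<sigma>[OF c] b(2) by simp
  then have "\<sigma> (Exp (t *\<^sub>R b)) = Exp (t *\<^sub>R b)"
  proof (rule doubling_curve_unique[OF _ c])
    show "\<sigma> (Exp ((2 * t) *\<^sub>R b)) = \<sigma> (Exp (t *\<^sub>R b)) \<otimes> \<sigma> (Exp (t *\<^sub>R b))" for t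
      unfolding two by (rule hom_mult[OF \<sigma>_hom carr carr])
    show "Exp ((2 * t) *\<^sub>R b) = Exp (t *\<^sub>R b) \<otimes> Exp (t *\<^sub>R b)" for t by (rule two)
  qed
  then show ?thesis using K_eq carr by simp
qed

end

text \<open>A chart of \<open>G/K\<close>, pulled back to the function \<open>h\<close> on an open subset \<open>U\<close> of \<open>G\<close>.\<close>

locale coset_coordinates = symmetric_triple G M \<sigma> K
  for G :: "('g, 'b) monoid_scheme" (structure) and M :: "('g, 'e::euclidean_space) manifold"
    and \<sigma> :: "'g \<Rightarrow> 'g" and K :: "'g set" +
  fixes W :: "'e set" and U :: "'g set" and h :: "'g \<Rightarrow> 'e"
  assumes W: "subspace W" and h_smooth: "smooth_map_on M (linear_manifold W) U h"
    and h_inj: "\<And>x y. x \<in> U \<Longrightarrow> y \<in> U \<Longrightarrow> h x = h y \<Longrightarrow> x <# K = y <# K"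
    and h_onto: "\<And>g. g \<in> U \<Longrightarrow> differential M (linear_manifold W) h g ` tangent_space M g =
                  tangent_space (linear_manifold W) (h g)"
begin

section \<open>Kernel and range of the derivative of a chart of \<open>G/K\<close> pulled back to
  \<open>G\<close>\<close>

lemma W_atlas: "smooth_atlas (linear_manifold W)" using smooth_atlas_linear[OF W] .

lemma U_carrier: "x \<in> U \<Longrightarrow> x \<in> carrier G"
  using openin_subset[OF smooth_map_on_openin[OF h_smooth]] carrier_eq by blast

lemma h_W: "g \<in> U \<Longrightarrow> h g \<in> W" using smooth_map_on_in[OF h_smooth] by simp

lemma W_chart: "linear_chart W \<in> charts (linear_manifold W)" by simp

lemma h_chart: "g \<in> U \<Longrightarrow> h g \<in> cdom (linear_chart W)" using h_W by simp

abbreviation dh :: "('g, 'e) chart \<Rightarrow> 'g \<Rightarrow> 'e \<Rightarrow> 'e" where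
  "dh d g \<equiv> chart_derivative d (linear_chart W) h g"

abbreviation translation :: "('g, 'e) chart \<Rightarrow> 'g \<Rightarrow> 'e \<Rightarrow> 'e" where
  "translation d g \<equiv> chart_derivative c0 d (\<lambda>x. g \<otimes> x) \<one>"

lemma dh_in: "g \<in> U \<Longrightarrow> d \<in> charts M \<Longrightarrow> g \<in> cdom d \<Longrightarrow> v \<in> cspace d \<Longrightarrow> dh d g v \<in> W"
  using smooth_map_on_chart_derivative(2)[OF atlas W_atlas h_smooth _ _ _ W_chart h_chart] by simp

lemma linear_dh: "g \<in> U \<Longrightarrow> d \<in> charts M \<Longrightarrow> g \<in> cdom d \<Longrightarrow> linear (dh d g)"
  using smooth_map_on_chart_derivative(1)[OF atlas W_atlas h_smooth _ _ _ W_chart h_chart] has_derivative_linear by blast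

lemma dh_onto:
  assumes g: "g \<in> U" and d: "d \<in> charts M" "g \<in> cdom d" and w: "w \<in> W"
  shows "\<exists>v\<in>cspace d. dh d g v = w"
proof -
  note lc = W_chart h_chart[OF g]
  have wl: "w \<in> cspace (linear_chart W)" using w by simp
  have "coord_tvec (linear_manifold W) (linear_chart W) (h g) w \<in> tangent_space (linear_manifold W) (h g)"
    using coord_tvec_in_tangent_space[OF W_atlas lc wl] .
  then obtain v where v: "v \<in> tangent_space M g" and
    eq: "differential M (linear_manifold W) h g v = coord_tvec (linear_manifold W) (linear_chart W) (h g) w"
    using h_onto[OF g] by (metis imageE)
  have vd: "v d \<in> cspace d" using tangent_spaceD(1)[OF v d] .
  have dl: "dh d g (v d) \<in> cspace (linear_chart W)" using dh_in[OF g d vd] by simp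
  have "coord_tvec (linear_manifold W) (linear_chart W) (h g) (dh d g (v d)) =
      coord_tvec (linear_manifold W) (linear_chart W) (h g) w"
    using eq differential_eq[OF atlas W_atlas h_smooth g d lc v] by simp
  then have "dh d g (v d) = w" using coord_tvec_self[OF W_atlas lc dl] coord_tvec_self[OF W_atlas lc wl] by metis
  then show ?thesis using vd by blast
qed

context
  fixes g d
  assumes g: "g \<in> carrier G" and d: "d \<in> charts M" "g \<in> cdom d"
begin

lemma translation_in: "v \<in> V \<Longrightarrow> translation d g v \<in> cspace d"
  using smooth_map_on_chart_derivative(2)[OF atlas atlas smooth_left_translation[OF g] _ c0 d(1)] g d carrier_eq by simp

lemma linear_translation: "linear (translation d g)"
  using smooth_map_on_chart_derivative(1)[OF atlas atlas smooth_left_translation[OF g] _ c0 d(1)] g d carrier_eq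
    has_derivative_linear by simp

lemma translation_inverse:
  shows "z \<in> cspace d \<Longrightarrow> translation d g (chart_derivative d c0 (\<lambda>x. inv g \<otimes> x) g z) = z"
    and "v \<in> V \<Longrightarrow> chart_derivative d c0 (\<lambda>x. inv g \<otimes> x) g (translation d g v) = v"
proof -
  have ig: "inv g \<in> carrier G" using g by simp
  have gt: "g \<in> topspace (mtop M)" "inv g \<otimes> g \<in> topspace (mtop M)" "\<one> \<in> topspace (mtop M)" "g \<otimes> \<one> \<in> topspace (mtop M)"
    using g carrier_eq by simp_all
  have ch: "inv g \<otimes> g \<in> cdom c0" "g \<otimes> (inv g \<otimes> g) \<in> cdom d" "g \<otimes> \<one> \<in> cdom d" "inv g \<otimes> (g \<otimes> \<one>) \<in> cdom c0"
    using g d c0 by simp_all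
  have carr: "x \<in> carrier G" if "c \<in> charts M" "x \<in> cdom c" for c x
    using cdom_subset_topspace[OF atlas that] carrier_eq by simp
  show "translation d g (chart_derivative d c0 (\<lambda>x. inv g \<otimes> x) g z) = z" if z: "z \<in> cspace d"
  proof -
    have "chart_derivative d d (\<lambda>x. g \<otimes> (inv g \<otimes> x)) g z = z"
      by (rule chart_derivative_ident[OF atlas d _ z]) (simp add: g carr[OF d(1)] m_assoc[symmetric])
    then show ?thesis
      using chart_derivative_compose[OF atlas atlas atlas smooth_left_translation[OF ig] smooth_left_translation[OF g]
          gt(1,2) d c0(1) ch(1) d(1) ch(2) z] g by simp
  qed
  show "chart_derivative d c0 (\<lambda>x. inv g \<otimes> x) g (translation d g v) = v" if v: "v \<in> V"
  proof -
    have "chart_derivative c0 c0 (\<lambda>x. inv g \<otimes> (g \<otimes> x)) \<one> v = v"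
      by (rule chart_derivative_ident[OF atlas c0 _ v]) (simp add: g carr[OF c0(1)] m_assoc[symmetric])
    then show ?thesis
      using chart_derivative_compose[OF atlas atlas atlas smooth_left_translation[OF g] smooth_left_translation[OF ig]
          gt(3,4) c0 d(1) ch(3) c0(1) ch(4) v] g by simp
  qed
qed

end

text \<open>The level curve with velocity \<open>z\<close> stays in the coset of \<open>g\<close>
  because \<open>h\<close> separates cosets. Translated to the identity it runs in \<open>K\<close>,
  so \<open>\<sigma>\<close> leaves it unchanged, and with it the velocity, for which
  differentiability at 0 suffices.\<close>

lemma kernel_dh:
  assumes g: "g \<in> U" and d: "d \<in> charts M" "g \<in> cdom d" and z: "z \<in> cspace d" "dh d g z = 0"
  obtains b where "b \<in> V" "S b = b" "z = translation d g b"
proof -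
  note dd = atlas_chart[OF atlas d(1)]
  note gc = U_carrier[OF g]
  define A where "A = U \<inter> cdom d"
  have A: "openin (mtop M) A" "A \<subseteq> U \<inter> cdom d" "h ` A \<subseteq> cdom (linear_chart W)" "A \<subseteq> cdom d" "g \<in> A"
    using smooth_map_on_openin[OF h_smooth] chart_openin_cdom[OF dd] h_W g d(2) unfolding A_def by auto
  let ?f = "cmap (linear_chart W) \<circ> h \<circ> cinv d"
  have fA: "?f (cmap d x) = h x" if "x \<in> A" for x using cinv_cmap[OF dd] A(4) that by auto
  have sm: "Ck_on (Suc 0) (cspace d) (cmap d ` A) ?f"
    by (rule smooth_onD[OF smooth_map_on_in_charts[OF atlas W_atlas h_smooth d(1) W_chart A(1,2,3)]])
  have im: "?f ` cmap d ` A \<subseteq> W" using fA h_W A_def by auto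
  have der: "(?f has_derivative dh d g) (at (cmap d g) within cspace d)"
    using smooth_map_on_chart_derivative(1)[OF atlas W_atlas h_smooth g d W_chart h_chart[OF g]] .
  obtain \<eta> e where \<eta>: "\<eta> 0 = cmap d g" "0 < e" "\<And>t. \<bar>t\<bar> < e \<Longrightarrow> \<eta> t \<in> cmap d ` A \<and> ?f (\<eta> t) = ?f (cmap d g)"
    "(\<eta> has_vector_derivative z) (at 0)"
    by (rule level_curve[OF chart_subspace[OF dd] W chart_openin_image[OF dd A(1,4)] sm im imageI[OF A(5)] der
        dh_onto[OF g d] z]) (assumption, blast)
  define \<gamma> where "\<gamma> t = cinv d (\<eta> t)" for t
  have \<gamma>: "\<gamma> t \<in> A" "cmap d (\<gamma> t) = \<eta> t" "h (\<gamma> t) = h g" if t: "\<bar>t\<bar> < e" for t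
  proof -
    obtain x where x: "x \<in> A" "\<eta> t = cmap d x" using \<eta>(3)[OF t] by blast
    then have "\<gamma> t = x" unfolding \<gamma>_def using cinv_cmap[OF dd] A(4) by auto
    then show "\<gamma> t \<in> A" "cmap d (\<gamma> t) = \<eta> t" using x by simp_all
    show "h (\<gamma> t) = h g" using \<eta>(3)[OF t] fA[OF x(1)] fA[OF A(5)] x(2) \<open>\<gamma> t = x\<close> by simp
  qed
  have \<gamma>0: "\<gamma> 0 = g" unfolding \<gamma>_def \<eta>(1) using cinv_cmap[OF dd d(2)] .
  have \<gamma>d: "\<gamma> t \<in> cdom d" if "\<bar>t\<bar> < e" for t using \<gamma>(1)[OF that] A(4) by blast
  have I: "openin (top_of_set (UNIV :: real set)) {-e<..<e}" "0 \<in> {-e<..<e}" using \<eta>(2) by auto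
  have "((\<lambda>t. cmap d (\<gamma> t)) has_derivative (\<lambda>t. t *\<^sub>R z)) (at 0 within UNIV)"
    by (rule has_derivative_transform_relopen[OF I, of \<eta>])
       (use \<gamma>(2) \<eta>(4) in \<open>auto simp: has_vector_derivative_def abs_less_iff\<close>)
  then have vz: "((\<lambda>t. cmap d (\<gamma> t)) has_vector_derivative z) (at 0)" by (simp add: has_vector_derivative_def)
  \<comment> \<open>\<open>curve_at_one\<close> asks for values in the group at all parameters, so
    the curve is continued by the identity.\<close>
  define q where "q t = (if \<bar>t\<bar> < e then inv g \<otimes> \<gamma> t else \<one>)" for t
  have qK: "q t \<in> K" for t
  proof (cases "\<bar>t\<bar> < e")
    case True
    have \<gamma>U: "\<gamma> t \<in> U" using \<gamma>(1)[OF True] by (simp add: A_def)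
    have "inv g \<otimes> \<gamma> t \<in> K" by (rule lcoset_eqD[OF U_carrier[OF \<gamma>U] gc h_inj[OF \<gamma>U g \<gamma>(3)[OF True]]])
    then show ?thesis using True by (simp add: q_def)
  next
    case False
    then show ?thesis using subgroup.one_closed[OF subgroup_K] by (auto simp: q_def)
  qed
  have tr: "smooth_map M M (\<lambda>x. inv g \<otimes> x)" by (rule smooth_left_translation) (simp add: gc)
  have \<gamma>t: "\<gamma> 0 \<in> topspace (mtop M)" using \<gamma>0 gc carrier_eq by simp
  have tr0: "inv g \<otimes> \<gamma> 0 \<in> cdom c0" using \<gamma>0 gc c0 by simp
  let ?b = "chart_derivative d c0 (\<lambda>x. inv g \<otimes> x) g z"
  have "((\<lambda>t. cmap c0 (inv g \<otimes> \<gamma> t)) has_vector_derivative ?b) (at 0)"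
    using has_vector_derivative_in_charts(2)[OF atlas atlas tr \<gamma>t d(1) c0(1) tr0 vz \<eta>(2) \<gamma>d] unfolding \<gamma>0 .
  then have "((\<lambda>t. cmap c0 (inv g \<otimes> \<gamma> t)) has_derivative (\<lambda>t. t *\<^sub>R ?b)) (at 0 within UNIV)"
    by (simp add: has_vector_derivative_def)
  then have "((\<lambda>t. cmap c0 (q t)) has_derivative (\<lambda>t. t *\<^sub>R ?b)) (at 0 within UNIV)"
    by (rule has_derivative_transform_relopen[OF I, rotated]) (auto simp: q_def abs_less_iff)
  then have vq: "((\<lambda>t. cmap c0 (q t)) has_vector_derivative ?b) (at 0)" by (simp add: has_vector_derivative_def)
  have O: "openin (mtop M) {x \<in> topspace (mtop M). inv g \<otimes> x \<in> cdom c0}"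
    by (rule smooth_map_on_openin_preimage[OF atlas atlas tr chart_openin_cdom[OF is_chart_c0]])
  have O0: "\<gamma> 0 \<in> {x \<in> topspace (mtop M). inv g \<otimes> x \<in> cdom c0}" using \<gamma>t tr0 by simp
  obtain r where r: "r > 0" "\<And>t. \<bar>t\<bar> < r \<Longrightarrow> \<gamma> t \<in> {x \<in> topspace (mtop M). inv g \<otimes> x \<in> cdom c0}"
    by (rule chart_curve_in_open[where \<gamma> = \<gamma>, OF dd O O0 \<eta>(2) \<gamma>d has_vector_derivative_continuous[OF vz]]) blast+
  have "q t \<in> cdom c0" if "\<bar>t\<bar> < r" for t using r(2)[OF that] c0(2) by (simp add: q_def)
  moreover have "q t \<in> carrier G" for t using qK K_eq by simp
  moreover have "q 0 = \<one>" using \<eta>(2) \<gamma>0 gc by (simp add: q_def)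
  ultimately have cq: "curve_at_one q ?b" unfolding curve_at_one_def using vq r(1) by blast
  have "\<sigma> (q t) = q t" for t using qK K_eq by simp
  then have "S ?b = ?b" using curve_at_one_unique[OF curve_at_one_\<sigma>[OF cq]] cq by simp
  moreover have "z = translation d g ?b" using translation_inverse(1)[OF gc d z(1)] by simp
  ultimately show thesis using that curve_at_one_velocity[OF cq] by blast
qed

text \<open>Translation followed by the derivative of \<open>h\<close> is injective on
  \<open>p0\<close>: a vector in its kernel is fixed by \<open>S\<close> and also negated by it,
  hence 0.\<close>

lemma dim_p0_le:
  assumes g: "g \<in> U"
  shows "dim p0 \<le> dim W"
proof -
  note gc = U_carrier[OF g]
  obtain d where d: "d \<in> charts M" "g \<in> cdom d" using atlas_cover[OF atlas, of g] gc carrier_eq by auto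
  let ?T = "\<lambda>v. dh d g (translation d g v)"
  have lin: "linear ?T"
    using linear_compose[OF linear_translation[OF gc d] linear_dh[OF g d]] by (simp add: comp_def)
  have inj: "inj_on ?T p0"
  proof (rule inj_onI)
    fix x y assume xy: "x \<in> p0" "y \<in> p0" "?T x = ?T y"
    let ?v = "x - y"
    have v: "?v \<in> p0" using subspace_diff[OF subspace_p0 xy(1,2)] .
    have vV: "?v \<in> V" using v p0_V by blast
    have "?T ?v = 0" using linear_diff[OF lin] xy(3) by simp
    from kernel_dh[OF g d translation_in[OF gc d vV] this]
    obtain b where b: "b \<in> V" "S b = b" "translation d g ?v = translation d g b" by metis
    have "?v = b" using translation_inverse(2)[OF gc d vV] translation_inverse(2)[OF gc d b(1)] b(3) by metis
    then have "?v = - ?v" using b(2) v by (simp add: p0_def)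
    then have "2 *\<^sub>R ?v = 0" by (metis scaleR_2 add.right_inverse)
    then show "x = y" by simp
  qed
  have "dim p0 = dim (?T ` p0)"
    using dim_image_eq[OF lin, of p0] inj subspace_p0 by (simp add: span_eq_iff[THEN iffD2])
  also have "\<dots> \<le> dim W"
    by (rule dim_subset) (use dh_in[OF g d] translation_in[OF gc d] p0_V in blast)
  finally show ?thesis .
qed

text \<open>Converse to \<open>kernel_dh\<close>, which only produced curves differentiable at one
  point: the translated ray of a fixed vector is smooth and, by \<open>Exp_fixed\<close>, stays in
  the coset.\<close>

lemma smooth_curve_in_coset:
  assumes p: "p \<in> carrier G" and d: "d \<in> charts M" "p \<in> cdom d" and b: "b \<in> V" "S b = b"
  shows "coord_tvec M d p (translation d p b) \<in> submanifold_tangent_space M (p <# K) p"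
proof -
  let ?k = "\<lambda>t. Exp (t *\<^sub>R b)" and ?\<gamma> = "\<lambda>t. p \<otimes> Exp (t *\<^sub>R b)"
  note kc = Exp_curve[OF b(1)]
  have ksm: "smooth_map_on real_line M UNIV ?k"
  proof (rule smooth_map_on_compose[OF real_atlas V_atlas _ smooth_Exp])
    show "smooth_map_on real_line (linear_manifold V) UNIV (\<lambda>t. t *\<^sub>R b)"
      by (rule smooth_map_on_linearI[OF subspace_UNIV _ smooth_on_bounded_linear[OF bounded_linear_scaleR_left]])
         (use subspace_scale[OF V b(1)] in auto)
    show "t *\<^sub>R b \<in> topspace (mtop (linear_manifold V))" for t using subspace_scale[OF V b(1)] by simp
  qed
  have sm: "smooth_map_on real_line M UNIV ?\<gamma>"
    by (rule smooth_map_on_compose[OF real_atlas atlas ksm smooth_left_translation[OF p]])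
       (use smooth_map_on_in[OF ksm] in blast)
  have k0: "?k 0 = \<one>" using kc unfolding curve_at_one_def by blast
  then have \<gamma>0: "?\<gamma> 0 = p" using p by simp
  have \<gamma>d: "?\<gamma> 0 \<in> cdom d" using \<gamma>0 d by simp
  obtain w where w: "((\<lambda>t. cmap d (?\<gamma> t)) has_vector_derivative w) (at 0)"
    "velocity M ?\<gamma> 0 = coord_tvec M d (?\<gamma> 0) w"
    by (rule smooth_curve_velocity[OF atlas sm open_UNIV UNIV_I d(1) \<gamma>d]) blast
  obtain e where e: "e > 0" "\<And>t. \<bar>t\<bar> < e \<Longrightarrow> ?k t \<in> cdom c0" and
    vb: "((\<lambda>t. cmap c0 (?k t)) has_vector_derivative b) (at 0)" using kc unfolding curve_at_one_def by blast
  have kt: "?k 0 \<in> topspace (mtop M)" using k0 carrier_eq by simp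
  have "((\<lambda>t. cmap d (?\<gamma> t)) has_vector_derivative translation d p b) (at 0)"
    using has_vector_derivative_in_charts(2)[where \<gamma> = ?k, OF atlas atlas smooth_left_translation[OF p] kt c0(1) d(1) \<gamma>d vb e]
    unfolding k0 .
  then have "w = translation d p b" using w(1) vector_derivative_unique_at by blast
  then have vel: "velocity M ?\<gamma> 0 = coord_tvec M d p (translation d p b)" using w(2) unfolding \<gamma>0 by simp
  have "smooth_map_on real_line M {-1<..<1} ?\<gamma>" by (rule smooth_map_on_subset[OF sm]) auto
  moreover have "?\<gamma> ` {-1<..<1} \<subseteq> p <# K" using Exp_fixed[OF b] by (auto simp: l_coset_def)
  ultimately show ?thesis
    unfolding submanifold_tangent_space_def using vel \<gamma>0
    by (intro CollectI exI[of _ ?\<gamma>] conjI exI[of _ 1]) auto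
qed

section \<open>Regular points and the exceptional set in one chart\<close>

definition regular_domain :: "'e set" where "regular_domain = {a \<in> V. Exp a \<in> U}"

lemma regular_domain: "openin (top_of_set V) regular_domain" "regular_domain \<subseteq> V"
  and smooth_h_Exp: "smooth_on V regular_domain (\<lambda>a. h (Exp a))"
proof -
  show o: "openin (top_of_set V) regular_domain"
    using smooth_map_on_openin_preimage[OF V_atlas atlas smooth_Exp smooth_map_on_openin[OF h_smooth]]
    by (simp add: regular_domain_def)
  show "regular_domain \<subseteq> V" by (auto simp: regular_domain_def)
  have "smooth_map_on (linear_manifold V) M regular_domain Exp"
    by (rule smooth_map_on_subset[OF smooth_Exp]) (use o in \<open>auto simp: regular_domain_def\<close>)
  from smooth_map_on_compose[OF V_atlas atlas this h_smooth]
  have "smooth_map_on (linear_manifold V) (linear_manifold W) regular_domain (\<lambda>a. h (Exp a))"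
    by (simp add: regular_domain_def)
  from smooth_map_on_linear_domain[OF V W_atlas this W_chart o]
  show "smooth_on V regular_domain (\<lambda>a. h (Exp a))"
    using h_W by (force simp: regular_domain_def)
qed

lemma regular_imp_transversal_at:
  assumes a: "a \<in> p0" "Exp a \<in> U" and F: "((\<lambda>a. h (Exp a)) has_derivative F') (at a within V)"
    and onto: "W \<subseteq> F' ` p0"
  shows "submanifold_tangent_space M (Exp ` p0) (Exp a) + submanifold_tangent_space M (Exp a <# K) (Exp a) =
    tangent_space M (Exp a)"
proof (rule equalityI)
  let ?p = "Exp a"
  note pc = U_carrier[OF a(2)]
  have aV: "a \<in> V" using a(1) p0_V by blast
  have ptop: "?p \<in> topspace (mtop M)" using pc carrier_eq by simp
  obtain d where d: "d \<in> charts M" "?p \<in> cdom d" using atlas_cover[OF atlas ptop] by metis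
  show "submanifold_tangent_space M (Exp ` p0) ?p + submanifold_tangent_space M (?p <# K) ?p \<subseteq> tangent_space M ?p"
  proof
    have sub: "submanifold_tangent_space M T ?p \<subseteq> tangent_space M ?p" for T
    proof
      fix v assume "v \<in> submanifold_tangent_space M T ?p"
      then obtain \<gamma> e where "v = velocity M \<gamma> 0" "\<gamma> 0 = ?p" "e > 0" "smooth_map_on real_line M {-e<..<e} \<gamma>"
        unfolding submanifold_tangent_space_def by blast
      then show "v \<in> tangent_space M ?p" using velocity_in_tangent_space[OF atlas, of "{-e<..<e}" \<gamma>] by simp
    qed
    fix v assume "v \<in> submanifold_tangent_space M (Exp ` p0) ?p + submanifold_tangent_space M (?p <# K) ?p"
    then obtain v1 v2 where "v1 \<in> tangent_space M ?p" "v2 \<in> tangent_space M ?p" "v = v1 + v2"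
      using sub by (elim set_plus_elim) blast
    then show "v \<in> tangent_space M ?p" using tangent_space_add[OF atlas _ _ ptop] by simp
  qed
  show "tangent_space M ?p \<subseteq> submanifold_tangent_space M (Exp ` p0) ?p + submanifold_tangent_space M (?p <# K) ?p"
  proof
    fix v assume v: "v \<in> tangent_space M ?p"
    note vd = tangent_spaceD[OF v d]
    obtain Y where Y: "Y \<in> p0" "F' Y = dh d ?p (v d)" using onto dh_in[OF a(2) d vd(1)] by (metis imageE subsetD)
    have YV: "Y \<in> V" using Y(1) p0_V by blast
    \<comment> \<open>Since \<open>p0\<close> is a subspace, the affine line stays in it and its
      image is a curve in \<open>P\<close>; the tangent space of \<open>P\<close> is entered only
      through such curves.\<close>
    have line: "a + t *\<^sub>R Y \<in> p0" for t using subspace_add[OF subspace_p0 a(1) subspace_scale[OF subspace_p0 Y(1)]] .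
    have lineV: "a + t *\<^sub>R Y \<in> V" for t using line p0_V by blast
    let ?\<gamma> = "\<lambda>t. Exp (a + t *\<^sub>R Y)"
    have sm: "smooth_map_on real_line M UNIV ?\<gamma>"
    proof (rule smooth_map_on_compose[OF real_atlas V_atlas _ smooth_Exp])
      show "smooth_map_on real_line (linear_manifold V) UNIV (\<lambda>t. a + t *\<^sub>R Y)"
        by (rule smooth_map_on_linearI[OF subspace_UNIV _ smooth_on_add[OF smooth_on_const
              smooth_on_bounded_linear[OF bounded_linear_scaleR_left]]]) (use lineV in auto)
      show "a + t *\<^sub>R Y \<in> topspace (mtop (linear_manifold V))" for t using lineV by simp
    qed
    have \<gamma>0: "?\<gamma> 0 = ?p" by simp
    have \<gamma>d: "?\<gamma> 0 \<in> cdom d" using d by simp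
    obtain w e where w: "w \<in> cspace d" "((\<lambda>t. cmap d (?\<gamma> t)) has_vector_derivative w) (at 0)"
      "velocity M ?\<gamma> 0 = coord_tvec M d (?\<gamma> 0) w" and e: "0 < e" "\<And>t. \<bar>t\<bar> < e \<Longrightarrow> ?\<gamma> t \<in> cdom d"
      by (rule smooth_curve_velocity[OF atlas sm open_UNIV UNIV_I d(1) \<gamma>d]) blast
    have \<gamma>U: "?\<gamma> 0 \<in> U" "h (?\<gamma> 0) \<in> cdom (linear_chart W)" using a(2) h_W by simp_all
    have "((\<lambda>t. cmap (linear_chart W) (h (?\<gamma> t))) has_vector_derivative dh d (?\<gamma> 0) w) (at 0)"
      using has_vector_derivative_in_charts(2)[where \<gamma> = ?\<gamma>, OF atlas W_atlas h_smooth \<gamma>U(1) d(1) W_chart \<gamma>U(2) w(2) e] .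
    then have 1: "((\<lambda>t. h (?\<gamma> t)) has_vector_derivative dh d ?p w) (at 0)" by simp
    have ld: "((\<lambda>t. a + t *\<^sub>R Y) has_derivative (\<lambda>t. t *\<^sub>R Y)) (at (0::real))" by (auto intro!: derivative_eq_intros)
    have "((\<lambda>a. h (Exp a)) has_derivative F') (at (a + 0 *\<^sub>R Y) within range (\<lambda>t::real. a + t *\<^sub>R Y))"
      using has_derivative_subset[OF F, of "range (\<lambda>t::real. a + t *\<^sub>R Y)"] lineV by auto
    from has_derivative_in_compose[OF ld this]
    have "((\<lambda>t. h (?\<gamma> t)) has_derivative (\<lambda>t. F' (t *\<^sub>R Y))) (at (0::real))" .
    then have "((\<lambda>t. h (?\<gamma> t)) has_vector_derivative F' Y) (at 0)"
      using linear_scale[OF has_derivative_linear[OF F]] by (simp add: has_vector_derivative_def)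
    then have eq: "dh d ?p w = F' Y" using 1 vector_derivative_unique_at by blast
    \<comment> \<open>\<open>Y\<close> was chosen so that \<open>w\<close> and the coordinates of
      \<open>v\<close> have the same image under the derivative of \<open>h\<close>; their
      difference is therefore a kernel vector, tangent to the coset.\<close>
    define z where "z = v d - w"
    have z: "z \<in> cspace d"
      unfolding z_def using subspace_diff[OF chart_subspace[OF atlas_chart[OF atlas d(1)]] vd(1) w(1)] .
    have "dh d ?p z = 0" unfolding z_def using linear_diff[OF linear_dh[OF a(2) d]] eq Y(2) by simp
    from kernel_dh[OF a(2) d z this] obtain b where b: "b \<in> V" "S b = b" "z = translation d ?p b" by metis
    have 2: "coord_tvec M d ?p z \<in> submanifold_tangent_space M (?p <# K) ?p"
      using smooth_curve_in_coset[OF pc d b(1,2)] b(3) by simp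
    have "smooth_map_on real_line M {-1<..<1} ?\<gamma>" by (rule smooth_map_on_subset[OF sm]) auto
    moreover have "?\<gamma> ` {-1<..<1} \<subseteq> Exp ` p0" using line by blast
    ultimately have 3: "coord_tvec M d ?p w \<in> submanifold_tangent_space M (Exp ` p0) ?p"
      unfolding submanifold_tangent_space_def using w(3) \<gamma>0
      by (intro CollectI exI[of _ ?\<gamma>] conjI exI[of _ 1]) auto
    have "v = coord_tvec M d ?p w + coord_tvec M d ?p z"
      unfolding coord_tvec_add[OF atlas d, symmetric] z_def using vd(2) by simp
    then show "v \<in> submanifold_tangent_space M (Exp ` p0) ?p + submanifold_tangent_space M (?p <# K) ?p"
      using set_plus_intro[OF 3 2] by simp
  qed
qed

lemma null_nontransversal:
  "null_in_subspace W (h ` {Exp a |a. a \<in> p0 \<and> Exp a \<in> U \<and>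
     submanifold_tangent_space M (Exp ` p0) (Exp a) + submanifold_tangent_space M (Exp a <# K) (Exp a) \<noteq>
       tangent_space M (Exp a)})" (is "null_in_subspace W (h ` ?N)")
proof (cases "U = {}")
  case True
  then have e: "h ` ?N = {}" by blast
  have "({} :: 'e set) + orthogonal_comp W = {}" by (auto elim: set_plus_elim)
  then have "null_in_subspace W {}" unfolding null_in_subspace_def by simp
  then show ?thesis by (simp only: e)
next
  \<comment> \<open>The dimension bound is derived at a point of \<open>U\<close>, hence the
    separate treatment of the empty domain.\<close>
  case False
  then obtain g where g: "g \<in> U" by blast
  let ?F = "\<lambda>a. h (Exp a)"
  obtain F' where F': "\<And>a. a \<in> regular_domain \<Longrightarrow> (?F has_derivative F' a) (at a within V)"
    using smooth_on_obtain_derivative[OF V regular_domain(1) smooth_h_Exp] by metis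
  define C where "C = {a \<in> p0 \<inter> regular_domain. \<not> W \<subseteq> F' a ` p0}"
  have FW: "?F ` regular_domain \<subseteq> W" using h_W by (auto simp: regular_domain_def)
  have CV: "C \<subseteq> V" "C \<subseteq> regular_domain" using p0_V by (auto simp: C_def)
  have "null_in_subspace W (?F ` C)"
  proof (rule null_critical_values_subspace[OF subspace_p0 W dim_p0_le[OF g], where f' = F'])
    show "C \<subseteq> p0" by (auto simp: C_def)
    fix a assume a: "a \<in> C"
    then have ar: "a \<in> regular_domain" using CV by blast
    show "(?F has_derivative F' a) (at a within C)" by (rule has_derivative_subset[OF F'[OF ar] CV(1)])
    show "?F a \<in> W" using FW ar by blast
    show "F' a v \<in> W" if "v \<in> p0" for v
      by (rule has_derivative_value_in_subspace[OF V W regular_domain(1) ar FW F'[OF ar]]) (use that p0_V in blast)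
    show "\<not> W \<subseteq> F' a ` p0" using a by (simp add: C_def)
  qed
  moreover have "h ` ?N \<subseteq> ?F ` C"
  proof
    fix y assume "y \<in> h ` ?N"
    then obtain a where a: "a \<in> p0" "Exp a \<in> U" "y = h (Exp a)" and
      ne: "submanifold_tangent_space M (Exp ` p0) (Exp a) + submanifold_tangent_space M (Exp a <# K) (Exp a) \<noteq>
       tangent_space M (Exp a)" by blast
    have ar: "a \<in> regular_domain" using a p0_V by (auto simp: regular_domain_def)
    have "\<not> W \<subseteq> F' a ` p0" using regular_imp_transversal_at[OF a(1,2) F'[OF ar]] ne by blast
    then have "a \<in> C" using a(1) ar by (simp add: C_def)
    then show "y \<in> ?F ` C" using a(3) by blast
  qed
  ultimately show ?thesis
    unfolding null_in_subspace_def by (meson negligible_subset order_trans set_plus_mono2 order_refl)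
qed

end

section \<open>The exceptional cosets over all charts of \<open>G/K\<close>\<close>

lemma topspace_coset_topology:
  assumes "topspace T = carrier G"
  shows "lcosets\<^bsub>G\<^esub> K \<subseteq> topspace (coset_topology G T K)"
proof -
  have "{g \<in> carrier G. g <#\<^bsub>G\<^esub> K \<in> lcosets\<^bsub>G\<^esub> K} = topspace T" using assms by (auto simp: LCOSETS_def)
  then have "openin (coset_topology G T K) (lcosets\<^bsub>G\<^esub> K)" unfolding openin_coset_topology[OF assms] by simp
  then show ?thesis by (rule openin_subset)
qed

theorem theorem3p5:
  fixes G :: "('g, 'b) monoid_scheme"
    and M :: "('g, 'e::euclidean_space) manifold"
    and \<sigma> :: "'g \<Rightarrow> 'g"
    and K P :: "'g set"
  assumes "riemannian_symmetric_triple G M \<sigma> K"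
    and "P = lie_exp G M ` minus_eigenspace G M \<sigma>"
  shows "\<exists>N. measure_zero (coset_manifold G M K) N \<and>
             (\<forall>C \<in> lcosets\<^bsub>G\<^esub> K - N. transversal M C P)"
proof -
  have T: "lie_group G M" "\<sigma> \<in> iso G G" "smooth_map M M \<sigma>" "K = {g \<in> carrier G. \<sigma> g = g}"
    using assms(1) unfolding riemannian_symmetric_triple_def by blast+
  interpret symmetric_triple G M \<sigma> K
    by unfold_locales (use T iso_imp_homomorphism in auto)
  have P: "P = Exp ` p0" using assms(2) lie_exp_minus_eigenspace by simp
  \<comment> \<open>The set of all bad cosets itself. \<open>measure_zero\<close> asks for a null
    image in each chart separately, so the charts can be treated one at a time.\<close>
  define N where "N = {C \<in> lcosets\<^bsub>G\<^esub> K. \<not> transversal M C P}"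
  have "null_in_subspace (cspace c) (cmap c ` (N \<inter> cdom c))" if c: "c \<in> charts (coset_manifold G M K)" for c
  proof -
    let ?U = "{g \<in> carrier G. g <#\<^bsub>G\<^esub> K \<in> cdom c}" and ?h = "\<lambda>g. cmap c (g <#\<^bsub>G\<^esub> K)"
    have cc: "is_chart (coset_topology G (mtop M) K) c"
      and sub: "submersion_on M (linear_manifold (cspace c)) ?U ?h"
      using c by (auto simp: coset_manifold_def)
    interpret coset_coordinates G M \<sigma> K "cspace c" ?U ?h
    proof
      show "subspace (cspace c)" using chart_subspace[OF cc] .
      show "smooth_map_on M (linear_manifold (cspace c)) ?U ?h" using sub by (simp add: submersion_on_def)
      show "x <#\<^bsub>G\<^esub> K = y <#\<^bsub>G\<^esub> K" if "x \<in> ?U" "y \<in> ?U" "?h x = ?h y" for x y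
        using inj_onD[OF chart_inj[OF cc] that(3)] that by simp
      show "differential M (linear_manifold (cspace c)) ?h g ` tangent_space M g =
          tangent_space (linear_manifold (cspace c)) (?h g)" if "g \<in> ?U" for g
        using sub that unfolding submersion_on_def by blast
    qed
    let ?N = "{Exp a |a. a \<in> p0 \<and> Exp a \<in> ?U \<and>
       submanifold_tangent_space M (Exp ` p0) (Exp a) + submanifold_tangent_space M (Exp a <#\<^bsub>G\<^esub> K) (Exp a) \<noteq>
       tangent_space M (Exp a)}"
    have "cmap c ` (N \<inter> cdom c) \<subseteq> ?h ` ?N"
    proof
      fix y assume "y \<in> cmap c ` (N \<inter> cdom c)"
      then obtain C where C: "C \<in> lcosets\<^bsub>G\<^esub> K" "\<not> transversal M C P" "C \<in> cdom c" "y = cmap c C"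
        by (auto simp: N_def)
      then obtain a where a: "a \<in> p0" "Exp a \<in> C" and
        ne: "submanifold_tangent_space M P (Exp a) + submanifold_tangent_space M C (Exp a) \<noteq> tangent_space M (Exp a)"
        unfolding transversal_def P by blast
      have ac: "Exp a \<in> carrier G" using lcosets_part_G[OF subgroup_K] C(1) a(2) by blast
      obtain g where g: "g \<in> carrier G" "C = g <#\<^bsub>G\<^esub> K" using C(1) by (auto simp: LCOSETS_def)
      \<comment> \<open>A bad coset is represented by the very point of \<open>P\<close> at which
        transversality fails, so its chart image is a value of \<open>?h\<close> on
        \<open>?N\<close>.\<close>
      have "C = Exp a <#\<^bsub>G\<^esub> K" using l_repr_independence[OF _ g(1) subgroup_K] a(2) g(2) by simp
      then have "Exp a \<in> ?N" "y = ?h (Exp a)" using a(1) ac C(3,4) ne unfolding P by auto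
      then show "y \<in> ?h ` ?N" by blast
    qed
    then show ?thesis
      using null_nontransversal unfolding null_in_subspace_def
      by (meson negligible_subset order_trans set_plus_mono2 order_refl)
  qed
  moreover have "N \<subseteq> topspace (mtop (coset_manifold G M K))"
    using topspace_coset_topology[OF carrier_eq] by (auto simp: N_def coset_manifold_def)
  ultimately have "measure_zero (coset_manifold G M K) N" by (simp add: measure_zero_def)
  then show ?thesis by (auto simp: N_def)
qed

end
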